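(* Let $(R,\mathfrak m,k)$ be a $3$-dimensional regular local ring (respectively, a standard graded polynomial ring in $3$ variables over a field $k$ with homogeneous maximal ideal $\mathfrak m$), and let $I$ be a proper ideal of $R$ (homogeneous in the graded case). Then $R/I\mathfrak m$ is a Golod ring.
   Context: Let $(A,\mathfrak n,k)$ be a local ring, or a standard graded $k$-algebra with homogeneous maximal ideal $\mathfrak n$. Let $K^A$ be the Koszul complex over $A$ on a minimal set of generators of $\mathfrak n$; it is a DG-algebra with $H_0(K^A)\cong k$. For a homogeneous element $a$ of a DG-algebra put $\overline a:=(-1)^{|a|+1}a$, where $|a|$ is the homological degree. A DG-algebra $B$ with $H_0(B)\cong k$ admits a trivial Massey operation if for some homogeneous $k$-basis $\mathcal B=\{h_\lambda\}_{\lambda\in\Lambda}$ of $H_{\ge 1}(B)$ there is a function $\mu:\coprod_{i=1}^\infty \mathcal B^i\to B$ such that $\mu(h_\lambda)=z_\lambda$ is a cycle with homology class $[z_\lambda]=h_\lambda$, and $d\mu(h_{\lambda_1},\dots,h_{\lambda_p})=\sum_{j=1}^{p-1}\overline{\mu(h_{\lambda_1},\dots,h_{\lambda_j})}\,\mu(h_{\lambda_{j+1}},\dots,h_{\lambda_p})$ for all $p\ge 2$. The ring $A$ is called Golod if $K^A$ admits a trivial Massey operation. *)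

theory Defs
  imports
    "HOL-Algebra.Algebra"
    "HOL-Library.Extended_Nat"
begin

section \<open>Local rings, dimension, regularity\<close>

locale local_ring = noetherian_ring R + cring R for R (structure) +
  assumes ex1_maximal: "\<exists>!m. maximalideal m R"

definition maximal_ideal :: "('a, 'm) ring_scheme \<Rightarrow> 'a set" where
  "maximal_ideal R = (THE m. maximalideal m R)"

definition krull_dim :: "('a, 'm) ring_scheme \<Rightarrow> enat" where
  "krull_dim R = Sup {enat n | n. \<exists>P :: nat \<Rightarrow> 'a set.
     (\<forall>i\<le>n. primeideal (P i) R) \<and> (\<forall>i<n. P i \<subset> P (Suc i))}"

definition embedding_dim :: "('a, 'm) ring_scheme \<Rightarrow> nat" where
  "embedding_dim R = (LEAST n. \<exists>Y. Y \<subseteq> carrier R \<and> finite Y \<and> card Y = n \<and>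
     genideal R Y = maximal_ideal R)"

locale regular_local_ring = local_ring +
  assumes regular: "enat (embedding_dim R) = krull_dim R"

text \<open>Minimality is with respect to inclusion. The list only fixes an ordering of the generators,
  which is needed for the signs in the Koszul complex.\<close>

definition minimal_generators :: "('a, 'm) ring_scheme \<Rightarrow> 'a set \<Rightarrow> 'a list \<Rightarrow> bool" where
  "minimal_generators R N xs \<longleftrightarrow>
     distinct xs \<and> set xs \<subseteq> carrier R \<and> genideal R (set xs) = N \<and>
     (\<forall>Y. Y \<subset> set xs \<longrightarrow> genideal R Y \<noteq> N)"


section \<open>Graded rings\<close>

text \<open>A grading of a ring is given by the family \<open>G\<close> of its homogeneous components.\<close>

definition homogeneous_ideal ::
    "('a, 'm) ring_scheme \<Rightarrow> (nat \<Rightarrow> 'a set) \<Rightarrow> 'a set \<Rightarrow> bool" where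
  "homogeneous_ideal R G I \<longleftrightarrow> ideal I R \<and> I = genideal R (I \<inter> (\<Union>d. G d))"

text \<open>The homogeneous maximal ideal of a standard graded algebra over a field.\<close>

definition irrelevant_ideal :: "('a, 'm) ring_scheme \<Rightarrow> (nat \<Rightarrow> 'a set) \<Rightarrow> 'a set" where
  "irrelevant_ideal R G = genideal R (\<Union>d\<in>{1..}. G d)"

definition quotient_grading ::
    "('a, 'm) ring_scheme \<Rightarrow> (nat \<Rightarrow> 'a set) \<Rightarrow> 'a set \<Rightarrow> nat \<Rightarrow> 'a set set" where
  "quotient_grading R G I d = (\<lambda>r. I +>\<^bsub>R\<^esub> r) ` G d"

text \<open>The polynomial ring \<open>K[x, y, z]\<close> as \<open>K[z][y][x]\<close>, with its standard grading.\<close>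

abbreviation poly3 ::
    "('a, 'm) ring_scheme \<Rightarrow> (nat \<Rightarrow> nat \<Rightarrow> 'a, nat \<Rightarrow> nat \<Rightarrow> nat \<Rightarrow> 'a) up_ring" where
  "poly3 K \<equiv> UP (UP (UP K))"

definition poly3_coeff ::
    "('a, 'm) ring_scheme \<Rightarrow> (nat \<Rightarrow> nat \<Rightarrow> nat \<Rightarrow> 'a) \<Rightarrow> nat \<Rightarrow> nat \<Rightarrow> nat \<Rightarrow> 'a" where
  "poly3_coeff K p i j l =
     coeff (UP K) (coeff (UP (UP K)) (coeff (UP (UP (UP K))) p i) j) l"

definition poly3_grading ::
    "('a, 'm) ring_scheme \<Rightarrow> nat \<Rightarrow> (nat \<Rightarrow> nat \<Rightarrow> nat \<Rightarrow> 'a) set" where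
  "poly3_grading K d = {p \<in> carrier (poly3 K).
     \<forall>i j l. i + j + l \<noteq> d \<longrightarrow> poly3_coeff K p i j l = \<zero>\<^bsub>K\<^esub>}"


section \<open>DG-algebras and trivial Massey operations\<close>

text \<open>The data of a DG-algebra: a ring, its homogeneous components and a differential
  (of homological degree \<open>-1\<close>).\<close>

record 'a dg_algebra = "'a ring" +
  component :: "nat \<Rightarrow> 'a set"
  differential :: "'a \<Rightarrow> 'a"

definition cycles :: "('a, 'm) dg_algebra_scheme \<Rightarrow> 'a set" where
  "cycles B = {z \<in> carrier B. differential B z = \<zero>\<^bsub>B\<^esub>}"

definition boundaries :: "('a, 'm) dg_algebra_scheme \<Rightarrow> 'a set" where
  "boundaries B = differential B ` carrier B"

definition homology_class :: "('a, 'm) dg_algebra_scheme \<Rightarrow> 'a \<Rightarrow> 'a set" where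
  "homology_class B z = boundaries B +>\<^bsub>B\<^esub> z"

definition homology_ring :: "('a, 'm) dg_algebra_scheme \<Rightarrow> 'a set ring" where
  "homology_ring B = (B\<lparr>carrier := cycles B\<rparr>) Quot (boundaries B)"

definition homology :: "('a, 'm) dg_algebra_scheme \<Rightarrow> nat \<Rightarrow> 'a set set" where
  "homology B i = homology_class B ` (cycles B \<inter> component B i)"

text \<open>The direct sum of the \<open>homology B i\<close> for \<open>i \<ge> 1\<close>.\<close>

definition positive_homology :: "('a, 'm) dg_algebra_scheme \<Rightarrow> 'a set set" where
  "positive_homology B = generate (add_monoid (homology_ring B)) (\<Union>i\<in>{1..}. homology B i)"

text \<open>\<open>Y\<close> is a (possibly infinite) basis of \<open>V\<close> over the subfield \<open>F\<close> of \<open>S\<close>;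
  \<open>ring.independent\<close> and \<open>ring.Span\<close> are about finite lists.\<close>

definition basis_over :: "('a, 'm) ring_scheme \<Rightarrow> 'a set \<Rightarrow> 'a set \<Rightarrow> 'a set \<Rightarrow> bool" where
  "basis_over S F V Y \<longleftrightarrow>
     (\<forall>us\<in>lists Y. distinct us \<longrightarrow> ring.independent S F us) \<and>
     V = (\<Union>us\<in>lists Y. ring.Span S F us)"

text \<open>The residue field acts on the homology through its identification with the subring
  \<open>homology B 0\<close> of the homology ring.\<close>

definition homogeneous_basis :: "('a, 'm) dg_algebra_scheme \<Rightarrow> 'a set set \<Rightarrow> bool" where
  "homogeneous_basis B Y \<longleftrightarrow>
     Y \<subseteq> (\<Union>i\<in>{1..}. homology B i) \<and>
     basis_over (homology_ring B) (homology B 0) (positive_homology B) Y"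

definition neg_pow :: "('a, 'm) ring_scheme \<Rightarrow> nat \<Rightarrow> 'a" where
  "neg_pow A k = (\<ominus>\<^bsub>A\<^esub> \<one>\<^bsub>A\<^esub>) [^]\<^bsub>A\<^esub> k"

text \<open>\<open>sgn_bar B a = (-1)\<^bsup>|a| + 1\<^esup> a\<close> for homogeneous \<open>a\<close>. The choice of the degree of
  \<open>a = \<zero>\<close>, which lies in every component, is immaterial.\<close>

definition hdegree :: "('a, 'm) dg_algebra_scheme \<Rightarrow> 'a \<Rightarrow> nat" where
  "hdegree B a = (LEAST i. a \<in> component B i)"

definition sgn_bar :: "('a, 'm) dg_algebra_scheme \<Rightarrow> 'a \<Rightarrow> 'a" where
  "sgn_bar B a = neg_pow B (hdegree B a + 1) \<otimes>\<^bsub>B\<^esub> a"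

text \<open>The tuples \<open>(h\<^sub>1, \<dots>, h\<^sub>p)\<close> with \<open>p \<ge> 1\<close> are the nonempty lists over \<open>Y\<close>. The
  values of \<open>\<mu>\<close> are homogeneous, as the use of \<open>sgn_bar\<close> requires.\<close>

definition trivial_massey_operation ::
    "('a, 'm) dg_algebra_scheme \<Rightarrow> 'a set set \<Rightarrow> ('a set list \<Rightarrow> 'a) \<Rightarrow> bool" where
  "trivial_massey_operation B Y \<mu> \<longleftrightarrow>
     (\<forall>hs\<in>lists Y. hs \<noteq> [] \<longrightarrow> \<mu> hs \<in> (\<Union>i. component B i)) \<and>
     (\<forall>h\<in>Y. \<mu> [h] \<in> cycles B \<and> homology_class B (\<mu> [h]) = h) \<and>
     (\<forall>hs\<in>lists Y. length hs \<ge> 2 \<longrightarrow>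
        differential B (\<mu> hs) =
          (\<Oplus>\<^bsub>B\<^esub> j\<in>{1..length hs - 1}. sgn_bar B (\<mu> (take j hs)) \<otimes>\<^bsub>B\<^esub> \<mu> (drop j hs)))"

definition admits_trivial_massey_operation :: "('a, 'm) dg_algebra_scheme \<Rightarrow> bool" where
  "admits_trivial_massey_operation B \<longleftrightarrow>
     (\<exists>Y. homogeneous_basis B Y \<and> (\<exists>\<mu>. trivial_massey_operation B Y \<mu>))"


section \<open>The Koszul complex\<close>

text \<open>The exterior algebra on \<open>e\<^sub>0, \<dots>, e\<^bsub>n-1\<^esub>\<close> over \<open>A\<close>, where \<open>n = length xs\<close>, with
  \<open>d e\<^sub>i = xs ! i\<close>. An element is the family \<open>f\<close> of its coefficients with respect to
  the basis of the \<open>e\<^sub>S = e\<^bsub>s1\<^esub> \<and> \<dots> \<and> e\<^bsub>sp\<^esub>\<close> for subsets \<open>S = {s1 < \<dots> < sp}\<close> of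
  \<open>{..<n}\<close>. For disjoint \<open>S\<close> and \<open>T\<close>, \<open>e\<^sub>S \<and> e\<^sub>T\<close> is \<open>e\<^bsub>S \<union> T\<^esub>\<close> up to the sign given
  by the number of inversions, and \<open>d e\<^sub>S\<close> is the sum over \<open>i \<in> S\<close> of
  \<open>(-1)\<^bsup>card {t \<in> S. t < i}\<^esup> (xs ! i) e\<^bsub>S - {i}\<^esub>\<close>.\<close>

definition koszul :: "('a, 'm) ring_scheme \<Rightarrow> 'a list \<Rightarrow> (nat set \<Rightarrow> 'a) dg_algebra" where
  "koszul A xs =
    \<lparr>carrier = Pow {..<length xs} \<rightarrow>\<^sub>E carrier A,
     monoid.mult = (\<lambda>f g. \<lambda>U\<in>Pow {..<length xs}.
        \<Oplus>\<^bsub>A\<^esub> S\<in>Pow U. neg_pow A (card {(s, t). s \<in> S \<and> t \<in> U - S \<and> t < s}) \<otimes>\<^bsub>A\<^esub>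
          (f S \<otimes>\<^bsub>A\<^esub> g (U - S))),
     monoid.one = (\<lambda>U\<in>Pow {..<length xs}. if U = {} then \<one>\<^bsub>A\<^esub> else \<zero>\<^bsub>A\<^esub>),
     ring.zero = (\<lambda>U\<in>Pow {..<length xs}. \<zero>\<^bsub>A\<^esub>),
     ring.add = (\<lambda>f g. \<lambda>U\<in>Pow {..<length xs}. f U \<oplus>\<^bsub>A\<^esub> g U),
     component = (\<lambda>i. {f \<in> Pow {..<length xs} \<rightarrow>\<^sub>E carrier A.
        \<forall>U\<in>Pow {..<length xs}. card U \<noteq> i \<longrightarrow> f U = \<zero>\<^bsub>A\<^esub>}),
     differential = (\<lambda>f. \<lambda>U\<in>Pow {..<length xs}.
        \<Oplus>\<^bsub>A\<^esub> i\<in>{..<length xs} - U. neg_pow A (card {t \<in> U. t < i}) \<otimes>\<^bsub>A\<^esub>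
          (xs ! i \<otimes>\<^bsub>A\<^esub> f (insert i U)))\<rparr>"


section \<open>Golod rings\<close>

text \<open>The Koszul complexes on different minimal sets of generators (homogeneous ones in the graded
  case) are isomorphic DG-algebras, so the condition is imposed on all of them. There is at least
  one since the rings in question are Noetherian.\<close>

definition golod_local :: "('a, 'm) ring_scheme \<Rightarrow> bool" where
  "golod_local A \<longleftrightarrow>
     (\<forall>xs. minimal_generators A (maximal_ideal A) xs \<longrightarrow>
        admits_trivial_massey_operation (koszul A xs))"

definition golod_graded :: "('a, 'm) ring_scheme \<Rightarrow> (nat \<Rightarrow> 'a set) \<Rightarrow> bool" where
  "golod_graded A G \<longleftrightarrow>
     (\<forall>xs. minimal_generators A (irrelevant_ideal A G) xs \<and> set xs \<subseteq> (\<Union>d. G d) \<longrightarrow>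
        admits_trivial_massey_operation (koszul A xs))"

end

theory Submission
  imports Defs
begin

text \<open>
  Put \<open>A = R / I m\<close> with maximal ideal \<open>n\<close>. All products of suitably chosen cycles of positive degree
  in \<open>K\<^sup>A\<close> vanish on the nose, so a trivial Massey operation may be taken to be zero on all tuples
  of length at least two. Indeed, a cycle of positive degree has coefficients in \<open>n\<close>, because the
  generators of \<open>n\<close> are minimal. Moreover, an element of \<open>I m\<close> is a combination of the lifted
  generators with coefficients in \<open>I\<close>; since the Koszul complex over \<open>R\<close> has no first homology,
  every class of degree one is therefore represented by a cycle with coefficients in \<open>I / I m\<close>, and
  these coefficients annihilate \<open>n\<close>. The products without a factor of degree one have degree at
  least \<open>4\<close>, while there are at most three generators.

  Over a regular local ring the first Koszul homology vanishes since Krull's principal ideal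
  theorem moves a prime chain of length three to a chain \<open>P0 \<subset> P1 \<subset> P2 \<subset> m = (x, y, z)\<close> with
  \<open>x \<in> P1\<close> and \<open>x, y \<in> P2\<close>. Nakayama's lemma then gives \<open>P2 = (x, y)\<close>, \<open>P1 = (x)\<close> and
  \<open>P0 = 0\<close>, so that \<open>x, y, z\<close> is a regular sequence.
\<close>

section \<open>Saturation and Nakayama's lemma\<close>

text \<open>The definition of a Golod ring ranges over all minimal lists of generators of
  \<open>n\<close>, whereas a regular sequence is at hand only for one triple in \<open>R\<close>.
  Vanishing of the first Koszul homology is therefore transported from that triple to lifts of an
  arbitrary list. It fails for redundant generators, so the lifts have to be controlled: as
  \<open>I\<close> is proper, \<open>I m\<close> lies in the square of \<open>m\<close>, hence lifts
  of generators of \<open>n\<close> generate \<open>m\<close> by Nakayama's lemma, and minimality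
  forces every relation among them modulo \<open>I m\<close> to have coefficients in
  \<open>m\<close>. Comparing ranks modulo \<open>m\<close> bounds their number by three.

  For the polynomial ring, which is not local, linear parts of polynomials replace Nakayama's lemma:
  they vanish on \<open>I m\<close>, and homogeneous lifts of minimal generators turn out to be
  linear forms. Both cases meet in
  \<open>quotient_by_product_admits_trivial_massey_operation\<close>, which asks that
  \<open>R / m\<close> be a field rather than that \<open>R\<close> be local.

  Localization occurs only through ideals saturated at a prime, so that the Noetherian property of
  \<open>R\<close> itself drives the arguments.\<close>

lemma (in cring) ideal_memI:
  assumes "I \<subseteq> carrier R" "\<zero> \<in> I"
    and add: "\<And>a b. a \<in> I \<Longrightarrow> b \<in> I \<Longrightarrow> a \<oplus> b \<in> I"
    and mult: "\<And>r a. r \<in> carrier R \<Longrightarrow> a \<in> I \<Longrightarrow> r \<otimes> a \<in> I"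
  shows "ideal I R"
proof (rule idealI)
  show "ring R" by (rule ring_axioms)
  show "subgroup I (add_monoid R)"
  proof (rule add.subgroupI)
    show "I \<subseteq> carrier R" "I \<noteq> {}" using assms by auto
    show "\<ominus> a \<in> I" if "a \<in> I" for a
    proof -
      have "a \<in> carrier R" using assms(1) that by blast
      then have "\<ominus> a = \<ominus> \<one> \<otimes> a" by algebra
      then show ?thesis using mult[of "\<ominus> \<one>" a] that by simp
    qed
  qed (use add in auto)
  show "x \<otimes> a \<in> I" if "a \<in> I" "x \<in> carrier R" for a x using mult that by blast
  show "a \<otimes> x \<in> I" if "a \<in> I" "x \<in> carrier R" for a x
    using mult[of x a] that assms(1) m_comm[of a x] by auto
qed

context cring
begin

text \<open>The coefficients are restricted to \<open>C\<close> because \<open>L + Rf\<close> is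
  later compared with \<open>L + Pf\<close>.\<close>

definition add_multiples :: "'a set \<Rightarrow> 'a set \<Rightarrow> 'a \<Rightarrow> 'a set" where
  "add_multiples L C f = {l \<oplus> c \<otimes> f | l c. l \<in> L \<and> c \<in> C}"

text \<open>The preimage in \<open>R\<close> of the extension of \<open>N\<close> to the
  localization at \<open>P\<close>. Ideals of the localization are represented by these preimages,
  so that all comparisons take place in \<open>R\<close>.\<close>

definition saturation :: "'a set \<Rightarrow> 'a set \<Rightarrow> 'a set" where
  "saturation P N = {r \<in> carrier R. \<exists>s \<in> carrier R - P. s \<otimes> r \<in> N}"

lemma add_multiplesI: "l \<in> L \<Longrightarrow> c \<in> C \<Longrightarrow> l \<oplus> c \<otimes> f \<in> add_multiples L C f"
  by (auto simp: add_multiples_def)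

lemma add_multiplesE:
  assumes "r \<in> add_multiples L C f"
  obtains l c where "l \<in> L" "c \<in> C" "r = l \<oplus> c \<otimes> f"
  using assms by (auto simp: add_multiples_def)

lemma add_multiples_ideal:
  assumes "ideal L R" "ideal C R" "f \<in> carrier R"
  shows "ideal (add_multiples L C f) R"
proof -
  interpret L: ideal L R by fact
  interpret C: ideal C R by fact
  show ?thesis
  proof (rule ideal_memI)
    show "add_multiples L C f \<subseteq> carrier R"
      using assms(3) L.Icarr C.Icarr by (auto simp: add_multiples_def)
    have "\<zero> = \<zero> \<oplus> \<zero> \<otimes> f" using assms(3) by simp
    then show "\<zero> \<in> add_multiples L C f"
      using add_multiplesI[of \<zero> L \<zero> C f] L.zero_closed C.zero_closed by simp
  next
    fix a b assume "a \<in> add_multiples L C f" "b \<in> add_multiples L C f"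
    then obtain l c l' c' where *: "l \<in> L" "c \<in> C" "l' \<in> L" "c' \<in> C"
      and ab: "a = l \<oplus> c \<otimes> f" "b = l' \<oplus> c' \<otimes> f" by (auto elim!: add_multiplesE)
    have cs: "l \<in> carrier R" "c \<in> carrier R" "l' \<in> carrier R" "c' \<in> carrier R"
      using * L.Icarr C.Icarr by auto
    have "a \<oplus> b = (l \<oplus> l') \<oplus> (c \<oplus> c') \<otimes> f" unfolding ab using cs assms(3) by algebra
    then show "a \<oplus> b \<in> add_multiples L C f"
      using * by (auto intro!: add_multiplesI)
  next
    fix r a assume r: "r \<in> carrier R" and "a \<in> add_multiples L C f"
    then obtain l c where *: "l \<in> L" "c \<in> C" and a: "a = l \<oplus> c \<otimes> f" by (auto elim!: add_multiplesE)
    have cs: "l \<in> carrier R" "c \<in> carrier R" using * L.Icarr C.Icarr by auto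
    have "r \<otimes> a = r \<otimes> l \<oplus> (r \<otimes> c) \<otimes> f" unfolding a using cs r assms(3) by algebra
    then show "r \<otimes> a \<in> add_multiples L C f"
      using * r by (auto intro!: add_multiplesI L.I_l_closed C.I_l_closed)
  qed
qed

lemma add_multiples_incl:
  assumes "ideal L R" "ideal C R" "f \<in> carrier R"
  shows "L \<subseteq> add_multiples L C f"
proof
  fix l assume l: "l \<in> L"
  then have "l = l \<oplus> \<zero> \<otimes> f" using assms(3) ideal.Icarr[OF assms(1) l] by simp
  then show "l \<in> add_multiples L C f"
    using add_multiplesI[OF l, of \<zero> C f] additive_subgroup.zero_closed[OF ideal.axioms(1)[OF assms(2)]] by simp
qed

lemma add_multiples_self:
  assumes "ideal L R" "f \<in> carrier R"
  shows "f \<in> add_multiples L (carrier R) f"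
proof -
  have "f = \<zero> \<oplus> \<one> \<otimes> f" using assms by simp
  then show ?thesis
    using add_multiplesI[of \<zero> L \<one> "carrier R" f] additive_subgroup.zero_closed[OF ideal.axioms(1)[OF assms(1)]] by simp
qed

lemma saturationI: "r \<in> carrier R \<Longrightarrow> s \<in> carrier R \<Longrightarrow> s \<notin> P \<Longrightarrow> s \<otimes> r \<in> N \<Longrightarrow> r \<in> saturation P N"
  by (auto simp: saturation_def)

lemma saturationE:
  assumes "r \<in> saturation P N"
  obtains s where "r \<in> carrier R" "s \<in> carrier R" "s \<notin> P" "s \<otimes> r \<in> N"
  using assms by (auto simp: saturation_def)

lemma prime_compl_mult:
  assumes "primeideal P R" "s \<in> carrier R" "t \<in> carrier R" "s \<notin> P" "t \<notin> P"
  shows "s \<otimes> t \<notin> P"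
  using assms primeideal.I_prime[of P R s t] by blast

lemma prime_one_notin: "primeideal P R \<Longrightarrow> \<one> \<notin> P"
  using ideal.one_imp_carrier primeideal.I_notcarr primeideal.axioms(1) by metis

text \<open>In the localization at \<open>P\<close> this is the fact that a unit minus an element of
  the maximal ideal is a unit.\<close>

lemma prime_compl_diff:
  assumes "primeideal P R" "s \<in> carrier R" "s \<notin> P" "p \<in> P"
  shows "s \<ominus> p \<notin> P"
proof
  interpret P: primeideal P R by fact
  assume "s \<ominus> p \<in> P"
  then have "(s \<ominus> p) \<oplus> p \<in> P" using assms(4) by simp
  moreover have "(s \<ominus> p) \<oplus> p = s" using assms(2) P.Icarr[OF assms(4)] by algebra
  ultimately show False using assms(3) by simp
qed

lemma saturation_incl:
  assumes "primeideal P R" "ideal N R"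
  shows "N \<subseteq> saturation P N"
  using prime_one_notin[OF assms(1)] ideal.Icarr[OF assms(2)]
  by (auto intro!: saturationI[of _ \<one>])

lemma saturation_mono: "N \<subseteq> N' \<Longrightarrow> saturation P N \<subseteq> saturation P N'"
  by (auto simp: saturation_def)

lemma saturation_ideal:
  assumes "primeideal P R" "ideal N R"
  shows "ideal (saturation P N) R"
proof -
  interpret P: primeideal P R by fact
  interpret N: ideal N R by fact
  show ?thesis
  proof (rule ideal_memI)
    show "saturation P N \<subseteq> carrier R" by (auto simp: saturation_def)
    show "\<zero> \<in> saturation P N" using saturation_incl[OF assms] N.zero_closed by blast
  next
    fix a b assume "a \<in> saturation P N" "b \<in> saturation P N"
    then obtain s t where *: "a \<in> carrier R" "b \<in> carrier R" "s \<in> carrier R" "t \<in> carrier R"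
      "s \<notin> P" "t \<notin> P" and N: "s \<otimes> a \<in> N" "t \<otimes> b \<in> N" by (auto elim!: saturationE)
    have "(s \<otimes> t) \<otimes> (a \<oplus> b) = t \<otimes> (s \<otimes> a) \<oplus> s \<otimes> (t \<otimes> b)" using * by algebra
    also have "\<dots> \<in> N" using N * by (simp add: N.I_l_closed)
    finally show "a \<oplus> b \<in> saturation P N"
      using * prime_compl_mult[OF assms(1)] by (auto intro!: saturationI[of _ "s \<otimes> t"])
  next
    fix r a assume r: "r \<in> carrier R" and "a \<in> saturation P N"
    then obtain s where *: "a \<in> carrier R" "s \<in> carrier R" "s \<notin> P" and N: "s \<otimes> a \<in> N"
      by (auto elim!: saturationE)
    have "s \<otimes> (r \<otimes> a) = r \<otimes> (s \<otimes> a)" using * r by algebra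
    also have "\<dots> \<in> N" using N r by (simp add: N.I_l_closed)
    finally show "r \<otimes> a \<in> saturation P N" using * r by (auto intro!: saturationI[of _ s])
  qed
qed

lemma saturation_cancel:
  assumes "primeideal P R" "t \<in> carrier R" "t \<notin> P" "r \<in> carrier R" "t \<otimes> r \<in> saturation P N"
  shows "r \<in> saturation P N"
proof -
  obtain s where s: "s \<in> carrier R" "s \<notin> P" "s \<otimes> (t \<otimes> r) \<in> N" using assms(5) by (auto elim: saturationE)
  have "(s \<otimes> t) \<otimes> r \<in> N" using s assms by (simp add: m_assoc)
  then show ?thesis using s assms prime_compl_mult[OF assms(1)] by (auto intro!: saturationI[of _ "s \<otimes> t"])
qed

lemma saturation_idem:
  assumes "primeideal P R"
  shows "saturation P (saturation P N) \<subseteq> saturation P N"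
proof
  fix r assume "r \<in> saturation P (saturation P N)"
  then obtain s where "r \<in> carrier R" "s \<in> carrier R" "s \<notin> P" "s \<otimes> r \<in> saturation P N"
    by (rule saturationE)
  then show "r \<in> saturation P N" using saturation_cancel[OF assms] by blast
qed

text \<open>In a Noetherian ring the union of a nonempty chain of ideals belongs to the chain, so
  Zorn's lemma applies to any nonempty family of ideals, whether or not it is closed under
  unions.\<close>

lemma ideal_max_element:
  assumes "noetherian_ring R" "\<A> \<noteq> {}" "\<And>J. J \<in> \<A> \<Longrightarrow> ideal J R"
  obtains M where "M \<in> \<A>" "\<And>J. J \<in> \<A> \<Longrightarrow> M \<subseteq> J \<Longrightarrow> J = M"
proof -
  have "\<exists>M\<in>\<A>. \<forall>J\<in>\<A>. M \<subseteq> J \<longrightarrow> J = M"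
  proof (rule subset_Zorn_nonempty[OF assms(2)])
    fix C assume C: "C \<noteq> {}" "subset.chain \<A> C"
    then have "subset.chain {I. ideal I R} C" using assms(3) by (auto simp: subset_chain_def)
    then have "\<Union>C \<in> C" using noetherian_ring.ideal_chain_is_trivial[OF assms(1) C(1)] by blast
    then show "\<Union>C \<in> \<A>" using C(2) by (auto simp: subset_chain_def)
  qed
  then show ?thesis using that by blast
qed

text \<open>Nakayama's lemma for \<open>(M + N) / N\<close> localized at \<open>P\<close>. In place
  of a determinant over a list of generators, a saturated ideal \<open>L\<close> containing
  \<open>N\<close> is chosen maximal among those not containing \<open>M\<close>; this reduces the
  claim to a single generator \<open>f\<close> modulo \<open>L\<close>.\<close>

lemma nakayama_at_prime:
  assumes "noetherian_ring R" "primeideal P R" "ideal M R" "ideal N R"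
    and M: "M \<subseteq> saturation P (N <+>\<^bsub>R\<^esub> (P \<cdot> M))"
  shows "M \<subseteq> saturation P N"
proof (rule ccontr)
  interpret P: primeideal P R by fact
  interpret M: ideal M R by fact
  assume notM: "\<not> M \<subseteq> saturation P N"
  define \<A> where "\<A> = {L. ideal L R \<and> N \<subseteq> L \<and> saturation P L \<subseteq> L \<and> \<not> M \<subseteq> L}"
  have "saturation P N \<in> \<A>"
    using notM saturation_ideal saturation_incl saturation_idem assms by (auto simp: \<A>_def)
  then have "\<A> \<noteq> {}" by blast
  then obtain L where L: "L \<in> \<A>" and max: "\<And>J. J \<in> \<A> \<Longrightarrow> L \<subseteq> J \<Longrightarrow> J = L"
    by (rule ideal_max_element[OF assms(1)]) (auto simp: \<A>_def)
  have idL: "ideal L R" and NL: "N \<subseteq> L" and satL: "saturation P L \<subseteq> L" and MnotL: "\<not> M \<subseteq> L"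
    using L by (auto simp: \<A>_def)
  interpret L: ideal L R by fact
  obtain f where f: "f \<in> M" "f \<notin> L" using MnotL by blast
  have fc: "f \<in> carrier R" using f M.Icarr by blast
  \<comment> \<open>Maximality of \<open>L\<close> forces \<open>M\<close> into the saturation of
    \<open>L + Rf\<close>: after localization, \<open>M\<close> is generated by \<open>f\<close>
    modulo \<open>L\<close>.\<close>
  define L' where "L' = saturation P (add_multiples L (carrier R) f)"
  have idA: "ideal (add_multiples L (carrier R) f) R"
    by (rule add_multiples_ideal[OF idL oneideal fc])
  have LL': "L \<subseteq> L'" unfolding L'_def
    using add_multiples_incl[OF idL oneideal fc] saturation_incl[OF assms(2) idA] by blast
  have "f \<in> L'" unfolding L'_def
    using add_multiples_self[OF idL fc] saturation_incl[OF assms(2) idA] by blast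
  then have "L' \<noteq> L" using f by blast
  then have "L' \<notin> \<A>" using max LL' by blast
  then have MinL': "M \<subseteq> L'"
    using saturation_ideal[OF assms(2) idA] saturation_idem[OF assms(2)] NL LL'
    unfolding \<A>_def L'_def by blast
  \<comment> \<open>After localization \<open>D\<close> is \<open>L + Pf\<close>. It contains
    \<open>P M\<close> because every element of \<open>M\<close> is a multiple of \<open>f\<close>
    modulo \<open>L\<close>, up to a factor outside \<open>P\<close>.\<close>
  define D where "D = saturation P (add_multiples L P f)"
  have idB: "ideal (add_multiples L P f) R" by (rule add_multiples_ideal[OF idL P.is_ideal fc])
  have idD: "ideal D R" unfolding D_def by (rule saturation_ideal[OF assms(2) idB])
  have LD: "L \<subseteq> D" unfolding D_def
    using add_multiples_incl[OF idL P.is_ideal fc] saturation_incl[OF assms(2) idB] by blast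
  have PMD: "P \<cdot> M \<subseteq> D"
  proof
    fix r assume "r \<in> P \<cdot> M"
    then show "r \<in> D"
    proof (induction r rule: ideal_prod.induct)
      case (prod p x)
      then have "x \<in> L'" using MinL' by blast
      then obtain t l c where t: "t \<in> carrier R" "t \<notin> P" "l \<in> L" "c \<in> carrier R" and x: "x \<in> carrier R"
        and eq: "t \<otimes> x = l \<oplus> c \<otimes> f"
        unfolding L'_def by (auto elim!: saturationE add_multiplesE)
      have p: "p \<in> carrier R" using prod P.Icarr by blast
      have "t \<otimes> (p \<otimes> x) = p \<otimes> (t \<otimes> x)" using t p x by algebra
      also have "\<dots> = p \<otimes> l \<oplus> (p \<otimes> c) \<otimes> f"
        unfolding eq using t p x fc L.Icarr[OF t(3)] by algebra
      also have "\<dots> \<in> add_multiples L P f"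
        using t p prod by (auto intro!: add_multiplesI L.I_l_closed P.I_r_closed)
      finally show ?case unfolding D_def using t p x by (auto intro!: saturationI[of _ t])
    next
      case (sum s1 s2)
      then show ?case using additive_subgroup.a_closed[OF ideal.axioms(1)[OF idD]] by blast
    qed
  qed
  have "N <+>\<^bsub>R\<^esub> (P \<cdot> M) \<subseteq> D"
  proof
    fix r assume "r \<in> N <+>\<^bsub>R\<^esub> (P \<cdot> M)"
    then obtain a b where "a \<in> N" "b \<in> P \<cdot> M" "r = a \<oplus> b" by (auto simp: set_add_def')
    then show "r \<in> D" using NL LD PMD additive_subgroup.a_closed[OF ideal.axioms(1)[OF idD]] by blast
  qed
  then have "M \<subseteq> saturation P D" using M saturation_mono by (meson subset_trans)
  also have "\<dots> \<subseteq> D" unfolding D_def by (rule saturation_idem[OF assms(2)])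
  finally have "M \<subseteq> D" .
  then have "f \<in> D" using f by blast
  then obtain t l p where t: "t \<in> carrier R" "t \<notin> P" "l \<in> L" "p \<in> P" and eq: "t \<otimes> f = l \<oplus> p \<otimes> f"
    unfolding D_def by (auto elim!: saturationE add_multiplesE)
  have cs: "l \<in> carrier R" "p \<in> carrier R" using t L.Icarr P.Icarr by auto
  \<comment> \<open>The usual factor \<open>1 - p\<close> appears here as \<open>t - p\<close>,
    which stays outside \<open>P\<close>.\<close>
  have "(t \<ominus> p) \<otimes> f = t \<otimes> f \<ominus> p \<otimes> f" using t cs fc by algebra
  also have "\<dots> = l" unfolding eq using cs fc by algebra
  finally have "(t \<ominus> p) \<otimes> f \<in> L" using t by simp
  moreover have "t \<ominus> p \<notin> P" using prime_compl_diff[OF assms(2)] t by blast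
  ultimately have "f \<in> saturation P L" using t cs fc by (auto intro!: saturationI[of _ "t \<ominus> p"])
  then show False using satL f by blast
qed

end

section \<open>Krull's principal ideal theorem and regular sequences\<close>

context cring begin

lemma ideal_colon:
  assumes "ideal J R" "s \<in> carrier R"
  shows "ideal {r \<in> carrier R. r \<otimes> s \<in> J} R"
proof -
  interpret J: ideal J R by fact
  show ?thesis
    by (rule ideal_memI) (use assms(2) in \<open>auto simp: l_distr m_assoc J.I_l_closed\<close>)
qed

text \<open>A maximal element among the colon ideals \<open>(J : s)\<close> with
  \<open>s \<notin> J\<close> is prime: if \<open>b\<close> is not in \<open>(J : s)\<close>, then
  \<open>b s\<close> is not in \<open>J\<close>, and \<open>(J : b s)\<close> contains, hence
  equals, \<open>(J : s)\<close>.\<close>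

lemma exists_associated_prime:
  assumes "noetherian_ring R" "ideal J R" "J \<noteq> carrier R"
  obtains s where "s \<in> carrier R" "s \<notin> J" "primeideal {r \<in> carrier R. r \<otimes> s \<in> J} R"
proof -
  interpret J: ideal J R by fact
  define col where "col s = {r \<in> carrier R. r \<otimes> s \<in> J}" for s
  have "col ` (carrier R - J) \<noteq> {}" using assms(3) J.Icarr by auto
  then obtain Q where Q: "Q \<in> col ` (carrier R - J)"
    and max: "\<And>J'. J' \<in> col ` (carrier R - J) \<Longrightarrow> Q \<subseteq> J' \<Longrightarrow> J' = Q"
    by (rule ideal_max_element[OF assms(1)]) (auto simp: col_def intro: ideal_colon assms(2))
  obtain s where s: "s \<in> carrier R" "s \<notin> J" and Qs: "Q = col s" using Q by blast
  have "primeideal (col s) R"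
  proof (rule primeidealI)
    show "ideal (col s) R" unfolding col_def by (rule ideal_colon[OF assms(2) s(1)])
    show "cring R" by (rule is_cring)
    have "\<one> \<notin> col s" using s by (simp add: col_def)
    then show "carrier R \<noteq> col s" by blast
  next
    fix a b assume ab: "a \<in> carrier R" "b \<in> carrier R" "a \<otimes> b \<in> col s"
    show "a \<in> col s \<or> b \<in> col s"
    proof (rule disjCI)
      assume "b \<notin> col s"
      then have bs: "b \<otimes> s \<in> carrier R - J" using ab s by (simp add: col_def)
      have "col s \<subseteq> col (b \<otimes> s)"
      proof
        fix r assume "r \<in> col s"
        then have r: "r \<in> carrier R" "r \<otimes> s \<in> J" by (auto simp: col_def)
        have "r \<otimes> (b \<otimes> s) = b \<otimes> (r \<otimes> s)" using r ab s by algebra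
        then show "r \<in> col (b \<otimes> s)" using r ab J.I_l_closed by (simp add: col_def)
      qed
      then have "col (b \<otimes> s) = col s" using max[of "col (b \<otimes> s)"] bs Qs by blast
      moreover have "a \<in> col (b \<otimes> s)" using ab s by (simp add: col_def m_assoc)
      ultimately show "a \<in> col s" by simp
    qed
  qed
  then show ?thesis using that s unfolding col_def by blast
qed

text \<open>The ideals saturated at \<open>P\<close> are the ideals of the localization at \<open>P\<close>, which is Artinian
  modulo \<open>J0\<close>. The induction adjoins to \<open>J\<close> an element annihilated by \<open>P\<close> modulo \<open>J\<close>.\<close>

lemma saturated_dcc:
  assumes noeth: "noetherian_ring R" and P: "primeideal P R"
    and minimal: "\<And>Q. primeideal Q R \<Longrightarrow> J0 \<subseteq> Q \<Longrightarrow> Q \<subseteq> P \<Longrightarrow> Q = P"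
    and J: "ideal J R" "J0 \<subseteq> J"
    and chain: "\<And>n. ideal (L n) R" "\<And>n. saturation P (L n) \<subseteq> L n" "\<And>n. J \<subseteq> L n" "\<And>n. L (Suc n) \<subseteq> L n"
  shows "\<exists>N. \<forall>n\<ge>N. L (Suc n) = L n"
proof (rule ccontr)
  assume bad: "\<not> ?thesis"
  interpret P: primeideal P R by fact
  define bad_chain where "bad_chain J L \<longleftrightarrow> (\<forall>n. ideal (L n) R \<and> saturation P (L n) \<subseteq> L n \<and> J \<subseteq> L n \<and>
     L (Suc n) \<subseteq> L n) \<and> \<not> (\<exists>N. \<forall>n\<ge>N. L (Suc n) = L n)" for J and L :: "nat \<Rightarrow> 'a set"
  define \<A> where "\<A> = {J. ideal J R \<and> J0 \<subseteq> J \<and> (\<exists>L. bad_chain J L)}"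
  have "J \<in> \<A>" unfolding \<A>_def bad_chain_def using J chain bad by blast
  then have "\<A> \<noteq> {}" by blast
  then obtain M where M: "M \<in> \<A>" and max: "\<And>J. J \<in> \<A> \<Longrightarrow> M \<subseteq> J \<Longrightarrow> J = M"
    by (rule ideal_max_element[OF noeth]) (auto simp: \<A>_def)
  have idM: "ideal M R" and JM: "J0 \<subseteq> M" using M by (auto simp: \<A>_def)
  obtain K where K: "bad_chain M K" using M by (auto simp: \<A>_def)
  then have Kid: "ideal (K n) R" and Ksat: "saturation P (K n) \<subseteq> K n" and MK: "M \<subseteq> K n"
    and Kdec: "K (Suc n) \<subseteq> K n" for n by (auto simp: bad_chain_def)
  have Kbad: "\<not> (\<exists>N. \<forall>n\<ge>N. K (Suc n) = K n)" using K by (simp add: bad_chain_def)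
  \<comment> \<open>The chain \<open>K\<close> also lies above the saturation of \<open>M\<close>,
    so by maximality of \<open>M\<close> the two ideals agree.\<close>
  have satM: "saturation P M \<subseteq> M"
  proof -
    have "saturation P M \<subseteq> K n" for n using saturation_mono[OF MK] Ksat by (meson subset_trans)
    then have "bad_chain (saturation P M) K" using K by (simp add: bad_chain_def)
    moreover have "M \<subseteq> saturation P M" by (rule saturation_incl[OF P idM])
    ultimately have "saturation P M = M"
      using JM saturation_ideal[OF P idM] by (intro max) (auto simp: \<A>_def)
    then show ?thesis by simp
  qed
  interpret M: ideal M R by fact
  have "M \<noteq> carrier R"
  proof
    assume "M = carrier R"
    then have "K n = carrier R" for n using MK[of n] ideal.Icarr[OF Kid[of n]] by blast
    then show False using Kbad by simp
  qed
  then obtain s where s: "s \<in> carrier R" "s \<notin> M" and pr: "primeideal {r \<in> carrier R. r \<otimes> s \<in> M} R"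
    by (rule exists_associated_prime[OF noeth idM])
  \<comment> \<open>The annihilator of \<open>s\<close> modulo \<open>M\<close> is a prime over
    \<open>J0\<close>. It lies in \<open>P\<close> because \<open>M\<close> is saturated at
    \<open>P\<close> and \<open>s \<notin> M\<close>, and minimality of \<open>P\<close> over
    \<open>J0\<close> makes the two equal.\<close>
  have "{r \<in> carrier R. r \<otimes> s \<in> M} = P"
  proof (rule minimal[OF pr])
    show "J0 \<subseteq> {r \<in> carrier R. r \<otimes> s \<in> M}" using JM s M.Icarr M.I_r_closed by blast
    show "{r \<in> carrier R. r \<otimes> s \<in> M} \<subseteq> P"
      using satM s saturationI[of s _ P M] by blast
  qed
  then have Ps: "p \<otimes> s \<in> M" if "p \<in> P" for p using that by blast
  \<comment> \<open>Adjoining \<open>s\<close> gives a chain above \<open>M + Rs\<close>, which is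
    strictly larger than \<open>M\<close>, so this chain becomes stationary. It remains to compare
    \<open>K n\<close> with \<open>K' n\<close>; since \<open>P s \<subseteq> M\<close>, after
    localization they differ by at most one copy of the residue field at \<open>P\<close>.\<close>
  define K' where "K' n = saturation P (add_multiples (K n) (carrier R) s)" for n
  define M' where "M' = add_multiples M (carrier R) s"
  have idM': "ideal M' R" unfolding M'_def by (rule add_multiples_ideal[OF idM oneideal s(1)])
  have MM': "M \<subseteq> M'" unfolding M'_def by (rule add_multiples_incl[OF idM oneideal s(1)])
  have "s \<in> M'" unfolding M'_def by (rule add_multiples_self[OF idM s(1)])
  then have "M' \<notin> \<A>" using max[OF _ MM'] s by blast
  then have nobad: "\<not> bad_chain M' C" for C using idM' JM MM' by (auto simp: \<A>_def)
  have idA: "ideal (add_multiples (K n) (carrier R) s) R" for n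
    by (rule add_multiples_ideal[OF Kid oneideal s(1)])
  have KK': "add_multiples (K n) (carrier R) s \<subseteq> K' n" for n
    unfolding K'_def by (rule saturation_incl[OF P idA])
  have M'sub: "M' \<subseteq> add_multiples (K n) (carrier R) s" for n
    unfolding M'_def add_multiples_def using MK by blast
  have "\<exists>N. \<forall>n\<ge>N. K' (Suc n) = K' n"
  proof (rule ccontr)
    assume "\<not> ?thesis"
    moreover have "K' (Suc n) \<subseteq> K' n" for n
      unfolding K'_def by (rule saturation_mono) (use Kdec in \<open>auto simp: add_multiples_def\<close>)
    moreover have "ideal (K' n) R" "saturation P (K' n) \<subseteq> K' n" for n
      unfolding K'_def by (rule saturation_ideal[OF P idA], rule saturation_idem[OF P])
    moreover have "M' \<subseteq> K' n" for n using M'sub KK' by (meson subset_trans)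
    ultimately have "bad_chain M' K'" by (simp add: bad_chain_def)
    then show False using nobad by blast
  qed
  then obtain N1 where N1: "\<And>n. n \<ge> N1 \<Longrightarrow> K' (Suc n) = K' n" by blast
  \<comment> \<open>If \<open>s\<close> stayed in every member, \<open>K\<close> itself would be a
    bad chain above \<open>M'\<close>.\<close>
  have "\<exists>n0. s \<notin> K n0"
  proof (rule ccontr)
    assume "\<nexists>n0. s \<notin> K n0"
    then have sK: "s \<in> K n" for n by blast
    have "M' \<subseteq> K n" for n
    proof
      interpret Kn: ideal "K n" R by (rule Kid)
      fix r assume "r \<in> M'"
      then obtain l c where "l \<in> M" "c \<in> carrier R" "r = l \<oplus> c \<otimes> s"
        unfolding M'_def by (rule add_multiplesE)
      then show "r \<in> K n"
        using subsetD[OF MK[of n], of l] Kn.I_l_closed[OF sK, of c] by simp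
    qed
    then have "bad_chain M' K" using K by (simp add: bad_chain_def)
    then show False using nobad by blast
  qed
  then obtain n0 where n0: "s \<notin> K n0" by blast
  have Kmono: "K (n + k) \<subseteq> K n" for n k
    by (induction k) (use Kdec in auto)
  have "K (Suc n) = K n" if n: "n \<ge> max n0 N1" for n
  proof
    show "K (Suc n) \<subseteq> K n" by (rule Kdec)
    have sn: "s \<notin> K n" using n0 Kmono[of n0 "n - n0"] n by auto
    show "K n \<subseteq> K (Suc n)"
    proof
      fix l assume l: "l \<in> K n"
      have lc: "l \<in> carrier R" by (rule ideal.Icarr[OF Kid l])
      have "l \<in> K' n" using l add_multiples_incl[OF Kid oneideal s(1)] KK' by blast
      then have "l \<in> K' (Suc n)" using N1 n by simp
      then obtain t where t: "t \<in> carrier R" "t \<notin> P"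
          "t \<otimes> l \<in> add_multiples (K (Suc n)) (carrier R) s"
        unfolding K'_def by (rule saturationE)
      from t(3) obtain l' c where c: "l' \<in> K (Suc n)" "c \<in> carrier R" and eq: "t \<otimes> l = l' \<oplus> c \<otimes> s"
        by (rule add_multiplesE)
      interpret Kn: ideal "K n" R by (rule Kid)
      have l'c: "l' \<in> carrier R" by (rule ideal.Icarr[OF Kid c(1)])
      have "c \<otimes> s = t \<otimes> l \<ominus> l'" unfolding eq using l'c c s by algebra
      also have "\<dots> \<in> K n" using subsetD[OF Kdec c(1)] l t Kn.I_l_closed by (simp add: a_minus_def)
      finally have cs: "c \<otimes> s \<in> K n" .
      \<comment> \<open>A coefficient outside \<open>P\<close> would put \<open>s\<close> into the
        saturated ideal \<open>K n\<close>. With \<open>c \<in> P\<close> the term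
        \<open>c s\<close> lies in \<open>M\<close>, hence in every member of the chain.\<close>
      have "c \<in> P"
      proof (rule ccontr)
        assume "c \<notin> P"
        then have "s \<in> saturation P (K n)" using cs c s by (auto intro: saturationI[of s c])
        then show False using Ksat sn by blast
      qed
      interpret Kn': ideal "K (Suc n)" R by (rule Kid)
      have "c \<otimes> s \<in> K (Suc n)" using Ps \<open>c \<in> P\<close> MK by blast
      then have "t \<otimes> l \<in> K (Suc n)" unfolding eq using c by simp
      then have "l \<in> saturation P (K (Suc n))" using t lc by (auto intro: saturationI[of l t])
      then show "l \<in> K (Suc n)" using Ksat by blast
    qed
  qed
  then show False using Kbad by blast
qed

text \<open>Krull's principal ideal theorem in \<open>R / P0\<close> localized at \<open>P\<close>. The powers of an
  element \<open>q\<close> of \<open>Q\<close> outside \<open>P0\<close>, saturated at \<open>Q\<close>, take the place of the symbolic powers.\<close>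

lemma prime_chain_exchange:
  assumes noeth: "noetherian_ring R"
    and P0: "primeideal P0 R" and Q: "primeideal Q R" and P: "primeideal P R"
    and chain: "P0 \<subset> Q" "Q \<subset> P" and x: "x \<in> P"
  obtains P' where "primeideal P' R" "P0 \<subset> P'" "P' \<subset> P" "x \<in> P'"
proof (cases "x \<in> Q")
  case True
  then show ?thesis using that Q chain by blast
next
  case xQ: False
  interpret P0: primeideal P0 R by fact
  interpret Q: primeideal Q R by fact
  interpret P: primeideal P R by fact
  have xc: "x \<in> carrier R" using x by (rule P.Icarr)
  \<comment> \<open>The desired prime is any prime over \<open>P0 + (x)\<close> strictly inside
    \<open>P\<close>: it differs from \<open>P0\<close> because
    \<open>x \<notin> P0\<close>.\<close>
  define J0 where "J0 = add_multiples P0 (carrier R) x"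
  have idJ0: "ideal J0 R" unfolding J0_def by (rule add_multiples_ideal[OF P0.is_ideal oneideal xc])
  have P0J: "P0 \<subseteq> J0" unfolding J0_def by (rule add_multiples_incl[OF P0.is_ideal oneideal xc])
  have xJ: "x \<in> J0" unfolding J0_def by (rule add_multiples_self[OF P0.is_ideal xc])
  have "\<exists>P'. primeideal P' R \<and> J0 \<subseteq> P' \<and> P' \<subset> P"
  proof (rule ccontr)
    \<comment> \<open>Without such a prime, \<open>P\<close> is minimal over \<open>J0\<close>, so
      descending chains of \<open>P\<close>-saturated ideals above \<open>J0\<close> become
      stationary.\<close>
    assume no: "\<nexists>P'. primeideal P' R \<and> J0 \<subseteq> P' \<and> P' \<subset> P"
    obtain q where q: "q \<in> Q" "q \<notin> P0" using chain by blast
    have qc: "q \<in> carrier R" using q Q.Icarr by blast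
    define E where "E n = add_multiples P0 (carrier R) (q [^] (n::nat))" for n
    define S where "S n = saturation Q (E n)" for n
    \<comment> \<open>The ideals \<open>S n\<close> need not contain \<open>x\<close>; adding
      \<open>x\<close> moves the chain above \<open>J0\<close>.\<close>
    define L where "L n = saturation P (add_multiples (S n) (carrier R) x)" for n
    have idE: "ideal (E n) R" for n
      unfolding E_def by (rule add_multiples_ideal[OF P0.is_ideal oneideal]) (simp add: qc)
    have idS: "ideal (S n) R" for n unfolding S_def by (rule saturation_ideal[OF Q idE])
    have Edec: "E (Suc n) \<subseteq> E n" for n
    proof
      fix r assume "r \<in> E (Suc n)"
      then obtain l c where c: "l \<in> P0" "c \<in> carrier R" and r: "r = l \<oplus> c \<otimes> q [^] Suc n"
        unfolding E_def by (rule add_multiplesE)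
      have "r = l \<oplus> (c \<otimes> q) \<otimes> q [^] n" unfolding r using c qc by (simp add: m_ac)
      then show "r \<in> E n" unfolding E_def using c qc by (auto intro: add_multiplesI)
    qed
    have Sdec: "S (Suc n) \<subseteq> S n" for n unfolding S_def by (rule saturation_mono[OF Edec])
    have P0S: "P0 \<subseteq> S n" for n
      using add_multiples_incl[OF P0.is_ideal oneideal, of "q [^] n"] saturation_incl[OF Q idE, of n] qc
      unfolding S_def E_def by auto
    have idA: "ideal (add_multiples (S n) (carrier R) x) R" for n
      by (rule add_multiples_ideal[OF idS oneideal xc])
    have AL: "add_multiples (S n) (carrier R) x \<subseteq> L n" for n
      unfolding L_def by (rule saturation_incl[OF P idA])
    have "\<exists>N. \<forall>n\<ge>N. L (Suc n) = L n"
    proof (rule saturated_dcc[OF noeth P _ idJ0 subset_refl])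
      show "Q' = P" if "primeideal Q' R" "J0 \<subseteq> Q'" "Q' \<subseteq> P" for Q' using no that by blast
      show "ideal (L n) R" "saturation P (L n) \<subseteq> L n" for n
        unfolding L_def by (rule saturation_ideal[OF P idA], rule saturation_idem[OF P])
      have "J0 \<subseteq> add_multiples (S n) (carrier R) x" for n
        unfolding J0_def add_multiples_def using P0S by blast
      then show "J0 \<subseteq> L n" for n using AL by (meson subset_trans)
      show "L (Suc n) \<subseteq> L n" for n unfolding L_def
        by (rule saturation_mono) (use Sdec in \<open>auto simp: add_multiples_def\<close>)
    qed
    then obtain n where n: "L (Suc n) = L n" by blast
    \<comment> \<open>By stationarity, an element of \<open>S n\<close> is, up to a factor outside
      \<open>P\<close>, of the form \<open>a + c x\<close> with \<open>a\<close> in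
      \<open>S (Suc n)\<close>. Since \<open>x \<notin> Q\<close> and \<open>S n\<close> is
      saturated at \<open>Q\<close>, the coefficient \<open>c\<close> lies in \<open>S n\<close>
      again, which is what Nakayama's lemma requires.\<close>
    have "S n \<subseteq> saturation P (S (Suc n) <+>\<^bsub>R\<^esub> (P \<cdot> S n))"
    proof
      fix r assume r: "r \<in> S n"
      have rc: "r \<in> carrier R" by (rule ideal.Icarr[OF idS r])
      have "r \<in> L n" using r add_multiples_incl[OF idS oneideal xc] AL by blast
      then have "r \<in> L (Suc n)" using n by simp
      then obtain t where t: "t \<in> carrier R" "t \<notin> P"
          "t \<otimes> r \<in> add_multiples (S (Suc n)) (carrier R) x"
        unfolding L_def by (rule saturationE)
      from t(3) obtain a c where c: "a \<in> S (Suc n)" "c \<in> carrier R" and eq: "t \<otimes> r = a \<oplus> c \<otimes> x"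
        by (rule add_multiplesE)
      have ac: "a \<in> carrier R" by (rule ideal.Icarr[OF idS c(1)])
      interpret Sn: ideal "S n" R by (rule idS)
      have "x \<otimes> c = t \<otimes> r \<ominus> a" unfolding eq using ac c xc by algebra
      also have "\<dots> \<in> S n" using subsetD[OF Sdec c(1)] r t Sn.I_l_closed by (simp add: a_minus_def)
      finally have "x \<otimes> c \<in> S n" .
      then have "c \<in> S n" using saturation_cancel[OF Q xc xQ c(2)] unfolding S_def by blast
      then have "c \<otimes> x \<in> P \<cdot> S n" using ideal_prod.prod[OF x, of c "S n" R] m_comm[OF xc c(2)] by simp
      then have "t \<otimes> r \<in> S (Suc n) <+>\<^bsub>R\<^esub> (P \<cdot> S n)" unfolding eq using c(1) by (auto simp: set_add_def')
      then show "r \<in> saturation P (S (Suc n) <+>\<^bsub>R\<^esub> (P \<cdot> S n))" using t rc by (auto intro: saturationI[of r t])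
    qed
    then have "S n \<subseteq> saturation P (S (Suc n))" by (rule nakayama_at_prime[OF noeth P idS idS])
    \<comment> \<open>The complement of \<open>P\<close> is contained in that of \<open>Q\<close>,
      so saturation at \<open>P\<close> adds nothing to an ideal saturated at
      \<open>Q\<close>.\<close>
    moreover have "saturation P (S (Suc n)) \<subseteq> S (Suc n)"
    proof
      fix r assume "r \<in> saturation P (S (Suc n))"
      then obtain t where t: "r \<in> carrier R" "t \<in> carrier R" "t \<notin> P" "t \<otimes> r \<in> S (Suc n)" by (rule saturationE)
      then have "t \<notin> Q" using chain by blast
      then show "r \<in> S (Suc n)" unfolding S_def using saturation_cancel[OF Q] t(1,2,4) unfolding S_def by blast
    qed
    ultimately have "S n \<subseteq> S (Suc n)" by (rule subset_trans)
    moreover have "q [^] n \<in> S n"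
      using add_multiples_self[OF P0.is_ideal, of "q [^] n"] saturation_incl[OF Q idE, of n] qc
      unfolding S_def E_def by auto
    \<comment> \<open>In the domain \<open>R / P0\<close> this makes \<open>q^n\<close>, up to a
      factor \<open>s\<close> outside \<open>Q\<close>, a multiple of \<open>q^(n+1)\<close>.
      Cancelling the nonzero power of \<open>q\<close> would put \<open>s - c q\<close>, which is
      outside \<open>Q\<close>, into \<open>P0\<close>.\<close>
    ultimately have "q [^] n \<in> S (Suc n)" by blast
    then obtain s where s: "s \<in> carrier R" "s \<notin> Q" "s \<otimes> q [^] n \<in> E (Suc n)"
      unfolding S_def by (rule saturationE)
    from s(3) obtain l c where c: "l \<in> P0" "c \<in> carrier R" and eq: "s \<otimes> q [^] n = l \<oplus> c \<otimes> q [^] Suc n"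
      unfolding E_def by (rule add_multiplesE)
    have lc: "l \<in> carrier R" using c P0.Icarr by blast
    have qn: "q [^] n \<in> carrier R" using qc by simp
    have "(s \<ominus> c \<otimes> q) \<otimes> q [^] n = s \<otimes> q [^] n \<ominus> c \<otimes> (q [^] n \<otimes> q)" using s c qc qn by algebra
    also have "\<dots> = l" using lc c qc qn unfolding eq nat_pow_Suc by algebra
    finally have "(s \<ominus> c \<otimes> q) \<otimes> q [^] n \<in> P0" using c by simp
    moreover have "s \<ominus> c \<otimes> q \<notin> Q"
      by (rule prime_compl_diff[OF Q s(1,2)]) (simp add: Q.I_l_closed c q)
    then have "s \<ominus> c \<otimes> q \<notin> P0" using chain by blast
    moreover have "q [^] k \<notin> P0" for k :: nat
      by (induction k) (use prime_one_notin[OF P0] prime_compl_mult[OF P0 _ qc _ q(2)] qc in auto)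
    ultimately show False using prime_compl_mult[OF P0, of "s \<ominus> c \<otimes> q" "q [^] n"] s c qc by auto
  qed
  then obtain P' where "primeideal P' R" "J0 \<subseteq> P'" "P' \<subset> P" by blast
  moreover have "x \<notin> P0" using xQ chain by blast
  ultimately show ?thesis using that P0J xJ by blast
qed

text \<open>Stated with elements rather than quotient rings, in the form in which a relation among
  \<open>x\<close>, \<open>y\<close>, \<open>z\<close> is solved starting from its last
  coefficient.\<close>

definition regular_sequence3 :: "'a \<Rightarrow> 'a \<Rightarrow> 'a \<Rightarrow> bool" where
  "regular_sequence3 x y z \<longleftrightarrow>
     (\<forall>p\<in>carrier R. x \<otimes> p = \<zero> \<longrightarrow> p = \<zero>) \<and>
     (\<forall>q\<in>carrier R. \<forall>a\<in>carrier R. y \<otimes> q = x \<otimes> a \<longrightarrow> (\<exists>b\<in>carrier R. q = x \<otimes> b)) \<and>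
     (\<forall>r\<in>carrier R. \<forall>a\<in>carrier R. \<forall>b\<in>carrier R. z \<otimes> r = x \<otimes> a \<oplus> y \<otimes> b \<longrightarrow>
        (\<exists>c\<in>carrier R. \<exists>d\<in>carrier R. r = x \<otimes> c \<oplus> y \<otimes> d))"

text \<open>The element \<open>z\<close> is not in \<open>P\<close>, since otherwise
  \<open>P\<close> would contain the whole extension. So \<open>j + c z \<in> P\<close> with
  \<open>j \<in> J\<close> forces \<open>c \<in> P\<close>, which gives \<open>P = J + z P\<close>,
  and Nakayama's lemma removes the second summand.\<close>

lemma prime_below_principal_extension:
  assumes noeth: "noetherian_ring R" and m: "primeideal m R"
    and local: "\<And>r. r \<in> carrier R \<Longrightarrow> r \<notin> m \<Longrightarrow> r \<in> Units R"
    and J: "ideal J R" and z: "z \<in> m" and P: "primeideal P R"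
    and sub: "J \<subseteq> P" "P \<subset> add_multiples J (carrier R) z"
  shows "P = J"
proof
  interpret m: primeideal m R by fact
  interpret P: primeideal P R by fact
  interpret J: ideal J R by fact
  have zc: "z \<in> carrier R" using z m.Icarr by blast
  have zP: "z \<notin> P"
  proof
    assume "z \<in> P"
    then have "add_multiples J (carrier R) z \<subseteq> P"
      using sub(1) P.I_l_closed by (auto elim!: add_multiplesE)
    then show False using sub by blast
  qed
  have "P \<subseteq> saturation m (J <+>\<^bsub>R\<^esub> (m \<cdot> P))"
  proof
    fix p assume p: "p \<in> P"
    then have "p \<in> add_multiples J (carrier R) z" using sub(2) by blast
    then obtain j c where c: "j \<in> J" "c \<in> carrier R" and eq: "p = j \<oplus> c \<otimes> z"
      by (rule add_multiplesE)
    have jc: "j \<in> carrier R" using c J.Icarr by blast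
    have "z \<otimes> c = p \<ominus> j" unfolding eq using jc c zc by algebra
    also have "\<dots> \<in> P" using p c sub(1) by (auto simp: a_minus_def)
    finally have "c \<in> P" using P.I_prime[OF zc c(2)] zP by blast
    then have "z \<otimes> c \<in> m \<cdot> P" using z by (intro ideal_prod.prod)
    then have "p \<in> J <+>\<^bsub>R\<^esub> (m \<cdot> P)" unfolding eq using c m_comm[OF zc c(2)] by (auto simp: set_add_def')
    then show "p \<in> saturation m (J <+>\<^bsub>R\<^esub> (m \<cdot> P))"
      using prime_one_notin[OF m] P.Icarr[OF p] by (auto intro!: saturationI[of p \<one>])
  qed
  then have "P \<subseteq> saturation m J" by (rule nakayama_at_prime[OF noeth m P.is_ideal J])
  \<comment> \<open>Elements outside \<open>m\<close> are units, so saturation at \<open>m\<close>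
    changes nothing.\<close>
  also have "\<dots> \<subseteq> J"
  proof
    fix r assume "r \<in> saturation m J"
    then obtain s where s: "r \<in> carrier R" "s \<in> carrier R" "s \<notin> m" "s \<otimes> r \<in> J" by (rule saturationE)
    then have sU: "s \<in> Units R" using local by blast
    have "r = inv s \<otimes> (s \<otimes> r)" using s sU by (simp add: m_assoc[symmetric])
    also have "\<dots> \<in> J" using s sU J.I_l_closed by blast
    finally show "r \<in> J" .
  qed
  finally show "P \<subseteq> J" .
qed (rule sub(1))

text \<open>The generators are exchanged into the chain until its primes become \<open>0\<close>,
  \<open>(x)\<close> and \<open>(x, y)\<close>. As the chain is strict, each next generator lies
  outside the prime generated by the preceding ones, hence is a nonzerodivisor modulo it.\<close>

lemma regular_sequence3_of_prime_chain:
  assumes noeth: "noetherian_ring R"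
    and local: "\<And>r. r \<in> carrier R \<Longrightarrow> r \<notin> m \<Longrightarrow> r \<in> Units R"
    and gens: "x \<in> carrier R" "y \<in> carrier R" "z \<in> carrier R" "m = Idl {x, y, z}"
    and chain: "primeideal P0 R" "primeideal P1 R" "primeideal P2 R" "primeideal m R"
      "P0 \<subset> P1" "P1 \<subset> P2" "P2 \<subset> m"
  shows "regular_sequence3 x y z"
proof -
  have xyz: "x \<in> m" "y \<in> m" "z \<in> m"
    using genideal_self[of "{x, y, z}"] gens by auto
  \<comment> \<open>Two exchanges move \<open>x\<close> down to the prime just above
    \<open>P0\<close>; only then is \<open>y\<close> exchanged into the prime between that one and
    \<open>m\<close>, so that \<open>x\<close> stays in both.\<close>
  obtain Q2 where Q2: "primeideal Q2 R" "P1 \<subset> Q2" "Q2 \<subset> m" "x \<in> Q2"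
    by (rule prime_chain_exchange[OF noeth chain(2,3,4,6,7) xyz(1)])
  obtain Q1 where Q1: "primeideal Q1 R" "P0 \<subset> Q1" "Q1 \<subset> Q2" "x \<in> Q1"
    by (rule prime_chain_exchange[OF noeth chain(1,2) Q2(1) chain(5) Q2(2,4)])
  obtain Q2' where Q2': "primeideal Q2' R" "Q1 \<subset> Q2'" "Q2' \<subset> m" "y \<in> Q2'"
    by (rule prime_chain_exchange[OF noeth Q1(1) Q2(1) chain(4) Q1(3) Q2(3) xyz(2)])
  interpret P0: primeideal P0 R by fact
  interpret Q1: primeideal Q1 R by fact
  interpret Q2': primeideal Q2' R by fact
  define J1 where "J1 = add_multiples {\<zero>} (carrier R) x"
  define J2 where "J2 = add_multiples J1 (carrier R) y"
  define J3 where "J3 = add_multiples J2 (carrier R) z"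
  have id1: "ideal J1 R" unfolding J1_def by (rule add_multiples_ideal[OF zeroideal oneideal gens(1)])
  have id2: "ideal J2 R" unfolding J2_def by (rule add_multiples_ideal[OF id1 oneideal gens(2)])
  have id3: "ideal J3 R" unfolding J3_def by (rule add_multiples_ideal[OF id2 oneideal gens(3)])
  have "x \<in> J1" "y \<in> J2" "z \<in> J3" "J1 \<subseteq> J2" "J2 \<subseteq> J3"
    unfolding J3_def J2_def J1_def
    using add_multiples_self gens zeroideal id1[unfolded J1_def] id2[unfolded J1_def J2_def]
      add_multiples_incl[OF _ oneideal] by auto
  then have "m \<subseteq> J3" unfolding gens(4) by (intro genideal_minimal[OF id3]) auto
  have J1: "r \<in> J1 \<longleftrightarrow> (\<exists>c\<in>carrier R. r = x \<otimes> c)" for r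
    unfolding J1_def add_multiples_def using gens(1) m_comm[of x] by force
  have J2: "r \<in> J2 \<longleftrightarrow> (\<exists>c\<in>carrier R. \<exists>d\<in>carrier R. r = x \<otimes> c \<oplus> y \<otimes> d)" for r
    unfolding J2_def add_multiples_def using gens(2) m_comm[of y] J1 by auto
  have J1Q: "J1 \<subseteq> Q1" using J1 Q1(4) Q1.I_r_closed by auto
  have J2Q: "J2 \<subseteq> Q2'"
  proof
    fix r assume "r \<in> J2"
    then obtain c d where "c \<in> carrier R" "d \<in> carrier R" "r = x \<otimes> c \<oplus> y \<otimes> d" using J2 by blast
    moreover have "x \<in> Q2'" using Q1(4) Q2'(2) by blast
    ultimately show "r \<in> Q2'" using Q2'.I_r_closed Q2'(4) by auto
  qed
  \<comment> \<open>Identification runs from the top down: knowing \<open>Q2' = J1 + (y)\<close> is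
    what bounds \<open>Q1\<close> from above, and knowing \<open>Q1 = (x)\<close> bounds
    \<open>P0\<close>.\<close>
  have eq2: "Q2' = J2"
    by (rule prime_below_principal_extension[OF noeth chain(4) local id2 xyz(3) Q2'(1) J2Q])
       (use Q2' \<open>m \<subseteq> J3\<close> J3_def in auto)
  have eq1: "Q1 = J1"
    by (rule prime_below_principal_extension[OF noeth chain(4) local id1 xyz(2) Q1(1) J1Q])
       (use Q2'(2) eq2 J2_def in auto)
  have eq0: "P0 = {\<zero>}"
    by (rule prime_below_principal_extension[OF noeth chain(4) local zeroideal xyz(1) P0.primeideal])
       (use Q1(2) eq1 J1_def P0.zero_closed in auto)
  have xP: "x \<notin> P0"
  proof
    assume "x \<in> P0"
    then have "J1 \<subseteq> P0" using J1 P0.I_r_closed by auto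
    then show False using Q1(2) eq1 by blast
  qed
  have yQ: "y \<notin> Q1"
  proof
    assume "y \<in> Q1"
    then have "J2 \<subseteq> Q1" using J2 Q1(4) Q1.I_r_closed by auto
    then show False using Q2'(2) eq2 by blast
  qed
  have zQ: "z \<notin> Q2'"
  proof
    assume "z \<in> Q2'"
    moreover have "x \<in> Q2'" using Q1(4) Q2'(2) by blast
    ultimately have "m \<subseteq> Q2'" unfolding gens(4) using Q2'(4) by (intro genideal_minimal[OF Q2'.is_ideal]) auto
    then show False using Q2'(3) by blast
  qed
  show ?thesis
    unfolding regular_sequence3_def
  proof (intro conjI ballI impI)
    fix p assume "p \<in> carrier R" "x \<otimes> p = \<zero>"
    then show "p = \<zero>" using P0.I_prime[of x p] xP eq0 gens by auto
  next
    fix q a assume "q \<in> carrier R" "a \<in> carrier R" "y \<otimes> q = x \<otimes> a"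
    then have "q \<in> Q1" using Q1.I_prime[of y q] yQ gens Q1.I_r_closed[OF Q1(4)] by auto
    then show "\<exists>b\<in>carrier R. q = x \<otimes> b" using eq1 J1 by blast
  next
    fix r a b assume r: "r \<in> carrier R" "a \<in> carrier R" "b \<in> carrier R" "z \<otimes> r = x \<otimes> a \<oplus> y \<otimes> b"
    then have "z \<otimes> r \<in> Q2'" using eq2 J2 by blast
    then have "r \<in> Q2'" using Q2'.I_prime[of z r] zQ gens r by auto
    then show "\<exists>c\<in>carrier R. \<exists>d\<in>carrier R. r = x \<otimes> c \<oplus> y \<otimes> d" using eq2 J2 by blast
  qed
qed

end

section \<open>Relations between generators of an ideal\<close>

context abelian_monoid begin

lemma finsum_swap:
  assumes "finite A" "finite B" "\<And>i j. i \<in> A \<Longrightarrow> j \<in> B \<Longrightarrow> f i j \<in> carrier G"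
  shows "(\<Oplus>i\<in>A. \<Oplus>j\<in>B. f i j) = (\<Oplus>j\<in>B. \<Oplus>i\<in>A. f i j)"
  using assms(1,3)
proof (induction A)
  case empty
  then show ?case by simp
next
  case (insert a A)
  then have "(\<Oplus>i\<in>insert a A. \<Oplus>j\<in>B. f i j) = (\<Oplus>j\<in>B. f a j) \<oplus> (\<Oplus>j\<in>B. \<Oplus>i\<in>A. f i j)"
    by (subst finsum_insert) (auto simp: Pi_def)
  also have "\<dots> = (\<Oplus>j\<in>B. f a j \<oplus> (\<Oplus>i\<in>A. f i j))"
    using insert by (intro finsum_addf[symmetric]) (auto simp: Pi_def)
  also have "\<dots> = (\<Oplus>j\<in>B. \<Oplus>i\<in>insert a A. f i j)"
    using insert by (intro finsum_cong refl) (auto simp: Pi_def simp_implies_def)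
  finally show ?case .
qed

end

context cring
begin

lemma finsum_diff:
  assumes "finite A" "f \<in> A \<rightarrow> carrier R" "g \<in> A \<rightarrow> carrier R"
  shows "(\<Oplus>i\<in>A. f i \<ominus> g i) = (\<Oplus>i\<in>A. f i) \<ominus> (\<Oplus>i\<in>A. g i)"
  using assms
proof (induction A)
  case empty
  then show ?case by (simp add: a_minus_def)
next
  case (insert a A)
  then have c: "f a \<in> carrier R" "g a \<in> carrier R" "(\<Oplus>i\<in>A. f i) \<in> carrier R" "(\<Oplus>i\<in>A. g i) \<in> carrier R"
    by (auto simp: Pi_def)
  have "(\<Oplus>i\<in>insert a A. f i \<ominus> g i) = (f a \<ominus> g a) \<oplus> ((\<Oplus>i\<in>A. f i) \<ominus> (\<Oplus>i\<in>A. g i))"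
    using insert by (subst finsum_insert) (auto simp: Pi_def)
  also have "\<dots> = (f a \<oplus> (\<Oplus>i\<in>A. f i)) \<ominus> (g a \<oplus> (\<Oplus>i\<in>A. g i))" using c by algebra
  finally show ?case using insert by (simp add: Pi_def)
qed

text \<open>Associativity of the product of a row, a matrix and a column; the changes of generators
  below are computed with it.\<close>

lemma dot_assoc:
  assumes "finite A" "finite B" "u \<in> A \<rightarrow> carrier R" "\<And>i j. i \<in> A \<Longrightarrow> j \<in> B \<Longrightarrow> g i j \<in> carrier R"
    "v \<in> B \<rightarrow> carrier R"
  shows "(\<Oplus>j\<in>B. (\<Oplus>i\<in>A. u i \<otimes> g i j) \<otimes> v j) = (\<Oplus>i\<in>A. u i \<otimes> (\<Oplus>j\<in>B. g i j \<otimes> v j))"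
proof -
  have c: "u i \<in> carrier R" "v j \<in> carrier R" if "i \<in> A" "j \<in> B" for i j using assms that by auto
  have "(\<Oplus>j\<in>B. (\<Oplus>i\<in>A. u i \<otimes> g i j) \<otimes> v j) = (\<Oplus>j\<in>B. \<Oplus>i\<in>A. u i \<otimes> g i j \<otimes> v j)"
    using assms by (intro finsum_cong refl finsum_ldistr) (auto simp: Pi_def simp_implies_def finsum_ldistr)
  also have "\<dots> = (\<Oplus>i\<in>A. \<Oplus>j\<in>B. u i \<otimes> g i j \<otimes> v j)"
    using assms c by (intro finsum_swap) auto
  also have "\<dots> = (\<Oplus>i\<in>A. \<Oplus>j\<in>B. u i \<otimes> (g i j \<otimes> v j))"
    using assms by (intro finsum_cong refl) (auto simp: Pi_def simp_implies_def m_assoc intro!: finsum_cong')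
  also have "\<dots> = (\<Oplus>i\<in>A. u i \<otimes> (\<Oplus>j\<in>B. g i j \<otimes> v j))"
    using assms by (intro finsum_cong refl) (auto simp: Pi_def simp_implies_def finsum_rdistr)
  finally show ?thesis .
qed

lemma finsum_delta:
  assumes "finite A" "i \<in> A" "f \<in> A \<rightarrow> carrier R"
  shows "(\<Oplus>j\<in>A. (if i = j then \<one> else \<zero>) \<otimes> f j) = f i"
proof -
  have "(\<Oplus>j\<in>A. (if i = j then \<one> else \<zero>) \<otimes> f j) = (\<Oplus>j\<in>A. if i = j then f j else \<zero>)"
    using assms by (intro finsum_cong') (auto simp: Pi_def)
  also have "\<dots> = f i" using assms by (intro finsum_singleton) auto
  finally show ?thesis .
qed

text \<open>Vanishing of the first homology of the Koszul complex on \<open>x\<close>: the boundaries of degree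
  one are the combinations of the entries of \<open>x\<close> with alternating coefficients \<open>T - T\<^sup>T\<close>.\<close>

definition koszul_exact :: "nat \<Rightarrow> (nat \<Rightarrow> 'a) \<Rightarrow> bool" where
  "koszul_exact n x \<longleftrightarrow>
     (\<forall>a\<in>{..<n} \<rightarrow> carrier R. (\<Oplus>i\<in>{..<n}. a i \<otimes> x i) = \<zero> \<longrightarrow>
        (\<exists>T\<in>{..<n} \<rightarrow> {..<n} \<rightarrow> carrier R.
           \<forall>i<n. a i = (\<Oplus>j\<in>{..<n}. (T i j \<ominus> T j i) \<otimes> x j)))"

text \<open>In matrix notation \<open>x = M y\<close> and \<open>y = N x\<close>. With
  \<open>r = 1 - M N\<close>, whose rows are relations of \<open>x\<close>, a relation
  \<open>a\<close> splits into \<open>a M N\<close>, which passes through \<open>y\<close>, and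
  \<open>a r\<close>. The assumption \<open>syz\<close> rules out redundant generators, for which
  exactness fails as soon as the ideal is proper.\<close>

lemma koszul_exact_change_generators:
  assumes y: "y \<in> {..<k} \<rightarrow> carrier R" and ex: "koszul_exact k y"
    and M: "\<And>i j. i < n \<Longrightarrow> j < k \<Longrightarrow> M i j \<in> carrier R" and x: "\<And>i. i < n \<Longrightarrow> x i = (\<Oplus>j\<in>{..<k}. M i j \<otimes> y j)"
    and N: "\<And>i j. i < k \<Longrightarrow> j < n \<Longrightarrow> N i j \<in> carrier R" and yX: "\<And>j. j < k \<Longrightarrow> y j = (\<Oplus>i\<in>{..<n}. N j i \<otimes> x i)"
    and syz: "\<And>a i. a \<in> {..<n} \<rightarrow> carrier R \<Longrightarrow> (\<Oplus>i\<in>{..<n}. a i \<otimes> x i) = \<zero> \<Longrightarrow> i < n \<Longrightarrow>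
       \<exists>c\<in>{..<n} \<rightarrow> carrier R. a i = (\<Oplus>q\<in>{..<n}. c q \<otimes> x q)"
  shows "koszul_exact n x"
  unfolding koszul_exact_def
proof (intro ballI impI)
  fix a assume a: "a \<in> {..<n} \<rightarrow> carrier R" and a0: "(\<Oplus>i\<in>{..<n}. a i \<otimes> x i) = \<zero>"
  have ac: "a i \<in> carrier R" if "i < n" for i using a that by auto
  have yc: "y j \<in> carrier R" if "j < k" for j using y that by auto
  have Xc: "x i \<in> carrier R" if "i < n" for i unfolding x[OF that] using M yc that by (auto intro!: finsum_closed)
  obtain A where A: "\<And>p. p < n \<Longrightarrow> A p \<in> {..<n} \<rightarrow> carrier R \<and> a p = (\<Oplus>q\<in>{..<n}. A p q \<otimes> x q)"
    using syz[OF a a0] by metis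
  have Ac: "A p q \<in> carrier R" if "p < n" "q < n" for p q using A that by auto
  \<comment> \<open>The row \<open>b = a M\<close> is the induced relation of \<open>y\<close>, to
    which exactness for \<open>y\<close> applies.\<close>
  define b where "b j = (\<Oplus>i\<in>{..<n}. a i \<otimes> M i j)" for j
  have bc: "b j \<in> carrier R" if "j < k" for j unfolding b_def using ac M that by (auto intro!: finsum_closed)
  have "(\<Oplus>j\<in>{..<k}. b j \<otimes> y j) = (\<Oplus>i\<in>{..<n}. a i \<otimes> (\<Oplus>j\<in>{..<k}. M i j \<otimes> y j))"
    unfolding b_def by (rule dot_assoc) (use ac M yc in auto)
  also have "\<dots> = (\<Oplus>i\<in>{..<n}. a i \<otimes> x i)" using x ac Xc by (intro finsum_cong') auto
  finally have "(\<Oplus>j\<in>{..<k}. b j \<otimes> y j) = \<zero>" using a0 by simp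
  moreover have "b \<in> {..<k} \<rightarrow> carrier R" using bc by auto
  ultimately have "\<exists>T\<in>{..<k} \<rightarrow> {..<k} \<rightarrow> carrier R. \<forall>j<k. b j = (\<Oplus>l\<in>{..<k}. (T j l \<ominus> T l j) \<otimes> y l)"
    using ex unfolding koszul_exact_def by blast
  then obtain W where W: "W \<in> {..<k} \<rightarrow> {..<k} \<rightarrow> carrier R"
      and bW: "\<And>j. j < k \<Longrightarrow> b j = (\<Oplus>l\<in>{..<k}. (W j l \<ominus> W l j) \<otimes> y l)"
    by blast
  have Wc: "W j l \<in> carrier R" if "j < k" "l < k" for j l
    using funcset_mem[OF funcset_mem[OF W, of j], of l] that by simp
  \<comment> \<open>The two changes of generators need not be inverse to each other;
    \<open>r\<close> measures the defect.\<close>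
  define r where "r p i = (if p = i then \<one> else \<zero>) \<ominus> (\<Oplus>j\<in>{..<k}. M p j \<otimes> N j i)" for p i
  have MN: "(\<Oplus>j\<in>{..<k}. M p j \<otimes> N j i) \<in> carrier R" if "p < n" "i < n" for p i
    using M N that by (auto intro!: finsum_closed)
  have rc: "r p i \<in> carrier R" if "p < n" "i < n" for p i unfolding r_def using MN that by auto
  have r0: "(\<Oplus>i\<in>{..<n}. r p i \<otimes> x i) = \<zero>" if p: "p < n" for p
  proof -
    have "(\<Oplus>i\<in>{..<n}. r p i \<otimes> x i) =
        (\<Oplus>i\<in>{..<n}. (if p = i then \<one> else \<zero>) \<otimes> x i \<ominus> (\<Oplus>j\<in>{..<k}. M p j \<otimes> N j i) \<otimes> x i)"
    proof (rule finsum_cong')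
      fix i assume "i \<in> {..<n}"
      then show "r p i \<otimes> x i = (if p = i then \<one> else \<zero>) \<otimes> x i \<ominus> (\<Oplus>j\<in>{..<k}. M p j \<otimes> N j i) \<otimes> x i"
        unfolding r_def using MN[OF p, of i] Xc[of i] by (auto simp: a_minus_def l_distr l_minus)
    qed (use MN p Xc in auto)
    also have "\<dots> = (\<Oplus>i\<in>{..<n}. (if p = i then \<one> else \<zero>) \<otimes> x i) \<ominus> (\<Oplus>i\<in>{..<n}. (\<Oplus>j\<in>{..<k}. M p j \<otimes> N j i) \<otimes> x i)"
      by (rule finsum_diff) (use MN p Xc in auto)
    also have "(\<Oplus>i\<in>{..<n}. (if p = i then \<one> else \<zero>) \<otimes> x i) = x p"
      by (rule finsum_delta) (use p Xc in auto)
    also have "(\<Oplus>i\<in>{..<n}. (\<Oplus>j\<in>{..<k}. M p j \<otimes> N j i) \<otimes> x i) = (\<Oplus>j\<in>{..<k}. M p j \<otimes> (\<Oplus>i\<in>{..<n}. N j i \<otimes> x i))"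
      by (rule dot_assoc) (use M N p Xc in auto)
    also have "\<dots> = (\<Oplus>j\<in>{..<k}. M p j \<otimes> y j)" using M p yc by (intro finsum_cong') (auto simp: yX[symmetric])
    also have "\<dots> = x p" using x p by simp
    finally show ?thesis using Xc p by (simp add: r_neg a_minus_def)
  qed
  \<comment> \<open>In matrices, \<open>T1 = N^t W N\<close> and \<open>T2 = r^t A\<close>. The
    antisymmetrization of \<open>T1\<close> sends \<open>x\<close> to \<open>N^t b\<close>, and
    \<open>T2 x\<close> is the remainder \<open>a - N^t b\<close>, while
    \<open>T2^t x = A^t r x\<close> vanishes because the rows of \<open>r\<close> are
    relations.\<close>
  define T1 where "T1 i q = (\<Oplus>j\<in>{..<k}. N j i \<otimes> (\<Oplus>l\<in>{..<k}. W j l \<otimes> N l q))" for i q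
  define T2 where "T2 i q = (\<Oplus>p\<in>{..<n}. r p i \<otimes> A p q)" for i q
  have WN: "(\<Oplus>l\<in>{..<k}. W j l \<otimes> N l q) \<in> carrier R" if "j < k" "q < n" for j q
    using Wc N that by (auto intro!: finsum_closed)
  have T1c: "T1 i q \<in> carrier R" if "i < n" "q < n" for i q
    unfolding T1_def using WN N that by (auto intro!: finsum_closed)
  have T2c: "T2 i q \<in> carrier R" if "i < n" "q < n" for i q
    unfolding T2_def using rc Ac that by (auto intro!: finsum_closed)
  have Wy: "(\<Oplus>l\<in>{..<k}. W j l \<otimes> y l) \<in> carrier R" "(\<Oplus>l\<in>{..<k}. W l j \<otimes> y l) \<in> carrier R" if "j < k" for j
    using Wc yc that by (auto intro!: finsum_closed)
  have S1: "(\<Oplus>q\<in>{..<n}. T1 i q \<otimes> x q) = (\<Oplus>j\<in>{..<k}. N j i \<otimes> (\<Oplus>l\<in>{..<k}. W j l \<otimes> y l))" if i: "i < n" for i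
  proof -
    have "(\<Oplus>q\<in>{..<n}. T1 i q \<otimes> x q) = (\<Oplus>j\<in>{..<k}. N j i \<otimes> (\<Oplus>q\<in>{..<n}. (\<Oplus>l\<in>{..<k}. W j l \<otimes> N l q) \<otimes> x q))"
      unfolding T1_def by (rule dot_assoc) (use WN N i Xc in auto)
    also have "\<dots> = (\<Oplus>j\<in>{..<k}. N j i \<otimes> (\<Oplus>l\<in>{..<k}. W j l \<otimes> y l))"
    proof (rule finsum_cong')
      fix j assume j: "j \<in> {..<k}"
      have "(\<Oplus>q\<in>{..<n}. (\<Oplus>l\<in>{..<k}. W j l \<otimes> N l q) \<otimes> x q) = (\<Oplus>l\<in>{..<k}. W j l \<otimes> (\<Oplus>q\<in>{..<n}. N l q \<otimes> x q))"
        by (rule dot_assoc) (use Wc N j Xc in auto)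
      also have "\<dots> = (\<Oplus>l\<in>{..<k}. W j l \<otimes> y l)" using Wc j yc by (intro finsum_cong') (auto simp: yX[symmetric])
      finally show "N j i \<otimes> (\<Oplus>q\<in>{..<n}. (\<Oplus>l\<in>{..<k}. W j l \<otimes> N l q) \<otimes> x q) = N j i \<otimes> (\<Oplus>l\<in>{..<k}. W j l \<otimes> y l)"
        by simp
    qed (use N i Wy in auto)
    finally show ?thesis .
  qed
  \<comment> \<open>The transpose of \<open>T1\<close> is \<open>N^t W^t N\<close>, so its product
    with \<open>x\<close> is \<open>N^t W^t y\<close>.\<close>
  have S2: "(\<Oplus>q\<in>{..<n}. T1 q i \<otimes> x q) = (\<Oplus>l\<in>{..<k}. N l i \<otimes> (\<Oplus>j\<in>{..<k}. W j l \<otimes> y j))" if i: "i < n" for i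
  proof -
    have "(\<Oplus>q\<in>{..<n}. T1 q i \<otimes> x q) = (\<Oplus>q\<in>{..<n}. (\<Oplus>j\<in>{..<k}. (\<Oplus>l\<in>{..<k}. W j l \<otimes> N l i) \<otimes> N j q) \<otimes> x q)"
      unfolding T1_def
    proof (rule finsum_cong')
      fix q assume q: "q \<in> {..<n}"
      have "(\<Oplus>j\<in>{..<k}. N j q \<otimes> (\<Oplus>l\<in>{..<k}. W j l \<otimes> N l i)) = (\<Oplus>j\<in>{..<k}. (\<Oplus>l\<in>{..<k}. W j l \<otimes> N l i) \<otimes> N j q)"
        by (rule finsum_cong') (use WN N i q in \<open>auto simp: m_comm\<close>)
      then show "(\<Oplus>j\<in>{..<k}. N j q \<otimes> (\<Oplus>l\<in>{..<k}. W j l \<otimes> N l i)) \<otimes> x q = (\<Oplus>j\<in>{..<k}. (\<Oplus>l\<in>{..<k}. W j l \<otimes> N l i) \<otimes> N j q) \<otimes> x q"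
        by simp
    qed (use WN N i Xc in \<open>auto intro!: finsum_closed m_closed\<close>)
    also have "\<dots> = (\<Oplus>j\<in>{..<k}. (\<Oplus>l\<in>{..<k}. W j l \<otimes> N l i) \<otimes> (\<Oplus>q\<in>{..<n}. N j q \<otimes> x q))"
      by (rule dot_assoc) (use WN N i Xc in auto)
    also have "\<dots> = (\<Oplus>j\<in>{..<k}. (\<Oplus>l\<in>{..<k}. N l i \<otimes> W j l) \<otimes> y j)"
    proof (rule finsum_cong')
      fix j assume j: "j \<in> {..<k}"
      have "(\<Oplus>l\<in>{..<k}. W j l \<otimes> N l i) = (\<Oplus>l\<in>{..<k}. N l i \<otimes> W j l)"
        by (rule finsum_cong') (use Wc N i j in \<open>auto simp: m_comm\<close>)
      then show "(\<Oplus>l\<in>{..<k}. W j l \<otimes> N l i) \<otimes> (\<Oplus>q\<in>{..<n}. N j q \<otimes> x q) = (\<Oplus>l\<in>{..<k}. N l i \<otimes> W j l) \<otimes> y j"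
        using yX j by simp
    qed (use Wc N i yc in \<open>auto intro!: finsum_closed m_closed\<close>)
    also have "\<dots> = (\<Oplus>l\<in>{..<k}. N l i \<otimes> (\<Oplus>j\<in>{..<k}. W j l \<otimes> y j))"
      by (rule dot_assoc) (use Wc N i yc in auto)
    finally show ?thesis .
  qed
  have S12: "(\<Oplus>q\<in>{..<n}. T1 i q \<otimes> x q) \<ominus> (\<Oplus>q\<in>{..<n}. T1 q i \<otimes> x q) = (\<Oplus>j\<in>{..<k}. N j i \<otimes> b j)" if i: "i < n" for i
  proof -
    have bj: "b j = (\<Oplus>l\<in>{..<k}. W j l \<otimes> y l) \<ominus> (\<Oplus>l\<in>{..<k}. W l j \<otimes> y l)" if j: "j < k" for j
    proof -
      have "b j = (\<Oplus>l\<in>{..<k}. W j l \<otimes> y l \<ominus> W l j \<otimes> y l)"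
        unfolding bW[OF j] using Wc yc j
        by (intro finsum_cong') (auto simp: a_minus_def l_distr l_minus)
      then show ?thesis using Wc yc j by (simp add: finsum_diff Pi_def)
    qed
    have "(\<Oplus>j\<in>{..<k}. N j i \<otimes> b j) =
      (\<Oplus>j\<in>{..<k}. N j i \<otimes> (\<Oplus>l\<in>{..<k}. W j l \<otimes> y l) \<ominus> N j i \<otimes> (\<Oplus>l\<in>{..<k}. W l j \<otimes> y l))"
    proof (rule finsum_cong')
      fix j assume "j \<in> {..<k}"
      then show "N j i \<otimes> b j = N j i \<otimes> (\<Oplus>l\<in>{..<k}. W j l \<otimes> y l) \<ominus> N j i \<otimes> (\<Oplus>l\<in>{..<k}. W l j \<otimes> y l)"
        using bj[of j] Wy[of j] N[of j i] i by (simp add: a_minus_def r_distr r_minus)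
    qed (use N i Wy in auto)
    also have "\<dots> = (\<Oplus>j\<in>{..<k}. N j i \<otimes> (\<Oplus>l\<in>{..<k}. W j l \<otimes> y l)) \<ominus> (\<Oplus>j\<in>{..<k}. N j i \<otimes> (\<Oplus>l\<in>{..<k}. W l j \<otimes> y l))"
      by (rule finsum_diff) (use N i Wy in auto)
    finally show ?thesis using S1[OF i] S2[OF i] by simp
  qed
  have S3: "(\<Oplus>q\<in>{..<n}. T2 i q \<otimes> x q) = a i \<ominus> (\<Oplus>j\<in>{..<k}. N j i \<otimes> b j)" if i: "i < n" for i
  proof -
    have "(\<Oplus>q\<in>{..<n}. T2 i q \<otimes> x q) = (\<Oplus>p\<in>{..<n}. r p i \<otimes> (\<Oplus>q\<in>{..<n}. A p q \<otimes> x q))"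
      unfolding T2_def by (rule dot_assoc) (use rc Ac Xc i in auto)
    also have "\<dots> = (\<Oplus>p\<in>{..<n}. (if i = p then \<one> else \<zero>) \<otimes> a p \<ominus> (\<Oplus>j\<in>{..<k}. N j i \<otimes> M p j) \<otimes> a p)"
    proof (rule finsum_cong')
      fix p assume "p \<in> {..<n}"
      then have p: "p < n" by simp
      have "(\<Oplus>q\<in>{..<n}. A p q \<otimes> x q) = a p" using A p by simp
      moreover have "(\<Oplus>j\<in>{..<k}. N j i \<otimes> M p j) = (\<Oplus>j\<in>{..<k}. M p j \<otimes> N j i)"
        by (rule finsum_cong') (use M N p i in \<open>auto simp: m_comm\<close>)
      ultimately show "r p i \<otimes> (\<Oplus>q\<in>{..<n}. A p q \<otimes> x q) =
          (if i = p then \<one> else \<zero>) \<otimes> a p \<ominus> (\<Oplus>j\<in>{..<k}. N j i \<otimes> M p j) \<otimes> a p"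
        unfolding r_def using MN[OF p i] ac[OF p] by (auto simp: a_minus_def l_distr l_minus)
    qed (use M N i ac in \<open>auto intro!: minus_closed m_closed finsum_closed\<close>)
    also have "\<dots> = (\<Oplus>p\<in>{..<n}. (if i = p then \<one> else \<zero>) \<otimes> a p) \<ominus> (\<Oplus>p\<in>{..<n}. (\<Oplus>j\<in>{..<k}. N j i \<otimes> M p j) \<otimes> a p)"
      by (rule finsum_diff) (use M N i ac in \<open>auto intro!: m_closed finsum_closed\<close>)
    also have "(\<Oplus>p\<in>{..<n}. (if i = p then \<one> else \<zero>) \<otimes> a p) = a i"
      by (rule finsum_delta) (use i ac in auto)
    also have "(\<Oplus>p\<in>{..<n}. (\<Oplus>j\<in>{..<k}. N j i \<otimes> M p j) \<otimes> a p) = (\<Oplus>j\<in>{..<k}. N j i \<otimes> (\<Oplus>p\<in>{..<n}. M p j \<otimes> a p))"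
      by (rule dot_assoc) (use M N i ac in auto)
    also have "\<dots> = (\<Oplus>j\<in>{..<k}. N j i \<otimes> b j)"
    proof (rule finsum_cong')
      fix j assume j: "j \<in> {..<k}"
      have "(\<Oplus>p\<in>{..<n}. M p j \<otimes> a p) = b j"
        unfolding b_def by (rule finsum_cong') (use M j ac in \<open>auto simp: m_comm\<close>)
      then show "N j i \<otimes> (\<Oplus>p\<in>{..<n}. M p j \<otimes> a p) = N j i \<otimes> b j" by simp
    qed (use N i bc in auto)
    finally show ?thesis .
  qed
  have S4: "(\<Oplus>q\<in>{..<n}. T2 q i \<otimes> x q) = \<zero>" if i: "i < n" for i
  proof -
    have "(\<Oplus>q\<in>{..<n}. T2 q i \<otimes> x q) = (\<Oplus>q\<in>{..<n}. (\<Oplus>p\<in>{..<n}. A p i \<otimes> r p q) \<otimes> x q)"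
    proof (rule finsum_cong')
      fix q assume q: "q \<in> {..<n}"
      have "T2 q i = (\<Oplus>p\<in>{..<n}. A p i \<otimes> r p q)"
        unfolding T2_def by (rule finsum_cong') (use Ac rc q i in \<open>auto simp: m_comm\<close>)
      then show "T2 q i \<otimes> x q = (\<Oplus>p\<in>{..<n}. A p i \<otimes> r p q) \<otimes> x q" by simp
    qed (use Ac rc i Xc in \<open>auto intro!: m_closed finsum_closed\<close>)
    also have "\<dots> = (\<Oplus>p\<in>{..<n}. A p i \<otimes> (\<Oplus>q\<in>{..<n}. r p q \<otimes> x q))"
      by (rule dot_assoc) (use Ac rc i Xc in auto)
    also have "\<dots> = (\<Oplus>p\<in>{..<n}. \<zero>)" using r0 Ac i by (intro finsum_cong') auto
    finally show ?thesis by simp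
  qed
  define T where "T i q = T1 i q \<oplus> T2 i q" for i q
  have "a i = (\<Oplus>q\<in>{..<n}. (T i q \<ominus> T q i) \<otimes> x q)" if i: "i < n" for i
  proof -
    have tc: "T1 i q \<otimes> x q \<in> carrier R" "T1 q i \<otimes> x q \<in> carrier R" "T2 i q \<otimes> x q \<in> carrier R" "T2 q i \<otimes> x q \<in> carrier R"
      if "q < n" for q using T1c T2c Xc that i by auto
    have "(\<Oplus>q\<in>{..<n}. (T i q \<ominus> T q i) \<otimes> x q) =
       (\<Oplus>q\<in>{..<n}. (T1 i q \<otimes> x q \<ominus> T1 q i \<otimes> x q) \<oplus> (T2 i q \<otimes> x q \<ominus> T2 q i \<otimes> x q))"
    proof (rule finsum_cong')
      fix q assume "q \<in> {..<n}"
      then have "T1 i q \<in> carrier R" "T1 q i \<in> carrier R" "T2 i q \<in> carrier R" "T2 q i \<in> carrier R" "x q \<in> carrier R"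
        using T1c T2c Xc i by auto
      then show "(T i q \<ominus> T q i) \<otimes> x q = (T1 i q \<otimes> x q \<ominus> T1 q i \<otimes> x q) \<oplus> (T2 i q \<otimes> x q \<ominus> T2 q i \<otimes> x q)"
        unfolding T_def by algebra
    qed (use tc in auto)
    also have "\<dots> = ((\<Oplus>q\<in>{..<n}. T1 i q \<otimes> x q) \<ominus> (\<Oplus>q\<in>{..<n}. T1 q i \<otimes> x q)) \<oplus>
        ((\<Oplus>q\<in>{..<n}. T2 i q \<otimes> x q) \<ominus> (\<Oplus>q\<in>{..<n}. T2 q i \<otimes> x q))"
      using tc by (simp add: finsum_addf finsum_diff Pi_def)
    also have "\<dots> = (\<Oplus>j\<in>{..<k}. N j i \<otimes> b j) \<oplus> ((a i \<ominus> (\<Oplus>j\<in>{..<k}. N j i \<otimes> b j)) \<ominus> \<zero>)"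
      using S12[OF i] S3[OF i] S4[OF i] by simp
    also have "\<dots> = a i"
    proof -
      have "u \<oplus> ((v \<ominus> u) \<ominus> \<zero>) = v" if "u \<in> carrier R" "v \<in> carrier R" for u v
        using that by algebra
      moreover have "(\<Oplus>j\<in>{..<k}. N j i \<otimes> b j) \<in> carrier R" using N i bc by (auto intro!: finsum_closed)
      ultimately show ?thesis using ac[OF i] by blast
    qed
    finally show ?thesis by simp
  qed
  moreover have "T \<in> {..<n} \<rightarrow> {..<n} \<rightarrow> carrier R" unfolding T_def using T1c T2c by auto
  ultimately show "\<exists>T\<in>{..<n} \<rightarrow> {..<n} \<rightarrow> carrier R. \<forall>i<n. a i = (\<Oplus>j\<in>{..<n}. (T i j \<ominus> T j i) \<otimes> x j)"
    by blast
qed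

text \<open>The coefficient ideal is arbitrary so that one lemma covers both \<open>(x)\<close> and
  \<open>I (x)\<close>.\<close>

lemma combination_ideal:
  assumes "x \<in> {..<n::nat} \<rightarrow> carrier R" "ideal I R"
  shows "ideal {\<Oplus>i\<in>{..<n}. c i \<otimes> x i | c. c \<in> {..<n} \<rightarrow> I} R"
proof -
  interpret I: ideal I R by fact
  have xc: "x i \<in> carrier R" if "i < n" for i using assms(1) that by auto
  show ?thesis
  proof (rule ideal_memI)
    show "{\<Oplus>i\<in>{..<n}. c i \<otimes> x i | c. c \<in> {..<n} \<rightarrow> I} \<subseteq> carrier R"
    proof clarify
      fix c assume c: "c \<in> {..<n} \<rightarrow> I"
      have "c i \<in> carrier R" if "i < n" for i using I.Icarr[OF funcset_mem[OF c, of i]] that by simp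
      then show "(\<Oplus>i\<in>{..<n}. c i \<otimes> x i) \<in> carrier R" using xc by (auto intro!: finsum_closed)
    qed
    have "\<zero> = (\<Oplus>i\<in>{..<n}. \<zero> \<otimes> x i)"
      using xc by (intro add.finprod_one_eqI[symmetric]) auto
    then show "\<zero> \<in> {\<Oplus>i\<in>{..<n}. c i \<otimes> x i | c. c \<in> {..<n} \<rightarrow> I}"
      using I.zero_closed by (auto intro!: exI[of _ "\<lambda>_. \<zero>"])
  next
    fix a b assume "a \<in> {\<Oplus>i\<in>{..<n}. c i \<otimes> x i | c. c \<in> {..<n} \<rightarrow> I}"
      "b \<in> {\<Oplus>i\<in>{..<n}. c i \<otimes> x i | c. c \<in> {..<n} \<rightarrow> I}"
    then obtain c d where c: "c \<in> {..<n} \<rightarrow> I" "d \<in> {..<n} \<rightarrow> I"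
      and ab: "a = (\<Oplus>i\<in>{..<n}. c i \<otimes> x i)" "b = (\<Oplus>i\<in>{..<n}. d i \<otimes> x i)" by blast
    have cc: "c i \<in> carrier R" "d i \<in> carrier R" if "i < n" for i
      using I.Icarr[OF funcset_mem[OF c(1), of i]] I.Icarr[OF funcset_mem[OF c(2), of i]] that by simp_all
    have "a \<oplus> b = (\<Oplus>i\<in>{..<n}. c i \<otimes> x i \<oplus> d i \<otimes> x i)"
      unfolding ab using cc xc by (intro finsum_addf[symmetric]) auto
    also have "\<dots> = (\<Oplus>i\<in>{..<n}. (c i \<oplus> d i) \<otimes> x i)"
      using cc xc by (intro finsum_cong') (auto simp: l_distr)
    finally show "a \<oplus> b \<in> {\<Oplus>i\<in>{..<n}. c i \<otimes> x i | c. c \<in> {..<n} \<rightarrow> I}"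
      using c by (auto intro!: exI[of _ "\<lambda>i. c i \<oplus> d i"])
  next
    fix r a assume r: "r \<in> carrier R" and "a \<in> {\<Oplus>i\<in>{..<n}. c i \<otimes> x i | c. c \<in> {..<n} \<rightarrow> I}"
    then obtain c where c: "c \<in> {..<n} \<rightarrow> I" and a: "a = (\<Oplus>i\<in>{..<n}. c i \<otimes> x i)" by blast
    have cc: "c i \<in> carrier R" if "i < n" for i using I.Icarr[OF funcset_mem[OF c, of i]] that by simp
    have "r \<otimes> a = (\<Oplus>i\<in>{..<n}. r \<otimes> (c i \<otimes> x i))"
      unfolding a using cc xc r by (intro finsum_rdistr) auto
    also have "\<dots> = (\<Oplus>i\<in>{..<n}. (r \<otimes> c i) \<otimes> x i)"
      using cc xc r by (intro finsum_cong') (auto simp: m_assoc)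
    finally show "r \<otimes> a \<in> {\<Oplus>i\<in>{..<n}. c i \<otimes> x i | c. c \<in> {..<n} \<rightarrow> I}"
      using c r I.I_l_closed by (auto intro!: exI[of _ "\<lambda>i. r \<otimes> c i"])
  qed
qed

lemma genideal_combination:
  assumes "x \<in> {..<n::nat} \<rightarrow> carrier R" "a \<in> Idl (x ` {..<n})"
  shows "\<exists>c\<in>{..<n} \<rightarrow> carrier R. a = (\<Oplus>i\<in>{..<n}. c i \<otimes> x i)"
proof -
  let ?C = "{\<Oplus>i\<in>{..<n}. c i \<otimes> x i | c. c \<in> {..<n} \<rightarrow> carrier R}"
  have "x ` {..<n} \<subseteq> ?C"
  proof
    fix r assume "r \<in> x ` {..<n}"
    then obtain i where i: "i < n" "r = x i" by auto
    have "r = (\<Oplus>j\<in>{..<n}. (if i = j then \<one> else \<zero>) \<otimes> x j)"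
      using finsum_delta[of "{..<n}" i x] i assms(1) by simp
    then show "r \<in> ?C" by (auto intro!: exI[of _ "\<lambda>j. if i = j then \<one> else \<zero>"])
  qed
  then have "Idl (x ` {..<n}) \<subseteq> ?C"
    by (rule genideal_minimal[OF combination_ideal[OF assms(1) oneideal]])
  then show ?thesis using assms(2) by blast
qed

lemma finsum_in_ideal:
  assumes "ideal I R" "finite A" "\<And>i. i \<in> A \<Longrightarrow> f i \<in> I"
  shows "(\<Oplus>i\<in>A. f i) \<in> I"
  using assms(2,3)
proof (induction A)
  case empty
  then show ?case using additive_subgroup.zero_closed[OF ideal.axioms(1)[OF assms(1)]] by simp
next
  case (insert a A)
  then have "f a \<oplus> (\<Oplus>i\<in>A. f i) \<in> I"
    using additive_subgroup.a_closed[OF ideal.axioms(1)[OF assms(1)]] by auto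
  moreover have "f \<in> A \<rightarrow> carrier R" "f a \<in> carrier R" using insert.prems ideal.Icarr[OF assms(1)] by auto
  ultimately show ?case using insert.hyps by simp
qed

text \<open>If \<open>u \<in> I\<close> and \<open>v\<close> is a combination of the
  \<open>x i\<close> with coefficients \<open>c i\<close>, then \<open>u v\<close> has the
  coefficients \<open>u (c i)\<close>, which lie in \<open>I\<close>.\<close>

lemma ideal_prod_combination:
  assumes x: "x \<in> {..<n::nat} \<rightarrow> carrier R" and I: "ideal I R" and a: "a \<in> I \<cdot> (Idl (x ` {..<n}))"
  shows "\<exists>b\<in>{..<n} \<rightarrow> I. a = (\<Oplus>i\<in>{..<n}. b i \<otimes> x i)"
proof -
  let ?C = "{\<Oplus>i\<in>{..<n}. c i \<otimes> x i | c. c \<in> {..<n} \<rightarrow> I}"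
  interpret C: ideal ?C R by (rule combination_ideal[OF x I])
  interpret I: ideal I R by fact
  have xc: "x i \<in> carrier R" if "i < n" for i using x that by auto
  from a have "a \<in> ?C"
  proof (induction a rule: ideal_prod.induct)
    case (prod u v)
    then obtain c where c: "c \<in> {..<n} \<rightarrow> carrier R" and v: "v = (\<Oplus>i\<in>{..<n}. c i \<otimes> x i)"
      using genideal_combination[OF x] by blast
    have uc: "u \<in> carrier R" using prod I.Icarr by blast
    have cc: "c i \<in> carrier R" if "i < n" for i using c that by auto
    have "u \<otimes> v = (\<Oplus>i\<in>{..<n}. u \<otimes> (c i \<otimes> x i))"
      unfolding v using uc cc xc by (intro finsum_rdistr) auto
    also have "\<dots> = (\<Oplus>i\<in>{..<n}. (u \<otimes> c i) \<otimes> x i)"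
      using uc cc xc by (intro finsum_cong') (auto simp: m_assoc)
    finally show ?case using prod(1) cc I.I_r_closed by (auto intro!: exI[of _ "\<lambda>i. u \<otimes> c i"])
  next
    case (sum u v)
    then show ?case by (intro C.a_closed)
  qed
  then show ?thesis by blast
qed

text \<open>Gaussian elimination modulo \<open>m\<close>.\<close>

lemma underdetermined_system_mod_ideal:
  fixes k :: nat
  assumes m: "ideal m R" "\<one> \<notin> m" and inverse: "\<And>a. a \<in> carrier R \<Longrightarrow> a \<notin> m \<Longrightarrow> \<exists>b\<in>carrier R. a \<otimes> b \<ominus> \<one> \<in> m"
    and "finite S" "k < card S" "\<And>p j. p \<in> S \<Longrightarrow> j < k \<Longrightarrow> M p j \<in> carrier R"
  shows "\<exists>v\<in>S \<rightarrow> carrier R. (\<exists>p\<in>S. v p \<notin> m) \<and> (\<forall>j<k. (\<Oplus>p\<in>S. v p \<otimes> M p j) \<in> m)"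
  using assms(4-)
proof (induction k arbitrary: S M)
  case 0
  then have "S \<noteq> {}" by auto
  then show ?case using m by (intro bexI[of _ "\<lambda>_. \<one>"]) auto
next
  case (Suc k)
  interpret m: ideal m R by fact
  have Mc: "M p j \<in> carrier R" if "p \<in> S" "j < Suc k" for p j using Suc.prems(3) that .
  show ?case
  proof (cases "\<forall>p\<in>S. M p k \<in> m")
    case True
    have "k < card S" using Suc.prems(2) by simp
    then obtain v where v: "v \<in> S \<rightarrow> carrier R" "\<exists>p\<in>S. v p \<notin> m" "\<And>j. j < k \<Longrightarrow> (\<Oplus>p\<in>S. v p \<otimes> M p j) \<in> m"
      using Suc.IH[of S M] Suc.prems(1) Mc by auto
    have "(\<Oplus>p\<in>S. v p \<otimes> M p k) \<in> m"
      by (rule finsum_in_ideal[OF m(1) Suc.prems(1)])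
        (use True funcset_mem[OF v(1)] m.I_l_closed in blast)
    then have "\<forall>j<Suc k. (\<Oplus>p\<in>S. v p \<otimes> M p j) \<in> m" using v(3) by (auto simp: less_Suc_eq)
    then show ?thesis using v by blast
  next
    case False
    then obtain p0 where p0: "p0 \<in> S" "M p0 k \<notin> m" by blast
    then obtain b where b: "b \<in> carrier R" "M p0 k \<otimes> b \<ominus> \<one> \<in> m" using inverse Mc by blast
    define S' where "S' = S - {p0}"
    \<comment> \<open>Elimination with the pivot \<open>M p0 k\<close>: subtracting this multiple of
      row \<open>p0\<close> clears column \<open>k\<close> of the other rows modulo
      \<open>m\<close>.\<close>
    define M' where "M' p j = M p j \<ominus> M p k \<otimes> b \<otimes> M p0 j" for p j
    have S': "finite S'" "k < card S'" "p0 \<notin> S'" "S = insert p0 S'"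
      using Suc.prems(1,2) p0 by (auto simp: S'_def)
    have M'c: "M' p j \<in> carrier R" if "p \<in> S'" "j < k" for p j
      unfolding M'_def using Mc[of p j] Mc[of p k] Mc[of p0 j] that p0 b by (auto simp: S'_def)
    obtain v where v: "v \<in> S' \<rightarrow> carrier R" "\<exists>p\<in>S'. v p \<notin> m" "\<And>j. j < k \<Longrightarrow> (\<Oplus>p\<in>S'. v p \<otimes> M' p j) \<in> m"
      using Suc.IH[OF S'(1,2), of M'] M'c by auto
    have vc: "v p \<in> carrier R" if "p \<in> S'" for p using v that by auto
    have Mc': "M p j \<in> carrier R" if "p \<in> S'" "j < Suc k" for p j using Mc that by (auto simp: S'_def)
    define c where "c = (\<Oplus>p\<in>S'. v p \<otimes> M p k)"
    have cc: "c \<in> carrier R" unfolding c_def using vc Mc' by (auto intro!: finsum_closed)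
    \<comment> \<open>The weight of the pivot row is chosen to cancel column \<open>k\<close> modulo
      \<open>m\<close>; in the other columns the sums for \<open>M'\<close> come out.\<close>
    define w where "w p = (if p = p0 then \<ominus> (c \<otimes> b) else v p)" for p
    have sum_w: "(\<Oplus>p\<in>S. w p \<otimes> M p j) = (\<Oplus>p\<in>S'. v p \<otimes> M p j) \<ominus> c \<otimes> b \<otimes> M p0 j" if j: "j < Suc k" for j
    proof -
      have M0: "M p0 j \<in> carrier R" using Mc p0 j by blast
      have s: "(\<Oplus>p\<in>S'. v p \<otimes> M p j) \<in> carrier R" using vc Mc' j by (auto intro!: finsum_closed)
      have "(\<Oplus>p\<in>S. w p \<otimes> M p j) = w p0 \<otimes> M p0 j \<oplus> (\<Oplus>p\<in>S'. w p \<otimes> M p j)"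
        unfolding S'(4) using S' vc Mc' cc b j M0 by (subst finsum_insert) (auto simp: w_def)
      also have "(\<Oplus>p\<in>S'. w p \<otimes> M p j) = (\<Oplus>p\<in>S'. v p \<otimes> M p j)"
        using S'(3) vc Mc' j by (intro finsum_cong') (auto simp: w_def)
      also have "w p0 \<otimes> M p0 j = \<ominus> (c \<otimes> b \<otimes> M p0 j)" using cc b M0 by (simp add: w_def l_minus)
      finally show ?thesis using s cc b M0 by (simp add: a_minus_def a_comm)
    qed
    have "(\<Oplus>p\<in>S. w p \<otimes> M p j) \<in> m" if j: "j < Suc k" for j
    proof (cases "j = k")
      case True
      have "(\<Oplus>p\<in>S. w p \<otimes> M p j) = c \<ominus> c \<otimes> b \<otimes> M p0 k" using sum_w[OF j] True by (simp add: c_def)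
      also have "\<dots> = \<ominus> c \<otimes> (M p0 k \<otimes> b \<ominus> \<one>)"
        using cc b(1) Mc[OF p0(1), of k] by simp algebra
      also have "\<dots> \<in> m" using m.I_l_closed[OF b(2)] cc by simp
      finally show ?thesis .
    next
      case False
      then have jk: "j < k" using j by simp
      have M0: "M p0 j \<in> carrier R" using Mc p0 j by blast
      have "(\<Oplus>p\<in>S'. v p \<otimes> M' p j) = (\<Oplus>p\<in>S'. v p \<otimes> M p j \<ominus> (v p \<otimes> M p k) \<otimes> (b \<otimes> M p0 j))"
      proof (rule finsum_cong')
        fix p assume p: "p \<in> S'"
        show "v p \<otimes> M' p j = v p \<otimes> M p j \<ominus> (v p \<otimes> M p k) \<otimes> (b \<otimes> M p0 j)"
          unfolding M'_def using vc[OF p] Mc'[OF p j] Mc'[OF p, of k] b(1) M0 by simp algebra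
      qed (use vc Mc' j b M0 in auto)
      also have "\<dots> = (\<Oplus>p\<in>S'. v p \<otimes> M p j) \<ominus> (\<Oplus>p\<in>S'. (v p \<otimes> M p k) \<otimes> (b \<otimes> M p0 j))"
        by (rule finsum_diff[OF S'(1)]) (use vc Mc' j b M0 in auto)
      also have "(\<Oplus>p\<in>S'. (v p \<otimes> M p k) \<otimes> (b \<otimes> M p0 j)) = c \<otimes> (b \<otimes> M p0 j)"
        unfolding c_def using vc Mc' b M0 S'(1) by (intro finsum_ldistr[symmetric]) auto
      finally show ?thesis using sum_w[OF j] v(3)[OF jk] cc b M0 by (simp add: m_assoc)
    qed
    moreover have "w \<in> S \<rightarrow> carrier R" using vc cc b S'(4) by (auto simp: w_def)
    moreover have "\<exists>p\<in>S. w p \<notin> m" using v(2) S' by (auto simp: w_def)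
    ultimately show ?thesis by blast
  qed
qed

text \<open>Modulo \<open>m\<close> this compares an independent with a spanning family. Write
  \<open>x = M y\<close> and \<open>y = N x\<close>. If \<open>n > k\<close>, some \<open>v\<close>
  with an entry outside \<open>m\<close> has \<open>e = v M\<close> with all entries in
  \<open>m\<close>. Then \<open>v x = e y = (e N) x\<close>, so \<open>v - e N\<close> is a relation
  of \<open>x\<close>; its entries and those of \<open>e N\<close> lie in \<open>m\<close>, which
  forces \<open>v\<close> into \<open>m\<close>.\<close>

lemma generator_count_bound:
  fixes n k :: nat
  assumes m: "ideal m R" "\<one> \<notin> m" and inverse: "\<And>a. a \<in> carrier R \<Longrightarrow> a \<notin> m \<Longrightarrow> \<exists>b\<in>carrier R. a \<otimes> b \<ominus> \<one> \<in> m"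
    and x: "x \<in> {..<n} \<rightarrow> carrier R" and y: "y \<in> {..<k} \<rightarrow> carrier R"
    and gen: "x ` {..<n} \<subseteq> Idl (y ` {..<k})" "y ` {..<k} \<subseteq> Idl (x ` {..<n})"
    and indep: "\<And>a i. a \<in> {..<n} \<rightarrow> carrier R \<Longrightarrow> (\<Oplus>i\<in>{..<n}. a i \<otimes> x i) = \<zero> \<Longrightarrow> i < n \<Longrightarrow> a i \<in> m"
  shows "n \<le> k"
proof (rule ccontr)
  interpret m: ideal m R by fact
  assume "\<not> n \<le> k"
  then have kn: "k < card {..<n}" by simp
  have xc: "x i \<in> carrier R" if "i < n" for i using x that by auto
  have yc: "y i \<in> carrier R" if "i < k" for i using y that by auto
  have "\<forall>i. \<exists>c. i < n \<longrightarrow> c \<in> {..<k} \<rightarrow> carrier R \<and> x i = (\<Oplus>j\<in>{..<k}. c j \<otimes> y j)"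
    using genideal_combination[OF y] gen(1) by blast
  then obtain M where M: "\<And>i. i < n \<Longrightarrow> M i \<in> {..<k} \<rightarrow> carrier R \<and> x i = (\<Oplus>j\<in>{..<k}. M i j \<otimes> y j)"
    by - (drule choice, blast)
  have "\<forall>j. \<exists>c. j < k \<longrightarrow> c \<in> {..<n} \<rightarrow> carrier R \<and> y j = (\<Oplus>i\<in>{..<n}. c i \<otimes> x i)"
    using genideal_combination[OF x] gen(2) by blast
  then obtain N where N: "\<And>j. j < k \<Longrightarrow> N j \<in> {..<n} \<rightarrow> carrier R \<and> y j = (\<Oplus>i\<in>{..<n}. N j i \<otimes> x i)"
    by - (drule choice, blast)
  have Mc: "M i j \<in> carrier R" if "i < n" "j < k" for i j using M[of i] that by auto
  have Nc: "N j i \<in> carrier R" if "i < n" "j < k" for i j using N[of j] that by auto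
  obtain v where v: "v \<in> {..<n} \<rightarrow> carrier R" "\<exists>p\<in>{..<n}. v p \<notin> m" "\<And>j. j < k \<Longrightarrow> (\<Oplus>p\<in>{..<n}. v p \<otimes> M p j) \<in> m"
    using underdetermined_system_mod_ideal[OF m inverse finite_lessThan kn, of M] Mc by auto
  have vc: "v p \<in> carrier R" if "p < n" for p using v that by auto
  define e where "e j = (\<Oplus>p\<in>{..<n}. v p \<otimes> M p j)" for j
  have em: "e j \<in> m" if "j < k" for j using v(3) that by (simp add: e_def)
  have ec: "e j \<in> carrier R" if "j < k" for j using em m.Icarr that by blast
  define f where "f i = (\<Oplus>j\<in>{..<k}. e j \<otimes> N j i)" for i
  have fm: "f i \<in> m" if "i < n" for i
    unfolding f_def by (rule finsum_in_ideal[OF m(1)]) (use em Nc that m.I_r_closed in auto)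
  have fc: "f i \<in> carrier R" if "i < n" for i using fm m.Icarr that by blast
  have "(\<Oplus>i\<in>{..<n}. f i \<otimes> x i) = (\<Oplus>j\<in>{..<k}. e j \<otimes> (\<Oplus>i\<in>{..<n}. N j i \<otimes> x i))"
    unfolding f_def by (rule dot_assoc) (use ec Nc xc in auto)
  also have "\<dots> = (\<Oplus>j\<in>{..<k}. e j \<otimes> y j)" using N ec yc by (intro finsum_cong') auto
  also have "\<dots> = (\<Oplus>p\<in>{..<n}. v p \<otimes> (\<Oplus>j\<in>{..<k}. M p j \<otimes> y j))"
    unfolding e_def by (rule dot_assoc) (use vc Mc yc in auto)
  also have "\<dots> = (\<Oplus>p\<in>{..<n}. v p \<otimes> x p)" using M vc xc by (intro finsum_cong') auto
  finally have eq: "(\<Oplus>i\<in>{..<n}. f i \<otimes> x i) = (\<Oplus>p\<in>{..<n}. v p \<otimes> x p)" .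
  have "(\<Oplus>i\<in>{..<n}. (v i \<ominus> f i) \<otimes> x i) = (\<Oplus>i\<in>{..<n}. v i \<otimes> x i \<ominus> f i \<otimes> x i)"
    using vc fc xc by (intro finsum_cong') (auto simp: a_minus_def l_distr l_minus)
  also have "\<dots> = (\<Oplus>i\<in>{..<n}. v i \<otimes> x i) \<ominus> (\<Oplus>i\<in>{..<n}. f i \<otimes> x i)"
    by (rule finsum_diff) (use vc fc xc in auto)
  also have "\<dots> = \<zero>" unfolding eq using vc xc by (simp add: a_minus_def r_neg Pi_def)
  finally have "(\<Oplus>i\<in>{..<n}. (v i \<ominus> f i) \<otimes> x i) = \<zero>" .
  then have d: "v i \<ominus> f i \<in> m" if "i < n" for i using indep[of "\<lambda>i. v i \<ominus> f i" i] vc fc that by auto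
  have "v i \<in> m" if i: "i < n" for i
  proof -
    have "v i = (v i \<ominus> f i) \<oplus> f i" using vc[OF i] fc[OF i] by algebra
    then show ?thesis using d[OF i] fm[OF i] m.a_closed by metis
  qed
  then show False using v(2) by auto
qed

text \<open>The last coefficient is found first: \<open>a 2\<close> modulo \<open>(x, y)\<close>,
  then \<open>a 1\<close> modulo \<open>x\<close> after substitution, and finally \<open>a 0\<close>
  by cancelling \<open>x\<close>.\<close>

lemma koszul_exact_regular_sequence3:
  assumes c: "x \<in> carrier R" "y \<in> carrier R" "z \<in> carrier R" and reg: "regular_sequence3 x y z"
  shows "koszul_exact 3 (\<lambda>i. [x, y, z] ! i)"
  unfolding koszul_exact_def
proof (intro ballI impI)
  have three: "{..<3::nat} = {0, 1, 2}" by auto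
  have sum3: "(\<Oplus>i\<in>{..<3::nat}. f i) = f 0 \<oplus> (f 1 \<oplus> f 2)"
    if "f 0 \<in> carrier R" "f 1 \<in> carrier R" "f 2 \<in> carrier R" for f
    unfolding three using that by (simp add: Pi_def)
  fix a assume a: "a \<in> {..<3::nat} \<rightarrow> carrier R" and a0: "(\<Oplus>i\<in>{..<3}. a i \<otimes> [x, y, z] ! i) = \<zero>"
  have ac: "a 0 \<in> carrier R" "a 1 \<in> carrier R" "a 2 \<in> carrier R" using a by auto
  have rel: "a 0 \<otimes> x \<oplus> (a 1 \<otimes> y \<oplus> a 2 \<otimes> z) = \<zero>" using a0 ac c by (simp add: sum3)
  have "z \<otimes> a 2 = x \<otimes> (\<ominus> a 0) \<oplus> y \<otimes> (\<ominus> a 1) \<oplus> (a 0 \<otimes> x \<oplus> (a 1 \<otimes> y \<oplus> a 2 \<otimes> z))"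
    using ac c by algebra
  then have "z \<otimes> a 2 = x \<otimes> (\<ominus> a 0) \<oplus> y \<otimes> (\<ominus> a 1)" unfolding rel using ac c by simp
  then obtain p q where pq: "p \<in> carrier R" "q \<in> carrier R" "a 2 = x \<otimes> p \<oplus> y \<otimes> q"
    using reg ac a_inv_closed unfolding regular_sequence3_def by blast
  have "y \<otimes> (a 1 \<oplus> z \<otimes> q) = x \<otimes> (\<ominus> (a 0 \<oplus> z \<otimes> p)) \<oplus> (a 0 \<otimes> x \<oplus> (a 1 \<otimes> y \<oplus> a 2 \<otimes> z))"
    unfolding pq(3) using pq(1,2) ac(1,2) c by algebra
  then have "y \<otimes> (a 1 \<oplus> z \<otimes> q) = x \<otimes> (\<ominus> (a 0 \<oplus> z \<otimes> p))" unfolding rel using ac c pq by simp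
  moreover have "a 1 \<oplus> z \<otimes> q \<in> carrier R" "\<ominus> (a 0 \<oplus> z \<otimes> p) \<in> carrier R" using ac c pq by auto
  ultimately obtain b where b: "b \<in> carrier R" "a 1 \<oplus> z \<otimes> q = x \<otimes> b"
    using reg unfolding regular_sequence3_def by blast
  have "a 1 = (a 1 \<oplus> z \<otimes> q) \<ominus> z \<otimes> q" using ac c pq by algebra
  then have a1: "a 1 = x \<otimes> b \<ominus> z \<otimes> q" unfolding b(2) .
  have "x \<otimes> (a 0 \<oplus> (z \<otimes> p \<oplus> y \<otimes> b)) = a 0 \<otimes> x \<oplus> (a 1 \<otimes> y \<oplus> a 2 \<otimes> z)"
    unfolding pq(3) a1 using pq(1,2) b(1) ac(1) c by algebra
  then have "x \<otimes> (a 0 \<oplus> (z \<otimes> p \<oplus> y \<otimes> b)) = \<zero>" unfolding rel .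
  moreover have "a 0 \<oplus> (z \<otimes> p \<oplus> y \<otimes> b) \<in> carrier R" using ac c pq b by simp
  ultimately have a0': "a 0 \<oplus> (z \<otimes> p \<oplus> y \<otimes> b) = \<zero>" using reg unfolding regular_sequence3_def by blast
  have "a 0 = (a 0 \<oplus> (z \<otimes> p \<oplus> y \<otimes> b)) \<ominus> (z \<otimes> p \<oplus> y \<otimes> b)" using ac c pq b by algebra
  then have a0: "a 0 = \<ominus> (z \<otimes> p \<oplus> y \<otimes> b)" unfolding a0' using c pq b by (simp add: a_minus_def)
  \<comment> \<open>The solution reads \<open>a 0 = - z p - y b\<close>,
    \<open>a 1 = x b - z q\<close>, \<open>a 2 = x p + y q\<close>; \<open>T\<close> holds the
    entries above the diagonal of this alternating matrix.\<close>
  define T where "T i j = (if i = 0 \<and> j = 1 then \<ominus> b else if i = 0 \<and> j = 2 then \<ominus> p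
    else if i = 1 \<and> j = 2 then \<ominus> q else \<zero>)" for i j :: nat
  have "a i = (\<Oplus>j\<in>{..<3}. (T i j \<ominus> T j i) \<otimes> [x, y, z] ! j)" if i: "i < 3" for i
  proof -
    have *: "(\<Oplus>j\<in>{..<3}. (T i j \<ominus> T j i) \<otimes> [x, y, z] ! j) =
       (T i 0 \<ominus> T 0 i) \<otimes> x \<oplus> ((T i 1 \<ominus> T 1 i) \<otimes> y \<oplus> (T i 2 \<ominus> T 2 i) \<otimes> z)"
      using c pq b by (subst sum3) (auto simp: T_def)
    consider "i = 0" | "i = 1" | "i = 2" using i by linarith
    then show ?thesis
    proof cases
      case 1
      have "a 0 = (\<zero> \<ominus> \<zero>) \<otimes> x \<oplus> ((\<ominus> b \<ominus> \<zero>) \<otimes> y \<oplus> (\<ominus> p \<ominus> \<zero>) \<otimes> z)"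
        unfolding a0 using c pq(1,2) b(1) by algebra
      then show ?thesis using * unfolding 1 by (simp add: T_def)
    next
      case 2
      have "a 1 = (\<zero> \<ominus> \<ominus> b) \<otimes> x \<oplus> ((\<zero> \<ominus> \<zero>) \<otimes> y \<oplus> (\<ominus> q \<ominus> \<zero>) \<otimes> z)"
        unfolding a1 using c pq(1,2) b(1) by algebra
      then show ?thesis using * unfolding 2 by (simp add: T_def)
    next
      case 3
      have "a 2 = (\<zero> \<ominus> \<ominus> p) \<otimes> x \<oplus> ((\<zero> \<ominus> \<ominus> q) \<otimes> y \<oplus> (\<zero> \<ominus> \<zero>) \<otimes> z)"
        unfolding pq(3) using c pq(1,2) b(1) by algebra
      then show ?thesis using * unfolding 3 by (simp add: T_def)
    qed
  qed
  moreover have "T \<in> {..<3} \<rightarrow> {..<3} \<rightarrow> carrier R" using c pq b by (auto simp: T_def)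
  ultimately show "\<exists>T\<in>{..<3} \<rightarrow> {..<3} \<rightarrow> carrier R. \<forall>i<3. a i = (\<Oplus>j\<in>{..<3}. (T i j \<ominus> T j i) \<otimes> [x, y, z] ! j)"
    by blast
qed

end

section \<open>The Koszul complex as a DG-algebra\<close>

text \<open>Both sides run over the chains \<open>S \<subseteq> V \<subseteq> U\<close>, the right
  one through the bijection \<open>V = S \<union> T\<close>. This is the reindexing behind
  associativity of the exterior product.\<close>

lemma (in abelian_monoid) finsum_subsets_swap:
  assumes "finite U" and G: "\<And>S V. S \<subseteq> V \<Longrightarrow> V \<subseteq> U \<Longrightarrow> g S V \<in> carrier G"
  shows "(\<Oplus>V\<in>Pow U. \<Oplus>S\<in>Pow V. g S V) = (\<Oplus>S\<in>Pow U. \<Oplus>T\<in>Pow (U - S). g S (S \<union> T))"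
proof -
  let ?h = "\<lambda>S V. if S \<subseteq> V then g S V else \<zero>"
  have fin: "finite (Pow U)" using assms(1) by simp
  have "(\<Oplus>V\<in>Pow U. \<Oplus>S\<in>Pow V. g S V) = (\<Oplus>V\<in>Pow U. \<Oplus>S\<in>Pow U. ?h S V)"
  proof (rule finsum_cong')
    fix V assume "V \<in> Pow U"
    then show "(\<Oplus>S\<in>Pow V. g S V) = (\<Oplus>S\<in>Pow U. ?h S V)"
      using G fin by (intro add.finprod_mono_neutral_cong_left) (auto simp: Pi_def)
  qed (use G in \<open>auto intro!: finsum_closed\<close>)
  also have "\<dots> = (\<Oplus>S\<in>Pow U. \<Oplus>V\<in>Pow U. ?h S V)"
    by (rule finsum_swap) (use G fin in auto)
  also have "\<dots> = (\<Oplus>S\<in>Pow U. \<Oplus>T\<in>Pow (U - S). g S (S \<union> T))"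
  proof (rule finsum_cong')
    fix S assume S: "S \<in> Pow U"
    have "inj_on (\<lambda>T. S \<union> T) (Pow (U - S))" by (auto simp: inj_on_def)
    moreover have im: "(\<lambda>T. S \<union> T) ` Pow (U - S) = {V \<in> Pow U. S \<subseteq> V}"
    proof
      show "{V \<in> Pow U. S \<subseteq> V} \<subseteq> (\<lambda>T. S \<union> T) ` Pow (U - S)"
      proof
        fix V assume "V \<in> {V \<in> Pow U. S \<subseteq> V}"
        then have "V = S \<union> (V - S)" "V - S \<in> Pow (U - S)" by auto
        then show "V \<in> (\<lambda>T. S \<union> T) ` Pow (U - S)" by (rule image_eqI)
      qed
    qed (use S in auto)
    ultimately have "(\<Oplus>T\<in>Pow (U - S). g S (S \<union> T)) = (\<Oplus>V\<in>{V \<in> Pow U. S \<subseteq> V}. g S V)"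
      using G S by (subst im[symmetric], subst finsum_reindex) (auto simp: Pi_def)
    also have "\<dots> = (\<Oplus>V\<in>Pow U. ?h S V)"
      using G fin by (intro add.finprod_mono_neutral_cong_left) (auto simp: Pi_def)
    finally show "(\<Oplus>V\<in>Pow U. ?h S V) = (\<Oplus>T\<in>Pow (U - S). g S (S \<union> T))" by simp
  next
    have "g S (S \<union> T) \<in> carrier G" if "S \<subseteq> U" "T \<subseteq> U - S" for S T using that by (intro G) auto
    then show "(\<lambda>S. \<Oplus>T\<in>Pow (U - S). g S (S \<union> T)) \<in> Pow U \<rightarrow> carrier G"
      by (auto intro!: finsum_closed)
  qed (rule refl)
  finally show ?thesis .
qed

lemma (in abelian_monoid) finsum_Pow_insert:
  assumes "finite U" "i \<notin> U" and g: "\<And>S. S \<subseteq> insert i U \<Longrightarrow> g S \<in> carrier G"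
  shows "(\<Oplus>S\<in>Pow (insert i U). g S) = (\<Oplus>S\<in>Pow U. g S) \<oplus> (\<Oplus>S\<in>Pow U. g (insert i S))"
proof -
  have g': "g (insert i S) \<in> carrier G" "g S \<in> carrier G" if "S \<subseteq> U" for S using that by (auto intro!: g)
  have "(\<Oplus>S\<in>Pow (insert i U). g S) = (\<Oplus>S\<in>Pow U. g S) \<oplus> (\<Oplus>S\<in>insert i ` Pow U. g S)"
    unfolding Pow_insert using assms(1,2) g' by (intro finsum_Un_disjoint) auto
  also have "inj_on (insert i) (Pow U)" using assms(2) by (auto simp: inj_on_def)
  then have "(\<Oplus>S\<in>insert i ` Pow U. g S) = (\<Oplus>S\<in>Pow U. g (insert i S))"
    using g' by (intro finsum_reindex) auto
  finally show ?thesis .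
qed

text \<open>The diagonal has its own assumption, since in characteristic two antisymmetry does not
  force it to vanish.\<close>

lemma (in abelian_group) finsum_antisymmetric:
  assumes "finite A" "\<And>i j. i \<in> A \<Longrightarrow> j \<in> A \<Longrightarrow> f i j \<in> carrier G"
    "\<And>i j. i \<in> A \<Longrightarrow> j \<in> A \<Longrightarrow> i \<noteq> j \<Longrightarrow> f i j \<oplus> f j i = \<zero>" "\<And>i. i \<in> A \<Longrightarrow> f i i = \<zero>"
  shows "(\<Oplus>i\<in>A. \<Oplus>j\<in>A. f i j) = \<zero>"
  using assms
proof (induction A)
  case empty
  then show ?case by simp
next
  case (insert k A)
  have c: "f i j \<in> carrier G" if "i \<in> insert k A" "j \<in> insert k A" for i j using insert.prems(1) that .
  have cs: "(\<Oplus>j\<in>A. f i j) \<in> carrier G" if "i \<in> insert k A" for i using c that by (auto intro!: finsum_closed)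
  have "(\<Oplus>i\<in>insert k A. \<Oplus>j\<in>insert k A. f i j) = (\<Oplus>j\<in>insert k A. f k j) \<oplus> (\<Oplus>i\<in>A. \<Oplus>j\<in>insert k A. f i j)"
    using insert.hyps c by (intro finsum_insert) (auto intro!: finsum_closed)
  also have "(\<Oplus>i\<in>A. \<Oplus>j\<in>insert k A. f i j) = (\<Oplus>i\<in>A. f i k \<oplus> (\<Oplus>j\<in>A. f i j))"
    using insert.hyps c cs by (intro finsum_cong') (auto simp: Pi_def)
  also have "\<dots> = (\<Oplus>i\<in>A. f i k) \<oplus> (\<Oplus>i\<in>A. \<Oplus>j\<in>A. f i j)"
    using c cs by (intro finsum_addf) auto
  also have "(\<Oplus>i\<in>A. \<Oplus>j\<in>A. f i j) = \<zero>" using insert by auto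
  also have "(\<Oplus>j\<in>insert k A. f k j) = (\<Oplus>j\<in>A. f k j)"
    using insert.hyps insert.prems(3)[of k] c cs by (simp add: Pi_def)
  also have "(\<Oplus>j\<in>A. f k j) \<oplus> ((\<Oplus>i\<in>A. f i k) \<oplus> \<zero>) = (\<Oplus>j\<in>A. f k j \<oplus> f j k)"
    using c by (simp add: finsum_addf Pi_def)
  also have "\<dots> = (\<Oplus>j\<in>A. \<zero>)" using insert.hyps(2) insert.prems(2)[of k] by (intro finsum_cong') auto
  finally show ?case by simp
qed

section \<open>Signs of the exterior product\<close>

lemma (in ring) neg_pow_closed [simp, intro]: "neg_pow R k \<in> carrier R"
  by (simp add: neg_pow_def)

lemma (in ring) neg_pow_add: "neg_pow R (k + l) = neg_pow R k \<otimes> neg_pow R l"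
  by (simp add: neg_pow_def nat_pow_mult)

lemma (in ring) neg_pow_0 [simp]: "neg_pow R 0 = \<one>"
  by (simp add: neg_pow_def)

lemma (in ring) neg_pow_Suc: "neg_pow R (Suc k) = \<ominus> neg_pow R k"
  by (simp add: neg_pow_def r_minus)

lemma (in ring) neg_pow_square: "neg_pow R k \<otimes> neg_pow R k = \<one>"
  by (induction k) (simp_all add: neg_pow_Suc l_minus r_minus)

definition inversions :: "nat set \<Rightarrow> nat set \<Rightarrow> nat" where
  "inversions S T = card {(s, t). s \<in> S \<and> t \<in> T \<and> t < s}"

lemma finite_inversions: "finite S \<Longrightarrow> finite T \<Longrightarrow> finite {(s, t). s \<in> S \<and> t \<in> T \<and> t < s}"
  by (rule finite_subset[of _ "S \<times> T"]) auto

lemma inversions_empty [simp]: "inversions {} T = 0" "inversions S {} = 0"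
  by (auto simp: inversions_def)

lemma inversions_Un_left:
  assumes "finite S" "finite S'" "finite T" "S \<inter> S' = {}"
  shows "inversions (S \<union> S') T = inversions S T + inversions S' T"
  unfolding inversions_def using assms
  by (subst card_Un_disjoint[symmetric]) (auto intro: finite_inversions intro!: arg_cong[where f = card])

lemma inversions_Un_right:
  assumes "finite S" "finite T" "finite T'" "T \<inter> T' = {}"
  shows "inversions S (T \<union> T') = inversions S T + inversions S T'"
  unfolding inversions_def using assms
  by (subst card_Un_disjoint[symmetric]) (auto intro: finite_inversions intro!: arg_cong[where f = card])

lemma inversions_singleton: "inversions {i} T = card {t \<in> T. t < i}"
proof -
  have "{(s, t). s \<in> {i} \<and> t \<in> T \<and> t < s} = Pair i ` {t \<in> T. t < i}" by auto
  then show ?thesis unfolding inversions_def by (simp add: card_image inj_on_def)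
qed

lemma inversions_singleton_right: "inversions S {i} = card {s \<in> S. i < s}"
proof -
  have "{(s, t). s \<in> S \<and> t \<in> {i} \<and> t < s} = (\<lambda>s. (s, i)) ` {s \<in> S. i < s}" by auto
  then show ?thesis unfolding inversions_def by (simp add: card_image inj_on_def)
qed

text \<open>Moving \<open>e_i\<close> from the left of \<open>e_S\<close> to its right takes
  \<open>card S\<close> transpositions.\<close>

lemma inversions_singleton_sum:
  assumes "finite S" "i \<notin> S"
  shows "inversions {i} S + inversions S {i} = card S"
proof -
  have "x < i \<or> i < x" if "x \<in> S" for x using that assms(2) by (cases x i rule: linorder_cases) auto
  then have S: "{t \<in> S. t < i} \<union> {t \<in> S. i < t} = S" by (intro equalityI subsetI) auto
  have "card ({t \<in> S. t < i} \<union> {t \<in> S. i < t}) = card {t \<in> S. t < i} + card {t \<in> S. i < t}"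
    by (rule card_Un_disjoint) (use assms(1) in \<open>simp_all add: disjoint_iff\<close>)
  then show ?thesis unfolding S inversions_singleton inversions_singleton_right by simp
qed

lemma inversions_pair: "i \<noteq> j \<Longrightarrow> inversions {i} {j} + inversions {j} {i} = 1"
  using inversions_singleton_sum[of "{j}" i] by simp

section \<open>The exterior algebra\<close>

locale koszul_complex = cring A for A (structure) +
  fixes xs
  assumes xs_closed: "set xs \<subseteq> carrier A"
begin

definition sg :: "nat set \<Rightarrow> nat set \<Rightarrow> 'a" where
  "sg S T = neg_pow A (inversions S T)"

abbreviation B where "B \<equiv> koszul A xs"
abbreviation idx where "idx \<equiv> {..<length xs}"

lemma sg_closed [simp, intro]: "sg S T \<in> carrier A"
  by (simp add: sg_def)

lemma idx_finite: "U \<subseteq> idx \<Longrightarrow> finite U"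
  using finite_subset by blast

lemma nth_closed: "i \<in> idx \<Longrightarrow> xs ! i \<in> carrier A"
  using xs_closed by auto

lemma in_B: "f \<in> carrier B \<longleftrightarrow> f \<in> Pow idx \<rightarrow>\<^sub>E carrier A"
  by (simp add: koszul_def)

lemma coeff_closed: "f \<in> carrier B \<Longrightarrow> U \<subseteq> idx \<Longrightarrow> f U \<in> carrier A"
  unfolding in_B by auto

lemma koszul_ext:
  assumes "f \<in> carrier B" "g \<in> carrier B" "\<And>U. U \<subseteq> idx \<Longrightarrow> f U = g U"
  shows "f = g"
  using PiE_ext[of f "Pow idx" "\<lambda>_. carrier A" g] assms unfolding in_B by auto

lemma koszul_memI:
  assumes "\<And>U. U \<subseteq> idx \<Longrightarrow> f U \<in> carrier A"
  shows "restrict f (Pow idx) \<in> carrier B"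
  unfolding in_B using assms by auto

lemma mult_eq: "U \<subseteq> idx \<Longrightarrow> (f \<otimes>\<^bsub>B\<^esub> g) U = (\<Oplus>S\<in>Pow U. sg S (U - S) \<otimes> (f S \<otimes> g (U - S)))"
  by (simp add: koszul_def sg_def inversions_def)

lemma one_eq: "U \<subseteq> idx \<Longrightarrow> \<one>\<^bsub>B\<^esub> U = (if U = {} then \<one> else \<zero>)"
  by (simp add: koszul_def)

lemma zero_eq: "U \<subseteq> idx \<Longrightarrow> \<zero>\<^bsub>B\<^esub> U = \<zero>"
  by (simp add: koszul_def)

lemma add_eq: "U \<subseteq> idx \<Longrightarrow> (f \<oplus>\<^bsub>B\<^esub> g) U = f U \<oplus> g U"
  by (simp add: koszul_def)

lemma zero_closed_B: "\<zero>\<^bsub>B\<^esub> \<in> carrier B" and one_closed_B: "\<one>\<^bsub>B\<^esub> \<in> carrier B"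
  by (auto simp: koszul_def)

lemma add_closed_B: "f \<in> carrier B \<Longrightarrow> g \<in> carrier B \<Longrightarrow> f \<oplus>\<^bsub>B\<^esub> g \<in> carrier B"
  by (auto simp: koszul_def intro!: a_closed)

lemma mult_term_closed:
  assumes "f \<in> carrier B" "g \<in> carrier B" "U \<subseteq> idx" "S \<subseteq> U"
  shows "f S \<in> carrier A" "g (U - S) \<in> carrier A" "sg S (U - S) \<otimes> (f S \<otimes> g (U - S)) \<in> carrier A"
proof -
  show "f S \<in> carrier A" "g (U - S) \<in> carrier A" using assms by (auto intro!: coeff_closed)
  then show "sg S (U - S) \<otimes> (f S \<otimes> g (U - S)) \<in> carrier A" by simp
qed

lemma mult_closed_B:
  assumes "f \<in> carrier B" "g \<in> carrier B"
  shows "f \<otimes>\<^bsub>B\<^esub> g \<in> carrier B"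
proof -
  have "(\<Oplus>S\<in>Pow U. sg S (U - S) \<otimes> (f S \<otimes> g (U - S))) \<in> carrier A" if "U \<subseteq> idx" for U
    using mult_term_closed[OF assms that] by (auto intro!: finsum_closed)
  then show ?thesis by (auto simp: koszul_def sg_def inversions_def)
qed

text \<open>The cocycle identity of the signs: both sides count the inversions between the three
  blocks \<open>S\<close>, \<open>T\<close> and the rest of \<open>U\<close>.\<close>

lemma sg_assoc:
  assumes "finite U" "S \<subseteq> U" "T \<subseteq> U - S"
  shows "sg (S \<union> T) (U - (S \<union> T)) \<otimes> sg S T = sg S (U - S) \<otimes> sg T (U - S - T)"
proof -
  have f: "finite S" "finite T" "finite (U - (S \<union> T))"
    using assms by (auto intro: finite_subset[of _ U])
  have "inversions (S \<union> T) (U - (S \<union> T)) = inversions S (U - (S \<union> T)) + inversions T (U - (S \<union> T))"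
    using f assms by (intro inversions_Un_left) auto
  moreover have "inversions S (T \<union> (U - (S \<union> T))) = inversions S T + inversions S (U - (S \<union> T))"
    using f by (intro inversions_Un_right) auto
  moreover have "T \<union> (U - (S \<union> T)) = U - S" using assms by auto
  moreover have "U - S - T = U - (S \<union> T)" by auto
  ultimately show ?thesis unfolding sg_def neg_pow_add[symmetric] by (simp add: ac_simps)
qed

lemma mult_assoc_B:
  assumes f: "f \<in> carrier B" and g: "g \<in> carrier B" and h: "h \<in> carrier B"
  shows "(f \<otimes>\<^bsub>B\<^esub> g) \<otimes>\<^bsub>B\<^esub> h = f \<otimes>\<^bsub>B\<^esub> (g \<otimes>\<^bsub>B\<^esub> h)"
proof (rule koszul_ext)
  fix U assume U: "U \<subseteq> idx"
  have fin: "finite U" using U by (rule idx_finite)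
  have c: "f S \<in> carrier A" "g S \<in> carrier A" "h S \<in> carrier A" if "S \<subseteq> U" for S
    using coeff_closed f g h that U by auto
  \<comment> \<open>The triple product is a sum over \<open>S \<subseteq> V \<subseteq> U\<close>
    with the factors taken at \<open>S\<close>, \<open>V - S\<close> and \<open>U - V\<close>. The
    outer sum over \<open>V\<close> or over \<open>S\<close> yields the two bracketings.\<close>
  let ?t = "\<lambda>S V. sg V (U - V) \<otimes> sg S (V - S) \<otimes> (f S \<otimes> g (V - S) \<otimes> h (U - V))"
  have tc: "?t S V \<in> carrier A" if "S \<subseteq> V" "V \<subseteq> U" for S V
  proof -
    have "S \<subseteq> U" "V - S \<subseteq> U" "U - V \<subseteq> U" using that by auto
    then show ?thesis using c by simp
  qed
  have "((f \<otimes>\<^bsub>B\<^esub> g) \<otimes>\<^bsub>B\<^esub> h) U = (\<Oplus>V\<in>Pow U. \<Oplus>S\<in>Pow V. ?t S V)"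
    unfolding mult_eq[OF U]
  proof (rule finsum_cong')
    fix V assume V: "V \<in> Pow U"
    then have VU: "V \<subseteq> idx" "V \<subseteq> U" using U by auto
    have hc: "h (U - V) \<in> carrier A" using c by simp
    have s: "S \<subseteq> V \<Longrightarrow> f S \<in> carrier A" "g (V - S) \<in> carrier A" for S
      using VU(2) by (auto intro!: c)
    have "sg V (U - V) \<otimes> ((f \<otimes>\<^bsub>B\<^esub> g) V \<otimes> h (U - V)) =
        (\<Oplus>S\<in>Pow V. sg S (V - S) \<otimes> (f S \<otimes> g (V - S))) \<otimes> (sg V (U - V) \<otimes> h (U - V))"
    proof -
      have "(\<Oplus>S\<in>Pow V. sg S (V - S) \<otimes> (f S \<otimes> g (V - S))) \<in> carrier A" using s by (auto intro!: finsum_closed)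
      then show ?thesis unfolding mult_eq[OF VU(1)] using hc by (simp add: m_ac)
    qed
    also have "\<dots> = (\<Oplus>S\<in>Pow V. sg S (V - S) \<otimes> (f S \<otimes> g (V - S)) \<otimes> (sg V (U - V) \<otimes> h (U - V)))"
      using s hc finite_subset[OF VU(2) fin] by (intro finsum_ldistr) auto
    also have "\<dots> = (\<Oplus>S\<in>Pow V. ?t S V)"
      using s hc tc VU by (intro finsum_cong') (auto simp: m_ac)
    finally show "sg V (U - V) \<otimes> ((f \<otimes>\<^bsub>B\<^esub> g) V \<otimes> h (U - V)) = (\<Oplus>S\<in>Pow V. ?t S V)" .
  qed (use tc in \<open>auto intro!: finsum_closed\<close>)
  also have "\<dots> = (\<Oplus>S\<in>Pow U. \<Oplus>T\<in>Pow (U - S). ?t S (S \<union> T))"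
    by (rule finsum_subsets_swap[OF fin]) (use tc in auto)
  also have "\<dots> = (f \<otimes>\<^bsub>B\<^esub> (g \<otimes>\<^bsub>B\<^esub> h)) U"
    unfolding mult_eq[OF U]
  proof (rule finsum_cong')
    fix S assume S: "S \<in> Pow U"
    then have SU: "U - S \<subseteq> idx" "S \<subseteq> U" using U by auto
    have fc: "f S \<in> carrier A" using c SU by simp
    have s: "T \<subseteq> U - S \<Longrightarrow> g T \<in> carrier A" "h (U - S - T) \<in> carrier A" for T by (auto intro!: c)
    have "(\<Oplus>T\<in>Pow (U - S). ?t S (S \<union> T)) =
       (\<Oplus>T\<in>Pow (U - S). sg S (U - S) \<otimes> f S \<otimes> (sg T (U - S - T) \<otimes> (g T \<otimes> h (U - S - T))))"
    proof (rule finsum_cong')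
      fix T assume "T \<in> Pow (U - S)"
      then have T: "T \<subseteq> U - S" by simp
      then have *: "S \<union> T - S = T" "U - (S \<union> T) = U - S - T" by auto
      have "?t S (S \<union> T) = sg (S \<union> T) (U - (S \<union> T)) \<otimes> sg S T \<otimes> (f S \<otimes> g T \<otimes> h (U - S - T))"
        unfolding *(1) by (simp only: *(2))
      also have "\<dots> = sg S (U - S) \<otimes> sg T (U - S - T) \<otimes> (f S \<otimes> g T \<otimes> h (U - S - T))"
        by (simp only: sg_assoc[OF fin SU(2) T])
      also have "\<dots> = sg S (U - S) \<otimes> f S \<otimes> (sg T (U - S - T) \<otimes> (g T \<otimes> h (U - S - T)))"
        using fc s T by (simp add: m_ac)
      finally show "?t S (S \<union> T) = sg S (U - S) \<otimes> f S \<otimes> (sg T (U - S - T) \<otimes> (g T \<otimes> h (U - S - T)))" .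
    qed (use fc s in auto)
    also have "\<dots> = sg S (U - S) \<otimes> f S \<otimes> (\<Oplus>T\<in>Pow (U - S). sg T (U - S - T) \<otimes> (g T \<otimes> h (U - S - T)))"
      using fc s fin by (intro finsum_rdistr[symmetric]) auto
    also have "\<dots> = sg S (U - S) \<otimes> (f S \<otimes> (g \<otimes>\<^bsub>B\<^esub> h) (U - S))"
      unfolding mult_eq[OF SU(1)] using fc s by (intro m_assoc) (auto intro!: finsum_closed)
    finally show "(\<Oplus>T\<in>Pow (U - S). ?t S (S \<union> T)) = sg S (U - S) \<otimes> (f S \<otimes> (g \<otimes>\<^bsub>B\<^esub> h) (U - S))" .
  qed (use mult_term_closed[OF f mult_closed_B[OF g h] U] in auto)
  finally show "((f \<otimes>\<^bsub>B\<^esub> g) \<otimes>\<^bsub>B\<^esub> h) U = (f \<otimes>\<^bsub>B\<^esub> (g \<otimes>\<^bsub>B\<^esub> h)) U" .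
qed (use mult_closed_B f g h in auto)

lemma one_mult_B:
  assumes f: "f \<in> carrier B"
  shows "\<one>\<^bsub>B\<^esub> \<otimes>\<^bsub>B\<^esub> f = f" "f \<otimes>\<^bsub>B\<^esub> \<one>\<^bsub>B\<^esub> = f"
proof -
  show "\<one>\<^bsub>B\<^esub> \<otimes>\<^bsub>B\<^esub> f = f"
  proof (rule koszul_ext)
    fix U assume U: "U \<subseteq> idx"
    have "(\<one>\<^bsub>B\<^esub> \<otimes>\<^bsub>B\<^esub> f) U = (\<Oplus>S\<in>Pow U. if {} = S then f U else \<zero>)"
      unfolding mult_eq[OF U]
    proof (rule finsum_cong')
      fix S assume "S \<in> Pow U"
      then have S: "S \<subseteq> idx" "f (U - S) \<in> carrier A" using coeff_closed[OF f, of "U - S"] U by auto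
      show "sg S (U - S) \<otimes> (\<one>\<^bsub>B\<^esub> S \<otimes> f (U - S)) = (if {} = S then f U else \<zero>)"
        unfolding one_eq[OF S(1)] using S(2) by (auto simp: sg_def)
    qed (use U f in \<open>auto simp: coeff_closed\<close>)
    also have "\<dots> = f U" using U f idx_finite[OF U] by (intro finsum_singleton) (auto simp: coeff_closed)
    finally show "(\<one>\<^bsub>B\<^esub> \<otimes>\<^bsub>B\<^esub> f) U = f U" .
  qed (use f one_closed_B mult_closed_B in auto)
  show "f \<otimes>\<^bsub>B\<^esub> \<one>\<^bsub>B\<^esub> = f"
  proof (rule koszul_ext)
    fix U assume U: "U \<subseteq> idx"
    have "(f \<otimes>\<^bsub>B\<^esub> \<one>\<^bsub>B\<^esub>) U = (\<Oplus>S\<in>Pow U. if U = S then f S else \<zero>)"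
      unfolding mult_eq[OF U]
    proof (rule finsum_cong')
      fix S assume S: "S \<in> Pow U"
      then have c: "f S \<in> carrier A" "U - S \<subseteq> idx" using coeff_closed[OF f] U by auto
      have "U - S = {} \<longleftrightarrow> U = S" using S by auto
      then show "sg S (U - S) \<otimes> (f S \<otimes> \<one>\<^bsub>B\<^esub> (U - S)) = (if U = S then f S else \<zero>)"
        unfolding one_eq[OF c(2)] using c(1) by (auto simp: sg_def)
    qed (use U f in \<open>auto simp: coeff_closed\<close>)
    also have "\<dots> = f U" using U f idx_finite[OF U] by (intro finsum_singleton) (auto intro!: coeff_closed[OF f])
    finally show "(f \<otimes>\<^bsub>B\<^esub> \<one>\<^bsub>B\<^esub>) U = f U" .
  qed (use f one_closed_B mult_closed_B in auto)
qed

lemma distr_B: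
  assumes f: "f \<in> carrier B" and g: "g \<in> carrier B" and h: "h \<in> carrier B"
  shows "(f \<oplus>\<^bsub>B\<^esub> g) \<otimes>\<^bsub>B\<^esub> h = f \<otimes>\<^bsub>B\<^esub> h \<oplus>\<^bsub>B\<^esub> g \<otimes>\<^bsub>B\<^esub> h"
    "h \<otimes>\<^bsub>B\<^esub> (f \<oplus>\<^bsub>B\<^esub> g) = h \<otimes>\<^bsub>B\<^esub> f \<oplus>\<^bsub>B\<^esub> h \<otimes>\<^bsub>B\<^esub> g"
proof -
  have c: "f S \<in> carrier A" "g S \<in> carrier A" "h S \<in> carrier A" if "S \<subseteq> U" "U \<subseteq> idx" for S U
    using coeff_closed f g h that by auto
  show "(f \<oplus>\<^bsub>B\<^esub> g) \<otimes>\<^bsub>B\<^esub> h = f \<otimes>\<^bsub>B\<^esub> h \<oplus>\<^bsub>B\<^esub> g \<otimes>\<^bsub>B\<^esub> h"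
  proof (rule koszul_ext)
    fix U assume U: "U \<subseteq> idx"
    have "((f \<oplus>\<^bsub>B\<^esub> g) \<otimes>\<^bsub>B\<^esub> h) U = (\<Oplus>S\<in>Pow U. sg S (U - S) \<otimes> (f S \<otimes> h (U - S)) \<oplus> sg S (U - S) \<otimes> (g S \<otimes> h (U - S)))"
      unfolding mult_eq[OF U]
    proof (rule finsum_cong')
      fix S assume "S \<in> Pow U"
      then have S: "S \<subseteq> idx" "S \<subseteq> U" using U by auto
      have s: "f S \<in> carrier A" "g S \<in> carrier A" "h (U - S) \<in> carrier A" using c[of _ U] S U by auto
      then show "sg S (U - S) \<otimes> ((f \<oplus>\<^bsub>B\<^esub> g) S \<otimes> h (U - S)) = sg S (U - S) \<otimes> (f S \<otimes> h (U - S)) \<oplus> sg S (U - S) \<otimes> (g S \<otimes> h (U - S))"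
        unfolding add_eq[OF S(1)] by (simp add: l_distr r_distr)
    qed (use mult_term_closed[OF f h U] mult_term_closed[OF g h U] in auto)
    also have "\<dots> = (f \<otimes>\<^bsub>B\<^esub> h) U \<oplus> (g \<otimes>\<^bsub>B\<^esub> h) U"
      unfolding mult_eq[OF U] using mult_term_closed[OF f h U] mult_term_closed[OF g h U] by (intro finsum_addf) auto
    finally show "((f \<oplus>\<^bsub>B\<^esub> g) \<otimes>\<^bsub>B\<^esub> h) U = (f \<otimes>\<^bsub>B\<^esub> h \<oplus>\<^bsub>B\<^esub> g \<otimes>\<^bsub>B\<^esub> h) U" by (simp add: add_eq[OF U])
  qed (use f g h in \<open>auto intro!: add_closed_B mult_closed_B\<close>)
  show "h \<otimes>\<^bsub>B\<^esub> (f \<oplus>\<^bsub>B\<^esub> g) = h \<otimes>\<^bsub>B\<^esub> f \<oplus>\<^bsub>B\<^esub> h \<otimes>\<^bsub>B\<^esub> g"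
  proof (rule koszul_ext)
    fix U assume U: "U \<subseteq> idx"
    have "(h \<otimes>\<^bsub>B\<^esub> (f \<oplus>\<^bsub>B\<^esub> g)) U = (\<Oplus>S\<in>Pow U. sg S (U - S) \<otimes> (h S \<otimes> f (U - S)) \<oplus> sg S (U - S) \<otimes> (h S \<otimes> g (U - S)))"
      unfolding mult_eq[OF U]
    proof (rule finsum_cong')
      fix S assume "S \<in> Pow U"
      then have S: "U - S \<subseteq> idx" "S \<subseteq> U" using U by auto
      have s: "h S \<in> carrier A" "g (U - S) \<in> carrier A" "f (U - S) \<in> carrier A" using c[of _ U] S U by auto
      then show "sg S (U - S) \<otimes> (h S \<otimes> (f \<oplus>\<^bsub>B\<^esub> g) (U - S)) = sg S (U - S) \<otimes> (h S \<otimes> f (U - S)) \<oplus> sg S (U - S) \<otimes> (h S \<otimes> g (U - S))"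
        unfolding add_eq[OF S(1)] by (simp add: l_distr r_distr)
    qed (use mult_term_closed[OF h f U] mult_term_closed[OF h g U] in auto)
    also have "\<dots> = (h \<otimes>\<^bsub>B\<^esub> f) U \<oplus> (h \<otimes>\<^bsub>B\<^esub> g) U"
      unfolding mult_eq[OF U] using mult_term_closed[OF h f U] mult_term_closed[OF h g U] by (intro finsum_addf) auto
    finally show "(h \<otimes>\<^bsub>B\<^esub> (f \<oplus>\<^bsub>B\<^esub> g)) U = (h \<otimes>\<^bsub>B\<^esub> f \<oplus>\<^bsub>B\<^esub> h \<otimes>\<^bsub>B\<^esub> g) U" by (simp add: add_eq[OF U])
  qed (use f g h in \<open>auto intro!: add_closed_B mult_closed_B\<close>)
qed

lemma koszul_ring: "ring B"
proof (rule ringI)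
  show "abelian_group B"
  proof (rule abelian_groupI)
    fix f assume f: "f \<in> carrier B"
    let ?g = "restrict (\<lambda>U. \<ominus> f U) (Pow idx)"
    have g: "?g \<in> carrier B" using f by (intro koszul_memI) (auto simp: coeff_closed)
    have "?g \<oplus>\<^bsub>B\<^esub> f = \<zero>\<^bsub>B\<^esub>"
      by (rule koszul_ext) (use f g zero_closed_B in \<open>auto simp: add_eq zero_eq coeff_closed l_neg intro!: add_closed_B\<close>)
    then show "\<exists>g\<in>carrier B. g \<oplus>\<^bsub>B\<^esub> f = \<zero>\<^bsub>B\<^esub>" using g by blast
  next
    fix f g h assume "f \<in> carrier B" "g \<in> carrier B" "h \<in> carrier B"
    then show "f \<oplus>\<^bsub>B\<^esub> g \<oplus>\<^bsub>B\<^esub> h = f \<oplus>\<^bsub>B\<^esub> (g \<oplus>\<^bsub>B\<^esub> h)"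
      by (intro koszul_ext) (auto simp: add_eq coeff_closed a_assoc intro!: add_closed_B)
  next
    fix f g assume "f \<in> carrier B" "g \<in> carrier B"
    then show "f \<oplus>\<^bsub>B\<^esub> g = g \<oplus>\<^bsub>B\<^esub> f"
      by (intro koszul_ext) (auto simp: add_eq coeff_closed a_comm intro!: add_closed_B)
  next
    fix f assume "f \<in> carrier B"
    then show "\<zero>\<^bsub>B\<^esub> \<oplus>\<^bsub>B\<^esub> f = f"
      by (intro koszul_ext) (auto simp: add_eq zero_eq coeff_closed zero_closed_B intro!: add_closed_B)
  qed (auto intro: zero_closed_B add_closed_B)
  show "monoid B" by (rule monoidI) (auto simp: mult_closed_B one_closed_B mult_assoc_B one_mult_B)
qed (auto simp: distr_B)

end

text \<open>Signs depend only on parity, so the sign identities for contractions become evenness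
  statements about numbers of inversions.\<close>

lemma (in ring) neg_pow_cong:
  assumes "even (k + l)"
  shows "neg_pow R k = neg_pow R l"
proof -
  have sq: "neg_pow R (2 * m) = \<one>" for m
    by (simp add: mult_2 neg_pow_add neg_pow_square)
  have "neg_pow R k = neg_pow R k \<otimes> (neg_pow R l \<otimes> neg_pow R l)"
    by (simp add: neg_pow_square)
  also have "\<dots> = neg_pow R (k + l) \<otimes> neg_pow R l"
    by (simp add: neg_pow_add m_assoc)
  also have "neg_pow R (k + l) = \<one>" using assms sq by (metis evenE)
  finally show ?thesis by simp
qed

lemma inversions_insert_left:
  assumes "finite S" "finite T" "i \<notin> S"
  shows "inversions (insert i S) T = inversions {i} T + inversions S T"
  using inversions_Un_left[of "{i}" S T] assms by simp

lemma inversions_insert_right: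
  assumes "finite S" "finite T" "i \<notin> T"
  shows "inversions S (insert i T) = inversions S {i} + inversions S T"
  using inversions_Un_right[of S "{i}" T] assms by simp

lemma inversions_Diff:
  assumes "finite U" "finite S" "T \<subseteq> U"
  shows "inversions S U = inversions S T + inversions S (U - T)"
proof -
  have "T \<union> (U - T) = U" using assms by auto
  then show ?thesis using inversions_Un_right[of S T "U - T"] assms finite_subset[of T U] by auto
qed

section \<open>The differential and its Leibniz rule\<close>

context koszul_complex
begin

sublocale KB: ring "koszul A xs" by (rule koszul_ring)

abbreviation dB where "dB \<equiv> differential B"

text \<open>The differential is \<open>\<Sum>\<^sub>i x\<^sub>i \<partial>\<^sub>i\<close> for the contractions \<open>\<partial>\<^sub>i\<close>, which are
  anticommuting derivations up to the sign automorphism \<open>par\<close>.\<close>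

definition contraction :: "nat \<Rightarrow> (nat set \<Rightarrow> 'a) \<Rightarrow> nat set \<Rightarrow> 'a" where
  "contraction i f = (\<lambda>U\<in>Pow idx. if i \<in> U then \<zero> else sg {i} U \<otimes> f (insert i U))"

definition par :: "(nat set \<Rightarrow> 'a) \<Rightarrow> nat set \<Rightarrow> 'a" where
  "par f = (\<lambda>U\<in>Pow idx. neg_pow A (card U) \<otimes> f U)"

lemma contraction_eq: "U \<subseteq> idx \<Longrightarrow> contraction i f U = (if i \<in> U then \<zero> else sg {i} U \<otimes> f (insert i U))"
  by (simp add: contraction_def)

lemma par_eq: "U \<subseteq> idx \<Longrightarrow> par f U = neg_pow A (card U) \<otimes> f U"
  by (simp add: par_def)

lemma contraction_closed [intro]: "f \<in> carrier B \<Longrightarrow> i \<in> idx \<Longrightarrow> contraction i f \<in> carrier B"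
  unfolding contraction_def by (intro koszul_memI) (auto simp: coeff_closed)

lemma par_closed [intro]: "f \<in> carrier B \<Longrightarrow> par f \<in> carrier B"
  unfolding par_def by (intro koszul_memI) (auto simp: coeff_closed)

lemma par_par: "f \<in> carrier B \<Longrightarrow> par (par f) = f"
  by (rule koszul_ext) (auto simp: par_eq coeff_closed m_assoc[symmetric] neg_pow_square)

text \<open>Since a contraction vanishes on the sets that contain its index, the sum can run over
  all indices independently of \<open>U\<close>; identities for \<open>d\<close> then follow from
  those for single contractions.\<close>

lemma d_eq:
  assumes f: "f \<in> carrier B" and U: "U \<subseteq> idx"
  shows "dB f U = (\<Oplus>i\<in>idx. xs ! i \<otimes> contraction i f U)"
proof -
  have "dB f U = (\<Oplus>i\<in>idx - U. sg {i} U \<otimes> (xs ! i \<otimes> f (insert i U)))"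
    using U by (simp add: koszul_def sg_def inversions_singleton)
  also have "\<dots> = (\<Oplus>i\<in>idx. xs ! i \<otimes> contraction i f U)"
    using U nth_closed coeff_closed[OF contraction_closed[OF f] U]
    by (intro add.finprod_mono_neutral_cong_left)
      (auto simp: contraction_eq coeff_closed[OF f] m_lcomm)
  finally show ?thesis .
qed

lemma d_closed [intro]:
  assumes "f \<in> carrier B" shows "dB f \<in> carrier B"
proof -
  have "(\<Oplus>i\<in>idx - U. sg {i} U \<otimes> (xs ! i \<otimes> f (insert i U))) \<in> carrier A" if "U \<subseteq> idx" for U
    using that nth_closed assms by (auto intro!: finsum_closed simp: coeff_closed)
  then show ?thesis by (auto simp: koszul_def sg_def inversions_singleton)
qed

lemma d_term_closed: "f \<in> carrier B \<Longrightarrow> U \<subseteq> idx \<Longrightarrow> i \<in> idx \<Longrightarrow> xs ! i \<otimes> contraction i f U \<in> carrier A"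
  using coeff_closed[OF contraction_closed] nth_closed by auto

lemma contraction_add:
  assumes "f \<in> carrier B" "g \<in> carrier B" "i \<in> idx"
  shows "contraction i (f \<oplus>\<^bsub>B\<^esub> g) = contraction i f \<oplus>\<^bsub>B\<^esub> contraction i g"
  using assms by (intro koszul_ext) (auto simp: contraction_eq add_eq coeff_closed r_distr)

lemma d_add:
  assumes f: "f \<in> carrier B" and g: "g \<in> carrier B"
  shows "dB (f \<oplus>\<^bsub>B\<^esub> g) = dB f \<oplus>\<^bsub>B\<^esub> dB g"
proof (rule koszul_ext)
  fix U assume U: "U \<subseteq> idx"
  have "dB (f \<oplus>\<^bsub>B\<^esub> g) U = (\<Oplus>i\<in>idx. xs ! i \<otimes> contraction i f U \<oplus> xs ! i \<otimes> contraction i g U)"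
    unfolding d_eq[OF add_closed_B[OF f g] U]
    using d_term_closed f g U nth_closed coeff_closed[OF contraction_closed]
    by (intro finsum_cong') (auto simp: contraction_add add_eq r_distr)
  also have "\<dots> = dB f U \<oplus> dB g U"
    unfolding d_eq[OF f U] d_eq[OF g U] using d_term_closed f g U by (intro finsum_addf) auto
  finally show "dB (f \<oplus>\<^bsub>B\<^esub> g) U = (dB f \<oplus>\<^bsub>B\<^esub> dB g) U" by (simp add: add_eq[OF U])
qed (use f g in auto)

lemma d_zero: "dB \<zero>\<^bsub>B\<^esub> = \<zero>\<^bsub>B\<^esub>"
proof -
  have "dB \<zero>\<^bsub>B\<^esub> \<oplus>\<^bsub>B\<^esub> dB \<zero>\<^bsub>B\<^esub> = dB \<zero>\<^bsub>B\<^esub>" using d_add[of "\<zero>\<^bsub>B\<^esub>" "\<zero>\<^bsub>B\<^esub>"] by simp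
  then show ?thesis using KB.add.l_cancel_one d_closed by blast
qed

lemma d_minus:
  assumes "f \<in> carrier B" shows "dB (\<ominus>\<^bsub>B\<^esub> f) = \<ominus>\<^bsub>B\<^esub> dB f"
proof -
  have "dB (\<ominus>\<^bsub>B\<^esub> f) \<oplus>\<^bsub>B\<^esub> dB f = \<zero>\<^bsub>B\<^esub>"
    using d_add[of "\<ominus>\<^bsub>B\<^esub> f" f] assms by (simp add: KB.l_neg d_zero)
  then show ?thesis using assms by (metis KB.minus_equality KB.a_inv_closed d_closed)
qed

text \<open>If \<open>i \<notin> U\<close>, the product evaluated at \<open>insert i U\<close> puts
  \<open>i\<close> into the left or the right factor, which gives the two terms. If
  \<open>i \<in> U\<close>, the left side is zero, and on the right the summands for
  \<open>S\<close> and \<open>insert i S\<close> cancel.\<close>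

lemma contraction_mult:
  assumes f: "f \<in> carrier B" and g: "g \<in> carrier B" and i: "i \<in> idx"
  shows "contraction i (f \<otimes>\<^bsub>B\<^esub> g) = contraction i f \<otimes>\<^bsub>B\<^esub> g \<oplus>\<^bsub>B\<^esub> par f \<otimes>\<^bsub>B\<^esub> contraction i g"
proof (rule koszul_ext)
  fix U assume U: "U \<subseteq> idx"
  have fin: "finite U" by (rule idx_finite[OF U])
  have fc: "f S \<in> carrier A" "g S \<in> carrier A" if "S \<subseteq> insert i U" for S
    using coeff_closed[OF f, of S] coeff_closed[OF g, of S] that i U by auto
  let ?R1 = "\<lambda>S. sg S (U - S) \<otimes> (contraction i f S \<otimes> g (U - S))"
  let ?R2 = "\<lambda>S. sg S (U - S) \<otimes> (par f S \<otimes> contraction i g (U - S))"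
  have R1: "?R1 S \<in> carrier A" and R2: "?R2 S \<in> carrier A" if "S \<subseteq> U" for S
    using mult_term_closed[OF contraction_closed[OF f i] g U that]
      mult_term_closed[OF par_closed[OF f] contraction_closed[OF g i] U that] by auto
  have rhs: "(contraction i f \<otimes>\<^bsub>B\<^esub> g \<oplus>\<^bsub>B\<^esub> par f \<otimes>\<^bsub>B\<^esub> contraction i g) U = (\<Oplus>S\<in>Pow U. ?R1 S \<oplus> ?R2 S)"
    unfolding add_eq[OF U] mult_eq[OF U] using R1 R2 by (intro finsum_addf[symmetric]) auto
  show "contraction i (f \<otimes>\<^bsub>B\<^esub> g) U = (contraction i f \<otimes>\<^bsub>B\<^esub> g \<oplus>\<^bsub>B\<^esub> par f \<otimes>\<^bsub>B\<^esub> contraction i g) U"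
  proof (cases "i \<in> U")
    case False
    have iU: "insert i U \<subseteq> idx" using i U by auto
    let ?L = "\<lambda>S. sg S (insert i U - S) \<otimes> (f S \<otimes> g (insert i U - S))"
    have L: "?L S \<in> carrier A" if "S \<subseteq> insert i U" for S
      using mult_term_closed[OF f g iU that] by auto
    have L': "?L S \<in> carrier A" "?L (insert i S) \<in> carrier A" if "S \<subseteq> U" for S
      by (rule L; use that in blast)+
    have "contraction i (f \<otimes>\<^bsub>B\<^esub> g) U = sg {i} U \<otimes> (\<Oplus>S\<in>Pow (insert i U). ?L S)"
      using False by (simp add: contraction_eq[OF U] mult_eq[OF iU])
    also have "(\<Oplus>S\<in>Pow (insert i U). ?L S) = (\<Oplus>S\<in>Pow U. ?L S) \<oplus> (\<Oplus>S\<in>Pow U. ?L (insert i S))"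
      using fin False L by (intro finsum_Pow_insert) auto
    also have "\<dots> = (\<Oplus>S\<in>Pow U. ?L S \<oplus> ?L (insert i S))"
      using L' by (intro finsum_addf[symmetric]) auto
    also have "sg {i} U \<otimes> \<dots> = (\<Oplus>S\<in>Pow U. sg {i} U \<otimes> (?L S \<oplus> ?L (insert i S)))"
      using L' fin by (intro finsum_rdistr) auto
    also have "\<dots> = (\<Oplus>S\<in>Pow U. ?R1 S \<oplus> ?R2 S)"
    proof (rule finsum_cong')
      fix S assume "S \<in> Pow U"
      then have S: "S \<subseteq> U" by simp
      then have SI: "S \<subseteq> idx" "U - S \<subseteq> idx" "i \<notin> S" "i \<notin> U - S" using U False by auto
      have finS: "finite S" "finite (U - S)" using fin finite_subset[OF S] by auto
      have eqs: "insert i U - S = insert i (U - S)" "insert i U - insert i S = U - S"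
        using False S by auto
      have c: "f S \<in> carrier A" "f (insert i S) \<in> carrier A" "g (U - S) \<in> carrier A" "g (insert i (U - S)) \<in> carrier A"
        using S by (auto intro!: fc)
      have U_split: "inversions {i} U = inversions {i} S + inversions {i} (U - S)"
        by (rule inversions_Diff[OF fin _ S]) simp
      \<comment> \<open>To reach the right factor, \<open>e_i\<close> passes the
        \<open>card S\<close> factors of \<open>e_S\<close>; this is the origin of
        \<open>par\<close>.\<close>
      have s1: "sg {i} U \<otimes> sg S (insert i (U - S)) = sg S (U - S) \<otimes> (neg_pow A (card S) \<otimes> sg {i} (U - S))"
        unfolding sg_def neg_pow_add[symmetric] inversions_insert_right[OF finS SI(4)] U_split
        by (intro neg_pow_cong) (auto simp: inversions_singleton_sum[OF finS(1) SI(3), symmetric])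
      have s2: "sg {i} U \<otimes> sg (insert i S) (U - S) = sg S (U - S) \<otimes> sg {i} S"
        unfolding sg_def neg_pow_add[symmetric] inversions_insert_left[OF finS SI(3)] U_split
        by (intro neg_pow_cong) auto
      have "sg {i} U \<otimes> (?L S \<oplus> ?L (insert i S)) =
         sg {i} U \<otimes> sg S (insert i (U - S)) \<otimes> (f S \<otimes> g (insert i (U - S))) \<oplus>
         sg {i} U \<otimes> sg (insert i S) (U - S) \<otimes> (f (insert i S) \<otimes> g (U - S))"
        unfolding eqs using c by (simp add: r_distr m_assoc)
      also have "\<dots> = ?R1 S \<oplus> ?R2 S"
        unfolding s1 s2 contraction_eq[OF SI(1)] contraction_eq[OF SI(2)] par_eq[OF SI(1)]
        using c SI by (simp add: m_ac a_ac)
      finally show "sg {i} U \<otimes> (?L S \<oplus> ?L (insert i S)) = ?R1 S \<oplus> ?R2 S" .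
    qed (use R1 R2 in auto)
    finally show ?thesis using rhs by simp
  next
    case True
    \<comment> \<open>The subsets of \<open>U\<close> are paired according to whether they contain
      \<open>i\<close>.\<close>
    define V where "V = U - {i}"
    have V: "U = insert i V" "i \<notin> V" "finite V" "V \<subseteq> idx" using True fin U by (auto simp: V_def)
    have RI: "?R1 (insert i S) \<in> carrier A" "?R2 (insert i S) \<in> carrier A" "?R1 S \<in> carrier A" "?R2 S \<in> carrier A"
      if "S \<subseteq> V" for S
    proof -
      have SU: "insert i S \<subseteq> U" "S \<subseteq> U" using that V(1) by auto
      show "?R1 (insert i S) \<in> carrier A" "?R2 (insert i S) \<in> carrier A" "?R1 S \<in> carrier A" "?R2 S \<in> carrier A"
        by (rule R1[OF SU(1)], rule R2[OF SU(1)], rule R1[OF SU(2)], rule R2[OF SU(2)])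
    qed
    have "(\<Oplus>S\<in>Pow U. ?R1 S \<oplus> ?R2 S) = (\<Oplus>S\<in>Pow V. ?R1 S \<oplus> ?R2 S) \<oplus> (\<Oplus>S\<in>Pow V. ?R1 (insert i S) \<oplus> ?R2 (insert i S))"
      using finsum_Pow_insert[OF V(3,2), of "\<lambda>S. ?R1 S \<oplus> ?R2 S"] R1 R2 unfolding V(1)[symmetric] by auto
    also have "\<dots> = (\<Oplus>S\<in>Pow V. (?R1 S \<oplus> ?R2 S) \<oplus> (?R1 (insert i S) \<oplus> ?R2 (insert i S)))"
      using RI by (intro finsum_addf[symmetric]) auto
    also have "\<dots> = (\<Oplus>S\<in>Pow V. \<zero>)"
    proof (rule finsum_cong')
      fix S assume "S \<in> Pow V"
      then have S: "S \<subseteq> V" by simp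
      then have SI: "S \<subseteq> idx" "insert i S \<subseteq> idx" "V - S \<subseteq> idx" "insert i (V - S) \<subseteq> idx" "i \<notin> S" "i \<notin> V - S" "i \<in> idx"
        using V i by auto
      have finS: "finite S" "finite (V - S)" using V(3) finite_subset[OF S] by auto
      have eqs: "U - S = insert i (V - S)" "U - insert i S = V - S"
        using V S by auto
      have c: "f (insert i S) \<in> carrier A" "g (insert i (V - S)) \<in> carrier A" "f S \<in> carrier A" "g (V - S) \<in> carrier A"
        using S V(1) by (auto intro!: fc)
      have s1: "sg S (insert i (V - S)) \<otimes> sg {i} S = neg_pow A (card S + inversions S (V - S))"
        unfolding sg_def neg_pow_add[symmetric] inversions_insert_right[OF finS SI(6)]
        by (intro neg_pow_cong) (auto simp: inversions_singleton_sum[OF finS(1) SI(5), symmetric])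
      \<comment> \<open>The sign of \<open>par\<close> at \<open>insert i S\<close> counts one
        element more than \<open>S\<close> has, and this makes the two summands opposite.\<close>
      have s2: "sg (insert i S) (V - S) \<otimes> (neg_pow A (card (insert i S)) \<otimes> sg {i} (V - S)) =
          \<ominus> neg_pow A (card S + inversions S (V - S))"
        unfolding sg_def neg_pow_add[symmetric] inversions_insert_left[OF finS SI(5)] neg_pow_Suc[symmetric]
        using SI(5) finS by (intro neg_pow_cong) auto
      have "?R1 S \<oplus> ?R2 S = sg S (insert i (V - S)) \<otimes> sg {i} S \<otimes> (f (insert i S) \<otimes> g (insert i (V - S)))"
        unfolding eqs contraction_eq[OF SI(1)] contraction_eq[OF SI(4)] par_eq[OF SI(1)]
        using c SI by (simp add: m_ac)
      moreover have "?R1 (insert i S) \<oplus> ?R2 (insert i S) =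
          sg (insert i S) (V - S) \<otimes> (neg_pow A (card (insert i S)) \<otimes> sg {i} (V - S)) \<otimes> (f (insert i S) \<otimes> g (insert i (V - S)))"
        unfolding eqs contraction_eq[OF SI(2)] contraction_eq[OF SI(3)] par_eq[OF SI(2)]
        using c SI by (simp add: m_ac)
      ultimately show "(?R1 S \<oplus> ?R2 S) \<oplus> (?R1 (insert i S) \<oplus> ?R2 (insert i S)) = \<zero>"
        unfolding s1 s2 using c by (simp add: l_minus r_neg)
    qed auto
    finally show ?thesis using rhs True by (simp add: contraction_eq[OF U])
  qed
qed (use f g i in auto)

text \<open>Linearity in the left factor over \<open>A\<close>, for a factor given coefficientwise;
  it turns the Leibniz rule for contractions into the one for \<open>d\<close>.\<close>

lemma mult_sum_left:
  assumes F: "F \<in> carrier B" and h: "\<And>i. i \<in> idx \<Longrightarrow> h i \<in> carrier B" and g: "g \<in> carrier B"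
    and eq: "\<And>S. S \<subseteq> idx \<Longrightarrow> F S = (\<Oplus>i\<in>idx. xs ! i \<otimes> h i S)" and U: "U \<subseteq> idx"
  shows "(F \<otimes>\<^bsub>B\<^esub> g) U = (\<Oplus>i\<in>idx. xs ! i \<otimes> (h i \<otimes>\<^bsub>B\<^esub> g) U)"
proof -
  have fin: "finite U" by (rule idx_finite[OF U])
  have hc: "h i S \<in> carrier A" if "i \<in> idx" "S \<subseteq> U" for i S using coeff_closed[OF h] that U by auto
  have gc: "g S \<in> carrier A" if "S \<subseteq> U" for S using coeff_closed[OF g] that U by auto
  have "(F \<otimes>\<^bsub>B\<^esub> g) U = (\<Oplus>S\<in>Pow U. \<Oplus>i\<in>idx. xs ! i \<otimes> (sg S (U - S) \<otimes> (h i S \<otimes> g (U - S))))"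
    unfolding mult_eq[OF U]
  proof (rule finsum_cong')
    fix S assume "S \<in> Pow U"
    then have S: "S \<subseteq> U" "S \<subseteq> idx" using U by auto
    have c: "g (U - S) \<in> carrier A" by (intro gc) auto
    have hS: "h i S \<in> carrier A" if "i \<in> idx" for i using hc that S by blast
    have "sg S (U - S) \<otimes> (F S \<otimes> g (U - S)) = F S \<otimes> (sg S (U - S) \<otimes> g (U - S))"
      using c coeff_closed[OF F S(2)] by (simp add: m_lcomm)
    also have "\<dots> = (\<Oplus>i\<in>idx. xs ! i \<otimes> h i S \<otimes> (sg S (U - S) \<otimes> g (U - S)))"
      unfolding eq[OF S(2)] using c hS nth_closed by (intro finsum_ldistr) auto
    also have "\<dots> = (\<Oplus>i\<in>idx. xs ! i \<otimes> (sg S (U - S) \<otimes> (h i S \<otimes> g (U - S))))"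
      using c hS nth_closed by (intro finsum_cong') (auto simp: m_ac)
    finally show "sg S (U - S) \<otimes> (F S \<otimes> g (U - S)) = (\<Oplus>i\<in>idx. xs ! i \<otimes> (sg S (U - S) \<otimes> (h i S \<otimes> g (U - S))))" .
  qed (use hc gc nth_closed in \<open>auto intro!: finsum_closed\<close>)
  also have "\<dots> = (\<Oplus>i\<in>idx. \<Oplus>S\<in>Pow U. xs ! i \<otimes> (sg S (U - S) \<otimes> (h i S \<otimes> g (U - S))))"
    using fin hc gc nth_closed by (intro finsum_swap) auto
  also have "\<dots> = (\<Oplus>i\<in>idx. xs ! i \<otimes> (h i \<otimes>\<^bsub>B\<^esub> g) U)"
    unfolding mult_eq[OF U] using fin hc gc nth_closed
    by (intro finsum_cong' finsum_rdistr[symmetric] refl) (auto intro!: finsum_closed)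
  finally show ?thesis .
qed

lemma mult_sum_right:
  assumes F: "F \<in> carrier B" and h: "\<And>i. i \<in> idx \<Longrightarrow> h i \<in> carrier B" and g: "g \<in> carrier B"
    and eq: "\<And>S. S \<subseteq> idx \<Longrightarrow> F S = (\<Oplus>i\<in>idx. xs ! i \<otimes> h i S)" and U: "U \<subseteq> idx"
  shows "(g \<otimes>\<^bsub>B\<^esub> F) U = (\<Oplus>i\<in>idx. xs ! i \<otimes> (g \<otimes>\<^bsub>B\<^esub> h i) U)"
proof -
  have fin: "finite U" by (rule idx_finite[OF U])
  have hc: "h i S \<in> carrier A" if "i \<in> idx" "S \<subseteq> U" for i S using coeff_closed[OF h] that U by auto
  have gc: "g S \<in> carrier A" if "S \<subseteq> U" for S using coeff_closed[OF g] that U by auto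
  have "(g \<otimes>\<^bsub>B\<^esub> F) U = (\<Oplus>S\<in>Pow U. \<Oplus>i\<in>idx. xs ! i \<otimes> (sg S (U - S) \<otimes> (g S \<otimes> h i (U - S))))"
    unfolding mult_eq[OF U]
  proof (rule finsum_cong')
    fix S assume "S \<in> Pow U"
    then have S: "S \<subseteq> U" "U - S \<subseteq> idx" "U - S \<subseteq> U" using U by auto
    have c: "g S \<in> carrier A" by (intro gc S)
    have hS: "h i (U - S) \<in> carrier A" if "i \<in> idx" for i using hc that S by blast
    have "sg S (U - S) \<otimes> (g S \<otimes> F (U - S)) = F (U - S) \<otimes> (sg S (U - S) \<otimes> g S)"
      using c coeff_closed[OF F S(2)] by (simp add: m_ac)
    also have "\<dots> = (\<Oplus>i\<in>idx. xs ! i \<otimes> h i (U - S) \<otimes> (sg S (U - S) \<otimes> g S))"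
      unfolding eq[OF S(2)] using c hS nth_closed by (intro finsum_ldistr) auto
    also have "\<dots> = (\<Oplus>i\<in>idx. xs ! i \<otimes> (sg S (U - S) \<otimes> (g S \<otimes> h i (U - S))))"
      using c hS nth_closed by (intro finsum_cong') (auto simp: m_ac)
    finally show "sg S (U - S) \<otimes> (g S \<otimes> F (U - S)) = (\<Oplus>i\<in>idx. xs ! i \<otimes> (sg S (U - S) \<otimes> (g S \<otimes> h i (U - S))))" .
  qed (use hc gc nth_closed in \<open>auto intro!: finsum_closed\<close>)
  also have "\<dots> = (\<Oplus>i\<in>idx. \<Oplus>S\<in>Pow U. xs ! i \<otimes> (sg S (U - S) \<otimes> (g S \<otimes> h i (U - S))))"
    using fin hc gc nth_closed by (intro finsum_swap) auto
  also have "\<dots> = (\<Oplus>i\<in>idx. xs ! i \<otimes> (g \<otimes>\<^bsub>B\<^esub> h i) U)"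
    unfolding mult_eq[OF U] using fin hc gc nth_closed
    by (intro finsum_cong' finsum_rdistr[symmetric] refl) (auto intro!: finsum_closed)
  finally show ?thesis .
qed

lemma d_mult:
  assumes f: "f \<in> carrier B" and g: "g \<in> carrier B"
  shows "dB (f \<otimes>\<^bsub>B\<^esub> g) = dB f \<otimes>\<^bsub>B\<^esub> g \<oplus>\<^bsub>B\<^esub> par f \<otimes>\<^bsub>B\<^esub> dB g"
proof (rule koszul_ext)
  fix U assume U: "U \<subseteq> idx"
  have c: "(contraction i f \<otimes>\<^bsub>B\<^esub> g) U \<in> carrier A" "(par f \<otimes>\<^bsub>B\<^esub> contraction i g) U \<in> carrier A" if "i \<in> idx" for i
    using that f g U by (auto intro!: coeff_closed KB.m_closed)
  have "dB (f \<otimes>\<^bsub>B\<^esub> g) U =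
     (\<Oplus>i\<in>idx. xs ! i \<otimes> (contraction i f \<otimes>\<^bsub>B\<^esub> g) U \<oplus> xs ! i \<otimes> (par f \<otimes>\<^bsub>B\<^esub> contraction i g) U)"
    unfolding d_eq[OF mult_closed_B[OF f g] U]
    by (rule finsum_cong') (use c nth_closed in \<open>auto simp: contraction_mult[OF f g] add_eq[OF U] r_distr\<close>)
  also have "\<dots> = (\<Oplus>i\<in>idx. xs ! i \<otimes> (contraction i f \<otimes>\<^bsub>B\<^esub> g) U) \<oplus> (\<Oplus>i\<in>idx. xs ! i \<otimes> (par f \<otimes>\<^bsub>B\<^esub> contraction i g) U)"
    using c nth_closed by (intro finsum_addf) auto
  also have "(\<Oplus>i\<in>idx. xs ! i \<otimes> (contraction i f \<otimes>\<^bsub>B\<^esub> g) U) = (dB f \<otimes>\<^bsub>B\<^esub> g) U"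
    by (rule mult_sum_left[symmetric]) (use f g U d_eq in auto)
  also have "(\<Oplus>i\<in>idx. xs ! i \<otimes> (par f \<otimes>\<^bsub>B\<^esub> contraction i g) U) = (par f \<otimes>\<^bsub>B\<^esub> dB g) U"
    by (rule mult_sum_right[symmetric]) (use f g U d_eq in auto)
  finally show "dB (f \<otimes>\<^bsub>B\<^esub> g) U = (dB f \<otimes>\<^bsub>B\<^esub> g \<oplus>\<^bsub>B\<^esub> par f \<otimes>\<^bsub>B\<^esub> dB g) U" by (simp add: add_eq[OF U])
qed (use f g in \<open>auto intro!: KB.m_closed KB.a_closed\<close>)

text \<open>The differential lowers the degree by one and so reverses the sign that
  \<open>par\<close> attaches.\<close>

lemma d_par:
  assumes f: "f \<in> carrier B"
  shows "dB (par f) = \<ominus>\<^bsub>B\<^esub> par (dB f)"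
proof -
  have "dB (par f) \<oplus>\<^bsub>B\<^esub> par (dB f) = \<zero>\<^bsub>B\<^esub>"
  proof (rule koszul_ext)
    fix U assume U: "U \<subseteq> idx"
    have ct: "contraction i f U \<in> carrier A" if "i \<in> idx" for i using that f U by (auto intro!: coeff_closed)
    have ds: "dB f U \<in> carrier A" using f U by (auto intro!: coeff_closed)
    have "dB (par f) U = (\<Oplus>i\<in>idx. \<ominus> neg_pow A (card U) \<otimes> (xs ! i \<otimes> contraction i f U))"
      unfolding d_eq[OF par_closed[OF f] U]
    proof (rule finsum_cong')
      fix i assume i: "i \<in> idx"
      show "xs ! i \<otimes> contraction i (par f) U = \<ominus> neg_pow A (card U) \<otimes> (xs ! i \<otimes> contraction i f U)"
      proof (cases "i \<in> U")
        case False
        have iU: "insert i U \<subseteq> idx" using i U by auto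
        have "card (insert i U) = Suc (card U)" using False idx_finite[OF U] by simp
        then show ?thesis
          using False coeff_closed[OF f iU] nth_closed[OF i]
          by (simp add: contraction_eq[OF U] par_eq[OF iU] neg_pow_Suc l_minus r_minus m_ac)
      qed (use nth_closed[OF i] in \<open>simp add: contraction_eq[OF U]\<close>)
    qed (use ct nth_closed in auto)
    also have "\<dots> = \<ominus> neg_pow A (card U) \<otimes> dB f U"
      unfolding d_eq[OF f U] using ct nth_closed by (intro finsum_rdistr[symmetric]) auto
    finally show "(dB (par f) \<oplus>\<^bsub>B\<^esub> par (dB f)) U = \<zero>\<^bsub>B\<^esub> U"
      using ds by (simp add: add_eq[OF U] zero_eq[OF U] par_eq[OF U] l_minus l_neg)
  qed (use f in \<open>auto intro!: KB.a_closed\<close>)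
  then show ?thesis using f by (metis KB.minus_equality par_closed d_closed)
qed

lemma d_d:
  assumes f: "f \<in> carrier B"
  shows "dB (dB f) = \<zero>\<^bsub>B\<^esub>"
proof (rule koszul_ext)
  fix U assume U: "U \<subseteq> idx"
  let ?t = "\<lambda>i j. xs ! i \<otimes> (xs ! j \<otimes> contraction i (contraction j f) U)"
  have cc: "contraction i (contraction j f) U \<in> carrier A" if "i \<in> idx" "j \<in> idx" for i j
    using that f U by (auto intro!: coeff_closed)
  have "dB (dB f) U = (\<Oplus>i\<in>idx. \<Oplus>j\<in>idx. ?t i j)"
    unfolding d_eq[OF d_closed[OF f] U]
  proof (rule finsum_cong')
    fix i assume i: "i \<in> idx"
    have "contraction i (dB f) U = (\<Oplus>j\<in>idx. xs ! j \<otimes> contraction i (contraction j f) U)"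
    proof (cases "i \<in> U")
      case True
      then show ?thesis using nth_closed by (auto simp: contraction_eq[OF U] intro!: add.finprod_one_eqI[symmetric])
    next
      case False
      have iU: "insert i U \<subseteq> idx" using i U by auto
      have c: "contraction j f (insert i U) \<in> carrier A" if "j \<in> idx" for j
        using that f iU by (auto intro!: coeff_closed)
      have "contraction i (dB f) U = (\<Oplus>j\<in>idx. sg {i} U \<otimes> (xs ! j \<otimes> contraction j f (insert i U)))"
        using False c nth_closed by (simp add: contraction_eq[OF U] d_eq[OF f iU] finsum_rdistr Pi_def)
      also have "\<dots> = (\<Oplus>j\<in>idx. xs ! j \<otimes> contraction i (contraction j f) U)"
        using False c nth_closed by (intro finsum_cong') (auto simp: contraction_eq[OF U, of i] m_lcomm)
      finally show ?thesis .
    qed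
    then show "xs ! i \<otimes> contraction i (dB f) U = (\<Oplus>j\<in>idx. ?t i j)"
      using cc[OF i] nth_closed i by (simp add: finsum_rdistr Pi_def)
  qed (use cc nth_closed in \<open>auto intro!: finsum_closed\<close>)
  also have "\<dots> = \<zero>"
  proof (rule finsum_antisymmetric)
    fix i j assume ij: "i \<in> idx" "j \<in> idx" "i \<noteq> j"
    show "?t i j \<oplus> ?t j i = \<zero>"
    proof (cases "i \<in> U \<or> j \<in> U")
      case True
      then have "contraction i (contraction j f) U = \<zero>" "contraction j (contraction i f) U = \<zero>"
        using ij U by (auto simp: contraction_eq)
      then show ?thesis using ij nth_closed by simp
    next
      case False
      have sub: "insert i U \<subseteq> idx" "insert j U \<subseteq> idx" "insert j (insert i U) \<subseteq> idx" using ij U by auto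
      have fin: "finite U" by (rule idx_finite[OF U])
      let ?v = "f (insert j (insert i U))"
      have v: "?v \<in> carrier A" by (rule coeff_closed[OF f sub(3)])
      \<comment> \<open>Exactly one of \<open>(i, j)\<close> and \<open>(j, i)\<close> is an
        inversion, so the two orders of contraction differ by an odd number of
        transpositions.\<close>
      have s: "sg {j} U \<otimes> sg {i} (insert j U) = \<ominus> (sg {i} U \<otimes> sg {j} (insert i U))"
      proof -
        have "inversions {i} (insert j U) = inversions {i} {j} + inversions {i} U"
          "inversions {j} (insert i U) = inversions {j} {i} + inversions {j} U"
          using False fin inversions_insert_right[of "{i}" U j] inversions_insert_right[of "{j}" U i] by simp_all
        then have e: "inversions {j} U + inversions {i} (insert j U) + Suc (inversions {i} U + inversions {j} (insert i U)) =
            2 * (inversions {i} U + inversions {j} U + 1)"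
          using inversions_pair[OF ij(3)] by simp
        show ?thesis
          unfolding sg_def neg_pow_add[symmetric] neg_pow_Suc[symmetric]
          by (intro neg_pow_cong) (simp only: e dvd_triv_left)
      qed
      have "contraction i (contraction j f) U = sg {i} U \<otimes> sg {j} (insert i U) \<otimes> ?v"
        using False ij v by (simp add: contraction_eq[OF U] contraction_eq[OF sub(1)] m_assoc)
      moreover have "contraction j (contraction i f) U = sg {j} U \<otimes> sg {i} (insert j U) \<otimes> ?v"
        using False ij v by (simp add: contraction_eq[OF U] contraction_eq[OF sub(2)] m_assoc insert_commute)
      ultimately show ?thesis unfolding s using v nth_closed[OF ij(1)] nth_closed[OF ij(2)]
        by (simp add: l_minus r_minus m_ac r_neg)
    qed
  next
    fix i assume i: "i \<in> idx"
    then have "contraction i (contraction i f) U = \<zero>" using U by (simp add: contraction_eq)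
    then show "?t i i = \<zero>" using i nth_closed by simp
  qed (use cc nth_closed in auto)
  finally show "dB (dB f) U = \<zero>\<^bsub>B\<^esub> U" by (simp add: zero_eq[OF U])
qed (use f in auto)

end

section \<open>Koszul homology\<close>

context ring begin

text \<open>Zorn's lemma, as no bound on the dimension is assumed. If \<open>g\<close> lay outside
  the spans of all finite lists over a maximal independent set, it could be added to that
  set.\<close>

lemma exists_independent_spanning_subset:
  assumes F: "subfield F R" and G: "G \<subseteq> carrier R"
  shows "\<exists>Y\<subseteq>G. (\<forall>us\<in>lists Y. distinct us \<longrightarrow> independent F us) \<and> (\<forall>g\<in>G. \<exists>us\<in>lists Y. g \<in> Span F us)"
proof -
  define \<A> where "\<A> = {Y. Y \<subseteq> G \<and> (\<forall>us\<in>lists Y. distinct us \<longrightarrow> independent F us)}"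
  have "\<exists>M\<in>\<A>. \<forall>Y\<in>\<A>. M \<subseteq> Y \<longrightarrow> Y = M"
  proof (rule subset_Zorn_nonempty)
    have "{} \<in> \<A>" by (auto simp: \<A>_def)
    then show "\<A> \<noteq> {}" by blast
  next
    fix C assume C: "C \<noteq> {}" "subset.chain \<A> C"
    \<comment> \<open>Independence concerns finite lists, and a finite list over the union of a
      chain lies in one of its members.\<close>
    have "independent F us" if us: "us \<in> lists (\<Union>C)" "distinct us" for us
    proof -
      obtain Y where "Y \<in> C" "set us \<subseteq> Y"
        by (rule finite_subset_Union_chain[OF _ _ C, of "set us"]) (use us in auto)
      then have Y: "Y \<in> C" "us \<in> lists Y" by (auto simp: lists_eq_set)
      then have "Y \<in> \<A>" using C(2) by (auto simp: subset_chain_def)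
      then show ?thesis using Y us(2) by (auto simp: \<A>_def)
    qed
    moreover have "\<Union>C \<subseteq> G" using C(2) by (auto simp: subset_chain_def \<A>_def)
    ultimately show "\<Union>C \<in> \<A>" by (auto simp: \<A>_def)
  qed
  then obtain Y where Y: "Y \<in> \<A>" and max: "\<And>Z. Z \<in> \<A> \<Longrightarrow> Y \<subseteq> Z \<Longrightarrow> Z = Y" by blast
  have YG: "Y \<subseteq> G" and ind: "\<And>us. us \<in> lists Y \<Longrightarrow> distinct us \<Longrightarrow> independent F us"
    using Y by (auto simp: \<A>_def)
  have "\<exists>us\<in>lists Y. g \<in> Span F us" if g: "g \<in> G" for g
  proof (rule ccontr)
    assume no: "\<not> (\<exists>us\<in>lists Y. g \<in> Span F us)"
    have gc: "g \<in> carrier R" using g G by blast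
    have "independent F us" if us: "us \<in> lists (insert g Y)" "distinct us" for us
    proof (cases "g \<in> set us")
      case False
      then have "us \<in> lists Y" using us by (auto simp: lists_eq_set)
      then show ?thesis using ind us(2) by blast
    next
      case True
      then obtain as bs where ab: "us = as @ g # bs" by (meson split_list)
      have asbs: "as @ bs \<in> lists Y" "distinct (as @ bs)" using us unfolding ab by (auto simp: lists_eq_set)
      have "g \<notin> Span F (as @ bs)" using no asbs(1) by blast
      then have "independent F (g # as @ bs)" using ind[OF asbs] by (rule li_Cons[OF gc])
      then show ?thesis by (rule independent_same_set[OF F, rotated 2]) (auto simp: ab)
    qed
    then have "insert g Y \<in> \<A>" using g YG by (auto simp: \<A>_def)
    then have "g \<in> Y" using max[of "insert g Y"] by blast
    then have "[g] \<in> lists Y" by simp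
    moreover have "g \<in> Span F [g]" using Span_base_incl[OF F, of "[g]"] gc by auto
    ultimately show False using no by blast
  qed
  then show ?thesis using YG ind by blast
qed

text \<open>Choosing \<open>Y\<close> inside the generating set \<open>G\<close> is what later makes
  the basis homogeneous. Closure of \<open>G\<close> under \<open>F\<close> makes the additive group
  generated by \<open>G\<close> an \<open>F\<close>-subspace.\<close>

lemma exists_basis_over_generate:
  assumes F: "subfield F R" and G: "G \<subseteq> carrier R"
    and smult: "\<And>k g. k \<in> F \<Longrightarrow> g \<in> G \<Longrightarrow> k \<otimes> g \<in> G"
  shows "\<exists>Y\<subseteq>G. basis_over R F (generate (add_monoid R) G) Y"
proof -
  obtain Y where Y: "Y \<subseteq> G" and ind: "\<forall>us\<in>lists Y. distinct us \<longrightarrow> independent F us"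
    and span: "\<And>g. g \<in> G \<Longrightarrow> \<exists>us\<in>lists Y. g \<in> Span F us"
    using exists_independent_spanning_subset[OF F G] by blast
  let ?V = "generate (add_monoid R) G" and ?W = "\<Union>us\<in>lists Y. Span F us"
  have Yc: "set us \<subseteq> carrier R" if "us \<in> lists Y" for us using that Y G by (auto simp: lists_eq_set)
  have subW: "subgroup ?W (add_monoid R)"
  proof (rule add.subgroupI)
    show "?W \<subseteq> carrier R" using Span_subgroup_props(1)[OF F Yc] by blast
    show "?W \<noteq> {}" using Span_subgroup_props(2)[OF F Yc] by (auto intro!: exI[of _ "[]"])
    show "\<ominus> a \<in> ?W" if "a \<in> ?W" for a using that Span_subgroup_props(4)[OF F Yc] by blast
  next
    fix a b assume "a \<in> ?W" "b \<in> ?W"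
    then obtain us vs where uv: "us \<in> lists Y" "vs \<in> lists Y" "a \<in> Span F us" "b \<in> Span F vs" by blast
    then have "a \<in> Span F (us @ vs)" "b \<in> Span F (us @ vs)"
      using mono_Span_append(1)[OF F Yc[OF uv(1)] Yc[OF uv(2)]] mono_Span_append(2)[OF F Yc[OF uv(2)] Yc[OF uv(1)]] by blast+
    moreover have "us @ vs \<in> lists Y" using uv by simp
    ultimately show "a \<oplus> b \<in> ?W" using Span_subgroup_props(3)[OF F Yc] by blast
  qed
  have "?V \<subseteq> ?W" by (rule add.generate_subgroup_incl[OF _ subW]) (use span in blast)
  moreover have "?W \<subseteq> ?V"
  proof
    have subV: "subgroup ?V (add_monoid R)" using G by (intro add.generate_is_subgroup) simp
    have "w \<in> ?V" if "set us \<subseteq> Y" "w \<in> Span F us" for us w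
      using that
    proof (induction us arbitrary: w)
      case Nil
      then show ?case using subgroup.one_closed[OF subV] by simp
    next
      case (Cons u us)
      then have "w \<in> line_extension F u (Span F us)" by simp
      then obtain k v where kv: "k \<in> F" "v \<in> Span F us" "w = k \<otimes> u \<oplus> v" by (auto simp: line_extension_mem_iff)
      have "k \<otimes> u \<in> ?V" using smult[OF kv(1)] Cons.prems(1) Y by (intro generate.incl) auto
      moreover have "v \<in> ?V" using Cons.IH Cons.prems(1) kv(2) by simp
      ultimately show ?case unfolding kv(3) using subgroup.m_closed[OF subV] by simp
    qed
    then show "w \<in> ?V" if "w \<in> ?W" for w using that by (auto simp: lists_eq_set)
  qed
  ultimately have "?V = ?W" by blast
  then show ?thesis using Y ind unfolding basis_over_def by blast
qed

end

section \<open>The homology ring\<close>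

context koszul_complex
begin

abbreviation Z where "Z \<equiv> cycles B"
abbreviation Bd where "Bd \<equiv> boundaries B"
abbreviation ZB where "ZB \<equiv> B\<lparr>carrier := Z\<rparr>"
abbreviation H where "H \<equiv> homology_ring B"

lemma cyclesI: "f \<in> carrier B \<Longrightarrow> dB f = \<zero>\<^bsub>B\<^esub> \<Longrightarrow> f \<in> Z"
  by (simp add: cycles_def)

lemma cyclesD: "f \<in> Z \<Longrightarrow> f \<in> carrier B" "f \<in> Z \<Longrightarrow> dB f = \<zero>\<^bsub>B\<^esub>"
  by (simp_all add: cycles_def)

lemma par_cycle: "f \<in> carrier B \<Longrightarrow> dB f = \<zero>\<^bsub>B\<^esub> \<Longrightarrow> dB (par f) = \<zero>\<^bsub>B\<^esub>"
proof -
  assume f: "f \<in> carrier B" "dB f = \<zero>\<^bsub>B\<^esub>"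
  have "par \<zero>\<^bsub>B\<^esub> = \<zero>\<^bsub>B\<^esub>" by (rule koszul_ext) (auto simp: par_eq zero_eq)
  then show "dB (par f) = \<zero>\<^bsub>B\<^esub>" using d_par[OF f(1)] f(2) by simp
qed

lemma d_one: "dB \<one>\<^bsub>B\<^esub> = \<zero>\<^bsub>B\<^esub>"
proof (rule koszul_ext)
  fix U assume U: "U \<subseteq> idx"
  have "dB \<one>\<^bsub>B\<^esub> U = (\<Oplus>i\<in>idx. \<zero>)"
    unfolding d_eq[OF one_closed_B U]
    by (rule finsum_cong') (use U nth_closed in \<open>auto simp: contraction_eq one_eq\<close>)
  then show "dB \<one>\<^bsub>B\<^esub> U = \<zero>\<^bsub>B\<^esub> U" by (simp add: zero_eq[OF U])
qed auto

lemma cycles_subring: "subring Z B"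
proof (rule KB.subringI)
  show "Z \<subseteq> carrier B" using cyclesD by blast
  show "\<one>\<^bsub>B\<^esub> \<in> Z" by (rule cyclesI) (auto simp: d_one)
  show "\<ominus>\<^bsub>B\<^esub> f \<in> Z" if "f \<in> Z" for f
    using cyclesD[OF that] by (intro cyclesI) (auto simp: d_minus)
  show "f \<otimes>\<^bsub>B\<^esub> g \<in> Z" if "f \<in> Z" "g \<in> Z" for f g
    using cyclesD[OF that(1)] cyclesD[OF that(2)] by (intro cyclesI) (auto simp: d_mult par_closed)
  show "f \<oplus>\<^bsub>B\<^esub> g \<in> Z" if "f \<in> Z" "g \<in> Z" for f g
    using cyclesD[OF that(1)] cyclesD[OF that(2)] by (intro cyclesI) (auto simp: d_add)
qed

lemma boundaries_subset: "Bd \<subseteq> Z"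
  unfolding boundaries_def by (auto intro: cyclesI simp: d_d)

lemma boundaries_ideal: "ideal Bd ZB"
proof (rule idealI)
  show "ring ZB" by (rule KB.subring_is_ring[OF cycles_subring])
  show "subgroup Bd (add_monoid ZB)"
  proof (rule subgroup.intro)
    show "Bd \<subseteq> carrier (add_monoid ZB)" using boundaries_subset by simp
    show "x \<otimes>\<^bsub>add_monoid ZB\<^esub> y \<in> Bd" if "x \<in> Bd" "y \<in> Bd" for x y
      using that by (auto simp: boundaries_def d_add[symmetric])
    show "\<one>\<^bsub>add_monoid ZB\<^esub> \<in> Bd"
      using d_zero zero_closed_B by (auto simp: boundaries_def image_iff intro!: bexI[of _ "\<zero>\<^bsub>B\<^esub>"])
    show "inv\<^bsub>add_monoid ZB\<^esub> x \<in> Bd" if x: "x \<in> Bd" for x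
    proof -
      interpret ZB: ring ZB by (rule KB.subring_is_ring[OF cycles_subring])
      obtain f where f: "f \<in> carrier B" "x = dB f" using x by (auto simp: boundaries_def)
      have "\<ominus>\<^bsub>ZB\<^esub> x = \<ominus>\<^bsub>B\<^esub> x"
      proof (rule ZB.minus_equality)
        show "\<ominus>\<^bsub>B\<^esub> x \<oplus>\<^bsub>ZB\<^esub> x = \<zero>\<^bsub>ZB\<^esub>" using f by (simp add: KB.l_neg d_closed)
      next
        have "x \<in> Z" using x boundaries_subset by blast
        then show "x \<in> carrier ZB" "\<ominus>\<^bsub>B\<^esub> x \<in> carrier ZB" using subringE(5)[OF cycles_subring] by auto
      qed
      also have "\<dots> \<in> Bd" using f by (auto simp: boundaries_def d_minus[symmetric])
      finally show ?thesis by (simp add: a_inv_def)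
    qed
  qed
next
  fix x a assume x: "x \<in> Bd" and "a \<in> carrier ZB"
  then have a: "a \<in> carrier B" "dB a = \<zero>\<^bsub>B\<^esub>" using cyclesD by auto
  obtain f where f: "f \<in> carrier B" "x = dB f" using x by (auto simp: boundaries_def)
  have "dB (f \<otimes>\<^bsub>B\<^esub> a) = x \<otimes>\<^bsub>B\<^esub> a"
    using a f by (simp add: d_mult par_closed d_closed)
  then show "x \<otimes>\<^bsub>ZB\<^esub> a \<in> Bd" using a f by (auto simp: boundaries_def image_iff intro!: bexI[of _ "f \<otimes>\<^bsub>B\<^esub> a"])
  \<comment> \<open>Here the Leibniz rule applies \<open>par\<close> to the left factor. Starting
    from \<open>par a\<close>, which is again a cycle, the two applications cancel.\<close>
  have "dB (par a \<otimes>\<^bsub>B\<^esub> f) = a \<otimes>\<^bsub>B\<^esub> x"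
    using a f by (simp add: d_mult par_closed d_closed par_par par_cycle)
  then show "a \<otimes>\<^bsub>ZB\<^esub> x \<in> Bd" using a f by (auto simp: boundaries_def image_iff intro!: bexI[of _ "par a \<otimes>\<^bsub>B\<^esub> f"])
qed

lemma homology_ring_ring: "ring H"
  unfolding homology_ring_def by (rule ideal.quotient_is_ring[OF boundaries_ideal])

lemma homology_class_eq: "homology_class B f = Bd +>\<^bsub>ZB\<^esub> f"
  by (simp add: homology_class_def a_r_coset_def r_coset_def)

lemma homology_class_hom: "ring_hom_ring ZB H (homology_class B)"
  using ideal.rcos_ring_hom_ring[OF boundaries_ideal] unfolding homology_ring_def homology_class_eq[abs_def] .

lemma homology_carrier: "carrier H = homology_class B ` Z"
  unfolding homology_class_eq[abs_def] by (simp add: homology_ring_def FactRing_def A_RCOSETS_def' UNION_singleton_eq_range)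

lemma homology_class_eq_iff:
  assumes "f \<in> Z" "g \<in> Z"
  shows "homology_class B f = homology_class B g \<longleftrightarrow> f \<ominus>\<^bsub>B\<^esub> g \<in> Bd"
proof -
  interpret I: ideal Bd ZB by (rule boundaries_ideal)
  have "\<ominus>\<^bsub>ZB\<^esub> g = \<ominus>\<^bsub>B\<^esub> g"
    by (rule I.minus_equality) (use assms subringE(5)[OF cycles_subring] cyclesD(1) KB.l_neg in auto)
  then have "f \<ominus>\<^bsub>ZB\<^esub> g = f \<ominus>\<^bsub>B\<^esub> g" by (simp add: a_minus_def)
  then show ?thesis
    using I.quotient_eq_iff_same_a_r_cos[OF boundaries_ideal, of f g] assms unfolding homology_class_eq by simp
qed

lemma component_eq: "component B i = {f \<in> carrier B. \<forall>U\<subseteq>idx. card U \<noteq> i \<longrightarrow> f U = \<zero>}"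
  by (auto simp: koszul_def)

lemma componentD: "f \<in> component B i \<Longrightarrow> f \<in> carrier B" "f \<in> component B i \<Longrightarrow> U \<subseteq> idx \<Longrightarrow> card U \<noteq> i \<Longrightarrow> f U = \<zero>"
  by (auto simp: component_eq)

definition scalar :: "'a \<Rightarrow> nat set \<Rightarrow> 'a" where
  "scalar a = (\<lambda>U\<in>Pow idx. if U = {} then a else \<zero>)"

lemma scalar_eq: "U \<subseteq> idx \<Longrightarrow> scalar a U = (if U = {} then a else \<zero>)"
  by (simp add: scalar_def)

lemma scalar_closed: "a \<in> carrier A \<Longrightarrow> scalar a \<in> carrier B"
  unfolding scalar_def by (intro koszul_memI) auto

lemma scalar_component: "a \<in> carrier A \<Longrightarrow> scalar a \<in> component B 0"
  using idx_finite by (auto simp: component_eq scalar_closed scalar_eq)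

lemma component_0_scalar: "f \<in> component B 0 \<Longrightarrow> f = scalar (f {})"
proof (rule koszul_ext)
  fix U assume f: "f \<in> component B 0" and U: "U \<subseteq> idx"
  show "f U = scalar (f {}) U"
    using componentD(2)[OF f U] idx_finite[OF U] by (auto simp: scalar_eq[OF U])
qed (auto simp: componentD scalar_closed coeff_closed)

lemma scalar_cycle: "a \<in> carrier A \<Longrightarrow> scalar a \<in> Z"
proof (rule cyclesI)
  assume a: "a \<in> carrier A"
  show "dB (scalar a) = \<zero>\<^bsub>B\<^esub>"
  proof (rule koszul_ext)
    fix U assume U: "U \<subseteq> idx"
    have "dB (scalar a) U = (\<Oplus>i\<in>idx. \<zero>)"
      unfolding d_eq[OF scalar_closed[OF a] U]
      by (rule finsum_cong') (use U nth_closed in \<open>auto simp: contraction_eq scalar_eq\<close>)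
    then show "dB (scalar a) U = \<zero>\<^bsub>B\<^esub> U" by (simp add: zero_eq[OF U])
  qed (auto simp: a scalar_closed)
qed (rule scalar_closed)

lemma scalar_mult:
  assumes a: "a \<in> carrier A" and f: "f \<in> carrier B" and U: "U \<subseteq> idx"
  shows "(scalar a \<otimes>\<^bsub>B\<^esub> f) U = a \<otimes> f U"
proof -
  have "(scalar a \<otimes>\<^bsub>B\<^esub> f) U = (\<Oplus>S\<in>Pow U. if {} = S then a \<otimes> f U else \<zero>)"
    unfolding mult_eq[OF U]
  proof (rule finsum_cong')
    fix S assume "S \<in> Pow U"
    then have S: "S \<subseteq> idx" "f (U - S) \<in> carrier A" using coeff_closed[OF f, of "U - S"] U by auto
    show "sg S (U - S) \<otimes> (scalar a S \<otimes> f (U - S)) = (if {} = S then a \<otimes> f U else \<zero>)"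
      unfolding scalar_eq[OF S(1)] using S(2) a by (auto simp: sg_def)
  qed (use U f a in \<open>auto simp: coeff_closed\<close>)
  also have "\<dots> = a \<otimes> f U" using U f a idx_finite[OF U] by (intro finsum_singleton) (auto simp: coeff_closed)
  finally show ?thesis .
qed

lemma scalar_scalar:
  assumes "a \<in> carrier A" "b \<in> carrier A"
  shows "scalar a \<otimes>\<^bsub>B\<^esub> scalar b = scalar (a \<otimes> b)"
  using assms by (intro koszul_ext) (auto simp: scalar_mult scalar_eq scalar_closed)

lemma scalar_add:
  assumes "a \<in> carrier A" "b \<in> carrier A"
  shows "scalar a \<oplus>\<^bsub>B\<^esub> scalar b = scalar (a \<oplus> b)"
  using assms by (intro koszul_ext) (auto simp: add_eq scalar_eq scalar_closed)

lemma scalar_minus: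
  assumes "a \<in> carrier A"
  shows "\<ominus>\<^bsub>B\<^esub> scalar a = scalar (\<ominus> a)"
proof (rule KB.minus_equality)
  show "scalar (\<ominus> a) \<oplus>\<^bsub>B\<^esub> scalar a = \<zero>\<^bsub>B\<^esub>"
    using assms zero_closed_B by (intro koszul_ext) (auto simp: scalar_add scalar_eq zero_eq l_neg scalar_closed)
qed (use assms in \<open>auto simp: scalar_closed\<close>)

lemma scalar_one: "scalar \<one> = \<one>\<^bsub>B\<^esub>"
  by (rule koszul_ext) (auto simp: scalar_eq one_eq scalar_closed)

lemma homology_0: "homology B 0 = (\<lambda>a. homology_class B (scalar a)) ` carrier A"
proof
  show "homology B 0 \<subseteq> (\<lambda>a. homology_class B (scalar a)) ` carrier A"
  proof
    fix h assume "h \<in> homology B 0"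
    then obtain f where f: "f \<in> component B 0" "h = homology_class B f" by (auto simp: homology_def)
    then have "h = homology_class B (scalar (f {}))" using component_0_scalar by metis
    moreover have "f {} \<in> carrier A" using f componentD coeff_closed by blast
    ultimately show "h \<in> (\<lambda>a. homology_class B (scalar a)) ` carrier A" by blast
  qed
qed (use scalar_component scalar_cycle in \<open>auto simp: homology_def\<close>)

text \<open>This identifies \<open>H_0\<close> with \<open>A / (xs)\<close>: the boundary of a
  degree-one element with coefficients \<open>c i\<close> is the combination of the generators with
  these coefficients.\<close>

lemma scalar_boundary_iff:
  assumes a: "a \<in> carrier A"
  shows "scalar a \<in> Bd \<longleftrightarrow> a \<in> genideal A (set xs)"
proof
  interpret G: ideal "genideal A (set xs)" A by (rule genideal_ideal[OF xs_closed])
  assume "scalar a \<in> Bd"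
  then obtain g where g: "g \<in> carrier B" "scalar a = dB g" by (auto simp: boundaries_def)
  have "a = dB g {}" using g(2) scalar_eq[of "{}" a] by simp
  also have "\<dots> = (\<Oplus>i\<in>idx. xs ! i \<otimes> contraction i g {})" by (rule d_eq[OF g(1)]) simp
  also have "\<dots> \<in> genideal A (set xs)"
  proof (rule finsum_in_ideal[OF G.is_ideal])
    fix i assume i: "i \<in> idx"
    then have "xs ! i \<in> genideal A (set xs)" using genideal_self[OF xs_closed] by auto
    then show "xs ! i \<otimes> contraction i g {} \<in> genideal A (set xs)"
      using i g coeff_closed[of "contraction i g" "{}"] by (intro G.I_r_closed) auto
  qed simp
  finally show "a \<in> genideal A (set xs)" .
next
  assume "a \<in> genideal A (set xs)"
  moreover have "set xs = (\<lambda>i. xs ! i) ` idx" by (auto simp: set_conv_nth)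
  ultimately obtain c where c: "c \<in> idx \<rightarrow> carrier A" "a = (\<Oplus>i\<in>idx. c i \<otimes> xs ! i)"
    using genideal_combination[of "\<lambda>i. xs ! i" "length xs" a] nth_closed by auto
  have cc: "c i \<in> carrier A" if "i \<in> idx" for i using c(1) that by blast
  define g where "g = (\<lambda>U\<in>Pow idx. if card U = 1 then c (the_elem U) else \<zero>)"
  have g: "g \<in> carrier B" unfolding g_def
  proof (rule koszul_memI)
    fix U assume "U \<subseteq> idx"
    then show "(if card U = 1 then c (the_elem U) else \<zero>) \<in> carrier A"
      using c(1) by (auto simp: card_1_singleton_iff)
  qed
  have "dB g = scalar a"
  proof (rule koszul_ext)
    fix U assume U: "U \<subseteq> idx"
    have "dB g U = (\<Oplus>i\<in>idx. if U = {} then c i \<otimes> xs ! i else \<zero>)"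
      unfolding d_eq[OF g U]
    proof (rule finsum_cong')
      fix i assume i: "i \<in> idx"
      have iU: "insert i U \<subseteq> idx" using i U by auto
      have ci: "c i \<in> carrier A" by (rule cc[OF i])
      show "xs ! i \<otimes> contraction i g U = (if U = {} then c i \<otimes> xs ! i else \<zero>)"
      proof (cases "U = {}")
        case True
        then show ?thesis using ci nth_closed[OF i] i
          by (simp add: contraction_eq g_def sg_def m_comm)
      next
        case False
        then have "card (insert i U) \<noteq> 1" if "i \<notin> U"
          using that idx_finite[OF U] by simp
        then show ?thesis using False nth_closed[OF i] iU
          by (auto simp: contraction_eq[OF U] g_def)
      qed
    qed (use cc nth_closed in auto)
    also have "\<dots> = scalar a U" using c(2) by (auto simp: scalar_eq[OF U])
    finally show "dB g U = scalar a U" .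
  qed (use a g in \<open>auto simp: scalar_closed\<close>)
  then show "scalar a \<in> Bd" using g unfolding boundaries_def by (metis imageI)
qed

end

text \<open>The assumptions \<open>n_proper\<close> and \<open>n_inverse\<close> say that
  \<open>A / n\<close> is a field. Inverses are taken modulo \<open>n\<close> because in the graded
  case an element outside \<open>n\<close> need not be a unit of \<open>A\<close>.\<close>

locale koszul_residue_field = koszul_complex +
  fixes n
  assumes xs_genideal: "genideal A (set xs) = n"
    and n_proper: "\<one> \<notin> n"
    and n_inverse: "a \<in> carrier A \<Longrightarrow> a \<notin> n \<Longrightarrow> \<exists>b\<in>carrier A. a \<otimes> b \<ominus> \<one> \<in> n"
begin

text \<open>The scalars map onto \<open>H_0\<close>, and by \<open>scalar_boundary_iff\<close> the
  kernel is \<open>n\<close>, so \<open>H_0\<close> is a copy of the field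
  \<open>A / n\<close>.\<close>

lemma homology_0_subfield: "subfield (homology B 0) H"
proof -
  interpret HR: ring H by (rule homology_ring_ring)
  interpret h: ring_hom_ring ZB H "homology_class B" by (rule homology_class_hom)
  define k where "k a = homology_class B (scalar a)" for a
  have zb: "scalar a \<in> carrier ZB" if "a \<in> carrier A" for a using scalar_cycle that by simp
  have kc: "k a \<in> carrier H" if "a \<in> carrier A" for a unfolding k_def using zb that by (intro h.hom_closed)
  have kmult: "k a \<otimes>\<^bsub>H\<^esub> k b = k (a \<otimes> b)" and kadd: "k a \<oplus>\<^bsub>H\<^esub> k b = k (a \<oplus> b)"
    if "a \<in> carrier A" "b \<in> carrier A" for a b
    using h.hom_mult[OF zb[OF that(1)] zb[OF that(2)]] h.hom_add[OF zb[OF that(1)] zb[OF that(2)]] that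
    by (auto simp: k_def scalar_scalar scalar_add)
  have kone: "k \<one> = \<one>\<^bsub>H\<^esub>" using h.hom_one by (simp add: k_def scalar_one)
  have kzero: "k a = \<zero>\<^bsub>H\<^esub> \<longleftrightarrow> a \<in> n" if a: "a \<in> carrier A" for a
  proof -
    have "\<zero>\<^bsub>H\<^esub> = homology_class B (scalar \<zero>)"
    proof -
      have "scalar \<zero> = \<zero>\<^bsub>B\<^esub>" by (rule koszul_ext) (auto simp: scalar_eq zero_eq scalar_closed)
      then show ?thesis using h.hom_zero by simp
    qed
    then have "k a = \<zero>\<^bsub>H\<^esub> \<longleftrightarrow> scalar a \<ominus>\<^bsub>B\<^esub> scalar \<zero> \<in> Bd"
      unfolding k_def using homology_class_eq_iff scalar_cycle a by simp
    also have "scalar a \<ominus>\<^bsub>B\<^esub> scalar \<zero> = scalar a"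
      using a by (simp add: a_minus_def scalar_minus scalar_add)
    finally show ?thesis using scalar_boundary_iff[OF a] xs_genideal by simp
  qed
  have kminus: "\<ominus>\<^bsub>H\<^esub> k a = k (\<ominus> a)" if a: "a \<in> carrier A" for a
  proof (rule HR.minus_equality)
    have "\<zero> \<in> n" using xs_genideal genideal_ideal[OF xs_closed] additive_subgroup.zero_closed ideal.axioms(1) by blast
    then show "k (\<ominus> a) \<oplus>\<^bsub>H\<^esub> k a = \<zero>\<^bsub>H\<^esub>" using kadd[of "\<ominus> a" a] kzero[of \<zero>] a by (simp add: l_neg)
  qed (use kc a in auto)
  have H0: "homology B 0 = k ` carrier A" unfolding homology_0 k_def ..
  have sub: "subring (homology B 0) H"
  proof (rule HR.subringI)
    show "homology B 0 \<subseteq> carrier H" using kc by (auto simp: H0)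
    show "\<one>\<^bsub>H\<^esub> \<in> homology B 0" unfolding H0 kone[symmetric] by simp
  qed (auto simp: H0 kminus kmult kadd)
  have comm: "u \<otimes>\<^bsub>H\<^esub> v = v \<otimes>\<^bsub>H\<^esub> u" if "u \<in> homology B 0" "v \<in> homology B 0" for u v
    using that by (auto simp: H0 kmult m_comm)
  have subc: "subcring (homology B 0) H" by (rule HR.subcringI[OF sub comm])
  show ?thesis
  proof (rule HR.subfieldI[OF subc])
    show "Units (H\<lparr>carrier := homology B 0\<rparr>) = homology B 0 - {\<zero>\<^bsub>H\<^esub>}"
    proof
      have ne: "\<one>\<^bsub>H\<^esub> \<noteq> \<zero>\<^bsub>H\<^esub>" using kzero[of \<one>] kone n_proper by simp
      show "Units (H\<lparr>carrier := homology B 0\<rparr>) \<subseteq> homology B 0 - {\<zero>\<^bsub>H\<^esub>}"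
      proof
        fix u assume "u \<in> Units (H\<lparr>carrier := homology B 0\<rparr>)"
        then obtain v where uv: "u \<in> homology B 0" "v \<in> homology B 0" "v \<otimes>\<^bsub>H\<^esub> u = \<one>\<^bsub>H\<^esub>"
          by (auto simp: Units_def)
        then have "v \<in> carrier H" using kc by (auto simp: H0)
        then have "u \<noteq> \<zero>\<^bsub>H\<^esub>" using uv(3) ne HR.r_null[of v] by metis
        then show "u \<in> homology B 0 - {\<zero>\<^bsub>H\<^esub>}" using uv by blast
      qed
      show "homology B 0 - {\<zero>\<^bsub>H\<^esub>} \<subseteq> Units (H\<lparr>carrier := homology B 0\<rparr>)"
      proof
        fix u assume u: "u \<in> homology B 0 - {\<zero>\<^bsub>H\<^esub>}"
        then obtain a where a: "a \<in> carrier A" "u = k a" by (auto simp: H0)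
        then have "a \<notin> n" using u kzero by auto
        then obtain b where b: "b \<in> carrier A" "a \<otimes> b \<ominus> \<one> \<in> n" using n_inverse a by blast
        have "k (a \<otimes> b) = k (a \<otimes> b \<ominus> \<one>) \<oplus>\<^bsub>H\<^esub> k \<one>"
        proof -
          have "a \<otimes> b = (a \<otimes> b \<ominus> \<one>) \<oplus> \<one>" using a b(1) by algebra
          then show ?thesis using kadd[of "a \<otimes> b \<ominus> \<one>" \<one>] a b(1) by simp
        qed
        also have "k (a \<otimes> b \<ominus> \<one>) = \<zero>\<^bsub>H\<^esub>" using kzero[of "a \<otimes> b \<ominus> \<one>"] a b by simp
        finally have "u \<otimes>\<^bsub>H\<^esub> k b = \<one>\<^bsub>H\<^esub>" using kmult a b kone kc[of \<one>] by simp
        moreover have kb: "k b \<in> homology B 0" using b by (auto simp: H0)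
        moreover have "k b \<otimes>\<^bsub>H\<^esub> u = u \<otimes>\<^bsub>H\<^esub> k b" using comm[OF kb] u by blast
        ultimately have "\<exists>v\<in>homology B 0. v \<otimes>\<^bsub>H\<^esub> u = \<one>\<^bsub>H\<^esub> \<and> u \<otimes>\<^bsub>H\<^esub> v = \<one>\<^bsub>H\<^esub>" by auto
        then show "u \<in> Units (H\<lparr>carrier := homology B 0\<rparr>)"
          using u by (simp add: Units_def)
      qed
    qed
  qed
qed

text \<open>A scalar times a homogeneous class is homogeneous of the same degree, so a basis can be
  selected among the homogeneous classes.\<close>

lemma exists_homogeneous_basis: "\<exists>Y. homogeneous_basis B Y"
proof -
  interpret HR: ring H by (rule homology_ring_ring)
  interpret h: ring_hom_ring ZB H "homology_class B" by (rule homology_class_hom)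
  let ?G = "\<Union>i\<in>{1..}. homology B i"
  have "\<exists>Y\<subseteq>?G. basis_over H (homology B 0) (generate (add_monoid H) ?G) Y"
  proof (rule HR.exists_basis_over_generate[OF homology_0_subfield])
    show "?G \<subseteq> carrier H" by (auto simp: homology_def homology_carrier)
    fix u g assume "u \<in> homology B 0" "g \<in> ?G"
    then have "u \<in> (\<lambda>a. homology_class B (scalar a)) ` carrier A" unfolding homology_0 by blast
    then obtain a where a: "a \<in> carrier A" "u = homology_class B (scalar a)" by blast
    obtain i f where f: "i \<ge> 1" "f \<in> Z" "f \<in> component B i" "g = homology_class B f"
      using \<open>g \<in> ?G\<close> by (auto simp: homology_def)
    have "u \<otimes>\<^bsub>H\<^esub> g = homology_class B (scalar a \<otimes>\<^bsub>B\<^esub> f)"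
      using h.hom_mult[of "scalar a" f] scalar_cycle a f by simp
    moreover have "scalar a \<otimes>\<^bsub>B\<^esub> f \<in> Z"
      using subringE(6)[OF cycles_subring scalar_cycle[OF a(1)] f(2)] .
    moreover have "scalar a \<otimes>\<^bsub>B\<^esub> f \<in> component B i"
      using a f componentD[OF f(3)] by (auto simp: component_eq scalar_mult scalar_closed)
    ultimately have "u \<otimes>\<^bsub>H\<^esub> g \<in> homology B i" by (auto simp: homology_def)
    then show "u \<otimes>\<^bsub>H\<^esub> g \<in> ?G" using f(1) by auto
  qed
  then show ?thesis by (auto simp: homogeneous_basis_def positive_homology_def)
qed

end

section \<open>Trivial Massey operations\<close>

lemma inversions_singletons: "inversions {j} {i} = (if i < j then 1 else 0)"
proof -
  have "{t \<in> {i}. t < j} = (if i < j then {i} else {})" by auto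
  then show ?thesis by (simp only: inversions_singleton split: if_splits) simp_all
qed

context koszul_complex
begin

lemma sgn_bar_mult_zero:
  assumes "f \<in> carrier B" "g \<in> carrier B" "f \<otimes>\<^bsub>B\<^esub> g = \<zero>\<^bsub>B\<^esub>"
  shows "sgn_bar B f \<otimes>\<^bsub>B\<^esub> g = \<zero>\<^bsub>B\<^esub>"
  using assms KB.neg_pow_closed by (simp add: sgn_bar_def KB.m_assoc)

lemma trivial_massey_operationI:
  assumes Y: "\<And>h. h \<in> Y \<Longrightarrow> z h \<in> Z \<and> z h \<in> (\<Union>i. component B i) \<and> homology_class B (z h) = h"
    and prod: "\<And>h h'. h \<in> Y \<Longrightarrow> h' \<in> Y \<Longrightarrow> z h \<otimes>\<^bsub>B\<^esub> z h' = \<zero>\<^bsub>B\<^esub>"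
  shows "trivial_massey_operation B Y (\<lambda>hs. if length hs = 1 then z (hd hs) else \<zero>\<^bsub>B\<^esub>)" (is "trivial_massey_operation B Y ?\<mu>")
  unfolding trivial_massey_operation_def
proof (intro conjI ballI impI)
  fix hs assume hs: "hs \<in> lists Y" "hs \<noteq> []"
  have "\<zero>\<^bsub>B\<^esub> \<in> component B 0" by (auto simp: component_eq zero_eq)
  then show "?\<mu> hs \<in> (\<Union>i. component B i)" using hs Y by (cases hs) auto
next
  fix h assume "h \<in> Y"
  then show "?\<mu> [h] \<in> Z" "homology_class B (?\<mu> [h]) = h" using Y by auto
next
  fix hs assume hs: "hs \<in> lists Y" "2 \<le> length hs"
  have zc: "z h \<in> carrier B" if "h \<in> Y" for h using Y[OF that] cyclesD by blast
  have "(\<Oplus>\<^bsub>B\<^esub> j\<in>{1..length hs - 1}. sgn_bar B (?\<mu> (take j hs)) \<otimes>\<^bsub>B\<^esub> ?\<mu> (drop j hs)) = \<zero>\<^bsub>B\<^esub>"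
  proof (rule KB.add.finprod_one_eqI)
    fix j assume j: "j \<in> {1..length hs - 1}"
    have ne: "take j hs \<noteq> []" "drop j hs \<noteq> []" using j hs(2) by auto
    have "set hs \<subseteq> Y" using hs(1) by (auto simp: lists_eq_set)
    then have "hd (take j hs) \<in> Y" "hd (drop j hs) \<in> Y"
      using hd_in_set[OF ne(1)] hd_in_set[OF ne(2)] set_take_subset[of j hs] set_drop_subset[of j hs] by blast+
    \<comment> \<open>For \<open>p = 2\<close> both factors are chosen cycles. For larger
      \<open>p\<close> one of the two sublists has at least two entries, and its value is
      zero.\<close>
    then show "sgn_bar B (?\<mu> (take j hs)) \<otimes>\<^bsub>B\<^esub> ?\<mu> (drop j hs) = \<zero>\<^bsub>B\<^esub>"
      using zc prod by (intro sgn_bar_mult_zero) auto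
  qed
  then show "dB (?\<mu> hs) = (\<Oplus>\<^bsub>B\<^esub> j\<in>{1..length hs - 1}. sgn_bar B (?\<mu> (take j hs)) \<otimes>\<^bsub>B\<^esub> ?\<mu> (drop j hs))"
    using hs(2) d_zero by simp
qed

end

text \<open>\<open>L\<close> stands for the image of \<open>I\<close> in \<open>R / I m\<close>,
  which \<open>n\<close> annihilates. \<open>exact_mod_L\<close> is the trace left by the vanishing
  first Koszul homology over \<open>R\<close>: a degree-one cycle agrees with a boundary up to
  coefficients in \<open>L\<close>.\<close>

locale koszul_golod = koszul_residue_field +
  fixes L
  assumes length_le_3: "length xs \<le> 3"
    and minimal: "\<lbrakk>c \<in> {..<length xs} \<rightarrow> carrier A; (\<Oplus>i\<in>{..<length xs}. c i \<otimes> xs ! i) = \<zero>; i < length xs\<rbrakk> \<Longrightarrow> c i \<in> n"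
    and L: "L \<subseteq> n" "\<zero> \<in> L" "\<lbrakk>a \<in> L; b \<in> n\<rbrakk> \<Longrightarrow> a \<otimes> b = \<zero>"
    and exact_mod_L: "\<lbrakk>c \<in> {..<length xs} \<rightarrow> carrier A; (\<Oplus>i\<in>{..<length xs}. c i \<otimes> xs ! i) = \<zero>\<rbrakk> \<Longrightarrow>
       \<exists>T\<in>{..<length xs} \<rightarrow> {..<length xs} \<rightarrow> carrier A.
         \<forall>i<length xs. c i \<ominus> (\<Oplus>j\<in>{..<length xs}. (T i j \<ominus> T j i) \<otimes> xs ! j) \<in> L"
begin

lemma n_ideal: "ideal n A"
  using genideal_ideal[OF xs_closed] xs_genideal by simp

lemma n_closed: "a \<in> n \<Longrightarrow> a \<in> carrier A"
  using ideal.Icarr[OF n_ideal] .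

text \<open>Evaluated at \<open>U - {j}\<close>, the equation \<open>d f = 0\<close> is a relation
  among the generators in which \<open>f U\<close> occurs, up to sign, as the coefficient of
  \<open>xs ! j\<close>.\<close>

lemma cycle_coeffs:
  assumes f: "f \<in> Z" "f \<in> component B i" and i: "1 \<le> i" and U: "U \<subseteq> idx"
  shows "f U \<in> n"
proof (cases "U = {}")
  case True
  then show ?thesis using componentD(2)[OF f(2) U] i L(1,2) by auto
next
  case False
  then obtain j where j: "j \<in> U" by blast
  define V where "V = U - {j}"
  have V: "V \<subseteq> idx" "U = insert j V" "j \<notin> V" "j \<in> idx" using j U by (auto simp: V_def)
  note fc = cyclesD(1)[OF f(1)]
  have cc: "contraction k f V \<in> carrier A" if "k \<in> idx" for k
    using that fc V by (auto intro!: coeff_closed)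
  have "(\<Oplus>k\<in>idx. contraction k f V \<otimes> xs ! k) = (\<Oplus>k\<in>idx. xs ! k \<otimes> contraction k f V)"
    by (rule finsum_cong') (use cc nth_closed in \<open>auto simp: m_comm\<close>)
  also have "\<dots> = dB f V" by (rule d_eq[OF fc V(1), symmetric])
  also have "\<dots> = \<zero>" using cyclesD(2)[OF f(1)] zero_eq[OF V(1)] by simp
  finally have "contraction j f V \<in> n" by (intro minimal[of "\<lambda>k. contraction k f V"]) (use cc V(4) in auto)
  then have "sg {j} V \<otimes> f U \<in> n" using V by (simp add: contraction_eq)
  then have "sg {j} V \<otimes> (sg {j} V \<otimes> f U) \<in> n" using ideal.I_l_closed[OF n_ideal] by simp
  moreover have "sg {j} V \<otimes> (sg {j} V \<otimes> f U) = f U"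
    using coeff_closed[OF fc U] by (simp add: m_assoc[symmetric] sg_def neg_pow_square)
  ultimately show ?thesis by simp
qed

lemma degree_one_representative:
  assumes f: "f \<in> Z" "f \<in> component B 1"
  obtains g where "g \<in> Z" "g \<in> component B 1" "homology_class B g = homology_class B f" "\<And>U. U \<subseteq> idx \<Longrightarrow> g U \<in> L"
proof -
  note fc = cyclesD(1)[OF f(1)]
  have cc: "f {i} \<in> carrier A" if "i \<in> idx" for i using that fc by (auto intro!: coeff_closed)
  have "(\<Oplus>i\<in>idx. f {i} \<otimes> xs ! i) = (\<Oplus>i\<in>idx. xs ! i \<otimes> contraction i f {})"
    by (rule finsum_cong') (use cc nth_closed in \<open>auto simp: m_comm contraction_eq sg_def\<close>)
  also have "\<dots> = dB f {}" by (rule d_eq[OF fc, symmetric]) simp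
  also have "\<dots> = \<zero>" using cyclesD(2)[OF f(1)] zero_eq[of "{}"] by simp
  finally obtain T where T: "T \<in> idx \<rightarrow> idx \<rightarrow> carrier A"
    and TL: "\<And>i. i < length xs \<Longrightarrow> f {i} \<ominus> (\<Oplus>j\<in>idx. (T i j \<ominus> T j i) \<otimes> xs ! j) \<in> L"
    using exact_mod_L[of "\<lambda>i. f {i}"] cc by blast
  have Tc: "T i j \<in> carrier A" if "i \<in> idx" "j \<in> idx" for i j
    using funcset_mem[OF funcset_mem[OF T that(1)] that(2)] .
  \<comment> \<open>A degree-two element whose boundary has the alternating combinations from
    \<open>T\<close> as coefficients. \<open>Max\<close> and \<open>Min\<close> recover the two
    indices from the set, and their order fixes the sign so that \<open>w_pair\<close> holds in both
    cases.\<close>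
  define w where "w = (\<lambda>U\<in>Pow idx. if card U = 2 then T (Max U) (Min U) \<ominus> T (Min U) (Max U) else \<zero>)"
  have wB: "w \<in> carrier B" unfolding w_def
  proof (rule koszul_memI)
    fix U assume U: "U \<subseteq> idx"
    show "(if card U = 2 then T (Max U) (Min U) \<ominus> T (Min U) (Max U) else \<zero>) \<in> carrier A"
    proof (cases "card U = 2")
      case True
      then have "U \<noteq> {}" "finite U" by (auto intro: card_ge_0_finite)
      then have "Max U \<in> idx" "Min U \<in> idx" using U Max_in Min_in by blast+
      then show ?thesis using Tc by simp
    qed simp
  qed
  have w_pair: "contraction j w {i} = T i j \<ominus> T j i" if "i \<in> idx" "j \<in> idx" for i j
  proof -
    have tc: "T i j \<in> carrier A" "T j i \<in> carrier A" using Tc that by auto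
    have i: "{i} \<subseteq> idx" "insert j {i} \<subseteq> idx" using that by auto
    consider "j < i" | "j = i" | "i < j" by linarith
    then show ?thesis
    proof cases
      case 1
      then have "sg {j} {i} = \<one>" by (simp add: sg_def inversions_singletons)
      moreover have "w (insert j {i}) = T i j \<ominus> T j i" using 1 i by (simp add: w_def max_def min_def)
      ultimately show ?thesis using 1 tc by (simp add: contraction_eq[OF i(1)])
    next
      case 2
      then show ?thesis using tc by (simp add: contraction_eq[OF i(1)] a_minus_def r_neg)
    next
      case 3
      then have "sg {j} {i} = \<ominus> \<one>" by (simp add: sg_def inversions_singletons neg_pow_Suc[of 0, simplified])
      moreover have "w (insert j {i}) = T j i \<ominus> T i j" using 3 i by (simp add: w_def max_def min_def)
      moreover have "\<ominus> \<one> \<otimes> (T j i \<ominus> T i j) = T i j \<ominus> T j i" using tc by algebra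
      ultimately show ?thesis using 3 by (simp add: contraction_eq[OF i(1)])
    qed
  qed
  have dw1: "dB w {i} = (\<Oplus>j\<in>idx. (T i j \<ominus> T j i) \<otimes> xs ! j)" if i: "i \<in> idx" for i
  proof -
    have "dB w {i} = (\<Oplus>j\<in>idx. xs ! j \<otimes> contraction j w {i})" by (rule d_eq[OF wB]) (use i in auto)
    also have "\<dots> = (\<Oplus>j\<in>idx. (T i j \<ominus> T j i) \<otimes> xs ! j)"
      by (rule finsum_cong') (use Tc i nth_closed in \<open>auto simp: w_pair m_comm\<close>)
    finally show ?thesis .
  qed
  have dw0: "dB w U = \<zero>" if U: "U \<subseteq> idx" "card U \<noteq> 1" for U
  proof -
    have "dB w U = (\<Oplus>j\<in>idx. \<zero>)"
      unfolding d_eq[OF wB U(1)]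
    proof (rule finsum_cong')
      fix j assume j: "j \<in> idx"
      then have jU: "insert j U \<subseteq> idx" using U by auto
      show "xs ! j \<otimes> contraction j w U = \<zero>"
      proof (cases "j \<in> U")
        case False
        then have "card (insert j U) \<noteq> 2" using U(2) idx_finite[OF U(1)] by simp
        then show ?thesis using jU nth_closed[OF j] by (simp add: contraction_eq[OF U(1)] w_def)
      qed (use nth_closed[OF j] in \<open>simp add: contraction_eq[OF U(1)]\<close>)
    qed auto
    then show ?thesis by simp
  qed
  define g where "g = f \<ominus>\<^bsub>B\<^esub> dB w"
  have dwc: "dB w \<in> carrier B" using wB by auto
  have gB: "g \<in> carrier B" unfolding g_def using fc dwc by simp
  have g_eq: "g U = f U \<ominus> dB w U" if U: "U \<subseteq> idx" for U
  proof -
    have "(\<ominus>\<^bsub>B\<^esub> dB w) U \<oplus> dB w U = \<zero>"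
      using add_eq[OF U, of "\<ominus>\<^bsub>B\<^esub> dB w" "dB w"] KB.l_neg[OF dwc] zero_eq[OF U] by simp
    then have "(\<ominus>\<^bsub>B\<^esub> dB w) U = \<ominus> dB w U"
      using minus_equality coeff_closed[OF _ U] dwc by (metis KB.a_inv_closed)
    then show ?thesis by (simp add: g_def a_minus_def add_eq[OF U])
  qed
  have dwZ: "dB w \<in> Z" using boundaries_subset wB by (auto simp: boundaries_def)
  have gZ: "g \<in> Z" using cyclesD[OF f(1)] cyclesD[OF dwZ] gB
    by (intro cyclesI) (auto simp: g_def a_minus_def d_add d_minus)
  have g1: "g U = \<zero>" if "U \<subseteq> idx" "card U \<noteq> 1" for U
    using componentD(2)[OF f(2) that] dw0[OF that] by (simp add: g_eq[OF that(1)] a_minus_def)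
  show thesis
  proof (rule that[of g])
    show "g \<in> Z" by (rule gZ)
    show "g \<in> component B 1" using gB g1 by (auto simp: component_eq)
    have "g \<ominus>\<^bsub>B\<^esub> f = \<ominus>\<^bsub>B\<^esub> dB w"
      using fc dwc by (simp add: g_def a_minus_def KB.a_ac KB.r_neg2)
    also have "\<dots> = dB (\<ominus>\<^bsub>B\<^esub> w)" using d_minus[OF wB] by simp
    finally have "g \<ominus>\<^bsub>B\<^esub> f \<in> Bd" using wB unfolding boundaries_def by auto
    then show "homology_class B g = homology_class B f" using homology_class_eq_iff[OF gZ f(1)] by simp
    show "g U \<in> L" if U: "U \<subseteq> idx" for U
    proof (cases "card U = 1")
      case True
      then obtain i where i: "U = {i}" by (auto simp: card_1_singleton_iff)
      then have "i \<in> idx" using U by auto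
      then show ?thesis using TL[of i] dw1[of i] g_eq[OF U] i by simp
    qed (use g1 U L(2) in simp)
  qed
qed

lemma product_zero:
  assumes f: "f \<in> Z" "f \<in> component B i" "1 \<le> i" "i = 1 \<Longrightarrow> (\<And>U. U \<subseteq> idx \<Longrightarrow> f U \<in> L)"
    and g: "g \<in> Z" "g \<in> component B j" "1 \<le> j" "j = 1 \<Longrightarrow> (\<And>U. U \<subseteq> idx \<Longrightarrow> g U \<in> L)"
  shows "f \<otimes>\<^bsub>B\<^esub> g = \<zero>\<^bsub>B\<^esub>"
proof (rule koszul_ext)
  fix U assume U: "U \<subseteq> idx"
  have "(f \<otimes>\<^bsub>B\<^esub> g) U = (\<Oplus>S\<in>Pow U. \<zero>)"
    unfolding mult_eq[OF U]
  proof (rule finsum_cong')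
    fix S assume "S \<in> Pow U"
    then have S: "S \<subseteq> idx" "U - S \<subseteq> idx" "S \<subseteq> U" using U by auto
    have fn: "f S \<in> n" by (rule cycle_coeffs[OF f(1-3) S(1)])
    have gn: "g (U - S) \<in> n" by (rule cycle_coeffs[OF g(1-3) S(2)])
    have c: "f S \<in> carrier A" "g (U - S) \<in> carrier A" using fn gn n_closed by auto
    have "f S \<otimes> g (U - S) = \<zero>"
    proof -
      consider "i = 1" | "j = 1" | "2 \<le> i" "2 \<le> j" using f(3) g(3) by linarith
      then show ?thesis
      proof cases
        case 1
        then show ?thesis using L(3)[OF f(4)[OF _ S(1)] gn] by simp
      next
        case 2
        then have "g (U - S) \<otimes> f S = \<zero>" using L(3)[OF g(4)[OF _ S(2)] fn] by simp
        then show ?thesis using c m_comm by simp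
      next
        case 3
        have "card S + card (U - S) = card U"
          using S(3) idx_finite[OF U] by (metis card_Diff_subset card_mono finite_subset le_add_diff_inverse)
        moreover have "card U \<le> 3" using card_mono[OF _ U] length_le_3 by simp
        ultimately have "card S \<noteq> i \<or> card (U - S) \<noteq> j" using 3 by linarith
        then show ?thesis using componentD(2)[OF f(2) S(1)] componentD(2)[OF g(2) S(2)] c by auto
      qed
    qed
    then show "sg S (U - S) \<otimes> (f S \<otimes> g (U - S)) = \<zero>" by simp
  qed auto
  then show "(f \<otimes>\<^bsub>B\<^esub> g) U = \<zero>\<^bsub>B\<^esub> U" by (simp add: zero_eq[OF U])
qed (use cyclesD(1)[OF f(1)] cyclesD(1)[OF g(1)] in auto)

theorem koszul_admits_trivial_massey_operation: "admits_trivial_massey_operation B"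
proof -
  obtain Y where Y: "homogeneous_basis B Y" using exists_homogeneous_basis by blast
  \<comment> \<open>The degree is recorded because only representatives of degree one are required
    to have coefficients in \<open>L\<close>.\<close>
  define good where "good h z \<longleftrightarrow> z \<in> Z \<and> homology_class B z = h \<and>
     (\<exists>i\<ge>1. z \<in> component B i \<and> (i = 1 \<longrightarrow> (\<forall>U\<subseteq>idx. z U \<in> L)))" for h z
  have ex: "\<exists>z. good h z" if h: "h \<in> Y" for h
  proof -
    have "h \<in> (\<Union>i\<in>{1..}. homology B i)" using h Y by (auto simp: homogeneous_basis_def)
    then obtain i f where f: "1 \<le> i" "f \<in> Z" "f \<in> component B i" "h = homology_class B f"
      by (auto simp: homology_def)
    show ?thesis
    proof (cases "i = 1")
      case True
      then have "f \<in> component B 1" using f(3) by simp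
      then obtain g where "g \<in> Z" "g \<in> component B 1" "homology_class B g = homology_class B f" "\<And>U. U \<subseteq> idx \<Longrightarrow> g U \<in> L"
        using degree_one_representative[OF f(2)] by blast
      then have "good h g" using f(4) by (auto simp: good_def)
      then show ?thesis by blast
    next
      case False
      then have "good h f" using f by (auto simp: good_def)
      then show ?thesis by blast
    qed
  qed
  define z where "z h = (SOME z. good h z)" for h
  have z: "good h (z h)" if "h \<in> Y" for h unfolding z_def using ex[OF that] by (rule someI_ex)
  have "trivial_massey_operation B Y (\<lambda>hs. if length hs = 1 then z (hd hs) else \<zero>\<^bsub>B\<^esub>)"
  proof (rule trivial_massey_operationI)
    show "z h \<in> Z \<and> z h \<in> (\<Union>i. component B i) \<and> homology_class B (z h) = h" if "h \<in> Y" for h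
      using z[OF that] by (auto simp: good_def)
    fix h h' assume h: "h \<in> Y" "h' \<in> Y"
    obtain i where i: "z h \<in> Z" "z h \<in> component B i" "1 \<le> i" "i = 1 \<longrightarrow> (\<forall>U\<subseteq>idx. z h U \<in> L)"
      using z[OF h(1)] unfolding good_def by blast
    obtain j where j: "z h' \<in> Z" "z h' \<in> component B j" "1 \<le> j" "j = 1 \<longrightarrow> (\<forall>U\<subseteq>idx. z h' U \<in> L)"
      using z[OF h(2)] unfolding good_def by blast
    show "z h \<otimes>\<^bsub>B\<^esub> z h' = \<zero>\<^bsub>B\<^esub>"
      by (rule product_zero[OF i(1-3) _ j(1-3)]) (use i(4) j(4) in simp_all)
  qed
  then show ?thesis using Y by (auto simp: admits_trivial_massey_operation_def)
qed

end

section \<open>Minimal generators of quotient rings\<close>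

context cring
begin

text \<open>Since \<open>J \<subseteq> K\<close>, membership in \<open>K\<close> does not depend on
  the representative of a coset.\<close>

lemma quotient_image_mem_iff:
  assumes J: "ideal J R" and K: "ideal K R" "J \<subseteq> K" and a: "a \<in> carrier R"
  shows "J +> a \<in> (+>) J ` K \<longleftrightarrow> a \<in> K"
proof
  interpret K: ideal K R by fact
  assume "J +> a \<in> (+>) J ` K"
  then obtain b where b: "b \<in> K" "J +> a = J +> b" by blast
  have bc: "b \<in> carrier R" by (rule K.Icarr[OF b(1)])
  then have "a \<ominus> b \<in> K" using quotient_eq_iff_same_a_r_cos[OF J a bc] b(2) K(2) by blast
  then have "(a \<ominus> b) \<oplus> b \<in> K" using b(1) by simp
  moreover have "(a \<ominus> b) \<oplus> b = a" using a bc by algebra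
  ultimately show "a \<in> K" by simp
qed blast

lemma quotient_eq_zero_iff:
  assumes J: "ideal J R" and a: "a \<in> carrier R"
  shows "J +> a = \<zero>\<^bsub>R Quot J\<^esub> \<longleftrightarrow> a \<in> J"
proof -
  have "J +> \<zero> = \<zero>\<^bsub>R Quot J\<^esub>"
    using ring_hom_cring.hom_zero[OF ideal.rcos_ring_hom_cring[OF J is_cring]] by simp
  then show ?thesis using quotient_eq_iff_same_a_r_cos[OF J a zero_closed] a by (simp add: a_minus_def)
qed

lemma quotient_carrier: "ideal J R \<Longrightarrow> carrier (R Quot J) = (+>) J ` carrier R"
  by (auto simp: FactRing_def A_RCOSETS_def')

lemma ideal_prod_subset_left:
  assumes "ideal I R" "ideal m R"
  shows "I \<cdot> m \<subseteq> I"
  using ideal_prod_inter[OF assms] by blast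

text \<open>Dividing by a unit coefficient would express \<open>xs ! j\<close> through the other
  generators.\<close>

lemma minimal_generators_no_unit_relation:
  assumes min: "minimal_generators R N xs" and c: "c \<in> {..<length xs} \<rightarrow> carrier R"
    and rel: "(\<Oplus>i\<in>{..<length xs}. c i \<otimes> xs ! i) = \<zero>" and j: "j < length xs"
  shows "c j \<notin> Units R"
proof
  assume u: "c j \<in> Units R"
  have xs: "distinct xs" "set xs \<subseteq> carrier R" "Idl (set xs) = N"
    and no: "\<And>Y. Y \<subset> set xs \<Longrightarrow> Idl Y \<noteq> N"
    using min by (auto simp: minimal_generators_def)
  have xc: "xs ! i \<in> carrier R" if "i < length xs" for i using xs(2) that by auto
  have cc: "c i \<in> carrier R" if "i < length xs" for i using c that by auto
  define Y where "Y = set xs - {xs ! j}"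
  have Y: "Y \<subseteq> carrier R" "Y \<subset> set xs" using xs(2) j by (auto simp: Y_def)
  interpret Y: ideal "Idl Y" R by (rule genideal_ideal[OF Y(1)])
  define s where "s = (\<Oplus>i\<in>{..<length xs} - {j}. c i \<otimes> xs ! i)"
  have sY: "s \<in> Idl Y"
    unfolding s_def
  proof (rule finsum_in_ideal[OF Y.is_ideal])
    fix i assume i: "i \<in> {..<length xs} - {j}"
    then have "xs ! i \<in> Y" using xs(1) j by (auto simp: Y_def nth_eq_iff_index_eq)
    then show "c i \<otimes> xs ! i \<in> Idl Y" using genideal_self[OF Y(1)] cc i by (intro Y.I_l_closed) auto
  qed simp
  have "(\<Oplus>i\<in>insert j ({..<length xs} - {j}). c i \<otimes> xs ! i) = c j \<otimes> xs ! j \<oplus> s"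
    unfolding s_def using cc xc j by (intro finsum_insert) auto
  moreover have "insert j ({..<length xs} - {j}) = {..<length xs}" using j by auto
  ultimately have "c j \<otimes> xs ! j \<oplus> s = \<zero>" using rel by simp
  then have "c j \<otimes> xs ! j = \<ominus> s" using cc[OF j] xc[OF j] Y.Icarr[OF sY] minus_equality minus_minus by (metis m_closed)
  then have "c j \<otimes> xs ! j \<in> Idl Y" using sY by simp
  then have "inv (c j) \<otimes> (c j \<otimes> xs ! j) \<in> Idl Y" by (rule Y.I_l_closed[OF _ Units_inv_closed[OF u]])
  moreover have "inv (c j) \<otimes> (c j \<otimes> xs ! j) = xs ! j"
    using u cc[OF j] xc[OF j] by (simp add: m_assoc[symmetric])
  ultimately have "xs ! j \<in> Idl Y" by simp
  then have "set xs \<subseteq> Idl Y" using genideal_self[OF Y(1)] by (auto simp: Y_def)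
  then have "Idl (set xs) \<subseteq> Idl Y" by (rule genideal_minimal[OF Y.is_ideal])
  moreover have "Idl Y \<subseteq> Idl (set xs)" using subset_Idl_subset[OF xs(2)] Y(2) by blast
  ultimately show False using no[OF Y(2)] xs(3) by blast
qed

lemma quotient_combination:
  assumes J: "ideal J R" and x: "\<And>i. i < length xs \<Longrightarrow> x i \<in> carrier R \<and> xs ! i = J +> x i"
    and c: "\<And>i. i < length xs \<Longrightarrow> c i \<in> carrier R"
  shows "J +> (\<Oplus>i\<in>{..<length xs}. c i \<otimes> x i) =
    (\<Oplus>\<^bsub>R Quot J\<^esub> i\<in>{..<length xs}. (J +> c i) \<otimes>\<^bsub>R Quot J\<^esub> xs ! i)"
proof -
  interpret h: ring_hom_cring R "R Quot J" "(+>) J" by (rule ideal.rcos_ring_hom_cring[OF J is_cring])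
  have "J +> (\<Oplus>i\<in>{..<length xs}. c i \<otimes> x i) =
      (\<Oplus>\<^bsub>R Quot J\<^esub> i\<in>{..<length xs}. ((+>) J \<circ> (\<lambda>i. c i \<otimes> x i)) i)"
    using c x by (intro h.hom_finsum) auto
  also have "\<dots> = (\<Oplus>\<^bsub>R Quot J\<^esub> i\<in>{..<length xs}. (J +> c i) \<otimes>\<^bsub>R Quot J\<^esub> xs ! i)"
    by (rule h.S.finsum_cong') (use c x in auto)
  finally show ?thesis .
qed

lemma quotient_lift:
  assumes J: "ideal J R" and c: "c \<in> {..<n} \<rightarrow> carrier (R Quot J)"
  obtains s where "\<And>i. i < n \<Longrightarrow> s i \<in> carrier R \<and> c i = J +> s i"
proof -
  have "\<forall>i. \<exists>s. i < n \<longrightarrow> s \<in> carrier R \<and> c i = J +> s"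
    using funcset_mem[OF c] unfolding quotient_carrier[OF J] by blast
  then obtain s where "\<And>i. i < n \<Longrightarrow> s i \<in> carrier R \<and> c i = J +> s i"
    by - (drule choice, blast)
  then show thesis by (rule that)
qed

lemma quotient_genideal_lift:
  assumes J: "ideal J R" and x: "\<And>i. i < length xs \<Longrightarrow> x i \<in> carrier R \<and> xs ! i = J +> x i"
    and r: "r \<in> carrier R" "J +> r \<in> genideal (R Quot J) (set xs)"
  obtains s where "\<And>i. i < length xs \<Longrightarrow> s i \<in> carrier R" "r \<ominus> (\<Oplus>i\<in>{..<length xs}. s i \<otimes> x i) \<in> J"
proof -
  interpret A: cring "R Quot J" by (rule ideal.quotient_is_cring[OF J is_cring])
  have "set xs = (\<lambda>i. xs ! i) ` {..<length xs}" by (auto simp: set_conv_nth)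
  then have gen: "J +> r \<in> genideal (R Quot J) ((\<lambda>i. xs ! i) ` {..<length xs})" using r(2) by simp
  have "(\<lambda>i. xs ! i) \<in> {..<length xs} \<rightarrow> carrier (R Quot J)"
    using x unfolding quotient_carrier[OF J] by blast
  then obtain c where c: "c \<in> {..<length xs} \<rightarrow> carrier (R Quot J)"
      "J +> r = (\<Oplus>\<^bsub>R Quot J\<^esub> i\<in>{..<length xs}. c i \<otimes>\<^bsub>R Quot J\<^esub> xs ! i)"
    using A.genideal_combination[OF _ gen] by blast
  obtain s where s: "\<And>i. i < length xs \<Longrightarrow> s i \<in> carrier R \<and> c i = J +> s i"
    using quotient_lift[OF J c(1)] by blast
  have sc: "(\<Oplus>i\<in>{..<length xs}. s i \<otimes> x i) \<in> carrier R" using s x by (auto intro!: finsum_closed)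
  have "J +> (\<Oplus>i\<in>{..<length xs}. s i \<otimes> x i) =
      (\<Oplus>\<^bsub>R Quot J\<^esub> i\<in>{..<length xs}. (J +> s i) \<otimes>\<^bsub>R Quot J\<^esub> xs ! i)"
    by (rule quotient_combination[OF J x]) (use s in auto)
  also have "\<dots> = J +> r"
  proof -
    have "J +> a \<in> carrier (R Quot J)" if "a \<in> carrier R" for a using quotient_carrier[OF J] that by blast
    then show ?thesis unfolding c(2) using s x by (intro A.finsum_cong' refl) auto
  qed
  finally show thesis using that[of s] s quotient_eq_iff_same_a_r_cos[OF J r(1) sc] by auto
qed

lemma quotient_minimal_generators_no_unit_relation:
  assumes J: "ideal J R" and x: "\<And>i. i < length xs \<Longrightarrow> x i \<in> carrier R \<and> xs ! i = J +> x i"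
    and min: "minimal_generators (R Quot J) N xs"
    and c: "\<And>i. i < length xs \<Longrightarrow> c i \<in> carrier R" "(\<Oplus>i\<in>{..<length xs}. c i \<otimes> x i) \<in> J"
    and i: "i < length xs"
  shows "c i \<notin> Units R"
proof
  assume u: "c i \<in> Units R"
  interpret A: cring "R Quot J" by (rule ideal.quotient_is_cring[OF J is_cring])
  interpret h: ring_hom_cring R "R Quot J" "(+>) J" by (rule ideal.rcos_ring_hom_cring[OF J is_cring])
  have "J +> (\<Oplus>i\<in>{..<length xs}. c i \<otimes> x i) = \<zero>\<^bsub>R Quot J\<^esub>"
    using quotient_eq_zero_iff[OF J] c(2) ideal.Icarr[OF J] by blast
  then have "J +> c i \<notin> Units (R Quot J)"
    using A.minimal_generators_no_unit_relation[OF min, of "\<lambda>i. J +> c i" i] i c(1)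
      quotient_combination[OF J x c(1)] by auto
  moreover have "J +> c i \<in> Units (R Quot J)"
  proof -
    have "(J +> inv (c i)) \<otimes>\<^bsub>R Quot J\<^esub> (J +> c i) = \<one>\<^bsub>R Quot J\<^esub>"
      "(J +> c i) \<otimes>\<^bsub>R Quot J\<^esub> (J +> inv (c i)) = \<one>\<^bsub>R Quot J\<^esub>"
      using u h.hom_mult[of "inv (c i)" "c i"] h.hom_mult[of "c i" "inv (c i)"] by auto
    moreover have "J +> inv (c i) \<in> carrier (R Quot J)" "J +> c i \<in> carrier (R Quot J)" using u by auto
    ultimately show ?thesis unfolding Units_def by blast
  qed
  ultimately show False by blast
qed

text \<open>The common core of the local and the graded case. Apart from the regular triple, each
  case has to provide lifts \<open>x\<close> that generate \<open>m\<close> and admit no relation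
  modulo \<open>I m\<close> with a coefficient outside \<open>m\<close>.\<close>

lemma quotient_by_product_admits_trivial_massey_operation:
  assumes m: "ideal m R" "\<one> \<notin> m" and inverse: "\<And>a. a \<in> carrier R \<Longrightarrow> a \<notin> m \<Longrightarrow> \<exists>b\<in>carrier R. a \<otimes> b \<ominus> \<one> \<in> m"
    and I: "ideal I R" "I \<subseteq> m"
    and y: "y1 \<in> carrier R" "y2 \<in> carrier R" "y3 \<in> carrier R" "Idl {y1, y2, y3} = m" "regular_sequence3 y1 y2 y3"
    and x: "x \<in> {..<length xs} \<rightarrow> carrier R" "Idl (x ` {..<length xs}) = m"
    and xs: "\<And>i. i < length xs \<Longrightarrow> xs ! i = (I \<cdot> m) +> x i"
    and indep: "\<And>c i. c \<in> {..<length xs} \<rightarrow> carrier R \<Longrightarrow> (\<Oplus>i\<in>{..<length xs}. c i \<otimes> x i) \<in> I \<cdot> m \<Longrightarrow>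
       i < length xs \<Longrightarrow> c i \<in> m"
  shows "admits_trivial_massey_operation (koszul (R Quot (I \<cdot> m)) xs)"
proof -
  define J where "J = I \<cdot> m"
  define n where "n = length xs"
  have J: "ideal J R" unfolding J_def by (rule ideal_prod_is_ideal[OF I(1) m(1)])
  have JI: "J \<subseteq> I" unfolding J_def by (rule ideal_prod_subset_left[OF I(1) m(1)])
  interpret m: ideal m R by fact
  interpret I: ideal I R by fact
  interpret J: ideal J R by fact
  define A where "A = R Quot J"
  define \<pi> where "\<pi> = (+>) J"
  interpret A: cring A unfolding A_def by (rule J.quotient_is_cring[OF is_cring])
  interpret \<pi>: ring_hom_cring R A \<pi> unfolding A_def \<pi>_def by (rule J.rcos_ring_hom_cring[OF is_cring])
  have \<pi>_ring: "ring_hom_ring R A \<pi>" unfolding A_def \<pi>_def by (rule J.rcos_ring_hom_ring)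
  have xc: "x i \<in> carrier R" if "i < n" for i using x(1) that unfolding n_def by auto
  have xs': "xs ! i = \<pi> (x i)" if "i < n" for i using xs that unfolding n_def \<pi>_def J_def by simp
  have set_xs: "set xs = \<pi> ` x ` {..<n}" using xs' by (auto simp: set_conv_nth n_def image_iff)
  have xm: "x ` {..<n} \<subseteq> m" using genideal_self[of "x ` {..<n}"] xc x(2) unfolding n_def by auto
  have \<pi>_zero: "\<pi> a = \<zero>\<^bsub>A\<^esub> \<longleftrightarrow> a \<in> J" if "a \<in> carrier R" for a
    using quotient_eq_zero_iff[OF J that] unfolding A_def \<pi>_def .
  have \<pi>_m: "\<pi> a \<in> \<pi> ` m \<longleftrightarrow> a \<in> m" if "a \<in> carrier R" for a
    unfolding \<pi>_def by (rule quotient_image_mem_iff[OF J m(1) _ that]) (use JI I(2) in blast)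
  have A_carrier: "carrier A = \<pi> ` carrier R" unfolding A_def \<pi>_def by (rule quotient_carrier[OF J])
  have xs_closed: "set xs \<subseteq> carrier A" using set_xs xc A_carrier by auto
  have lift: "\<exists>c'\<in>{..<n} \<rightarrow> carrier R. (\<forall>i<n. c i = \<pi> (c' i)) \<and>
      (\<Oplus>\<^bsub>A\<^esub> i\<in>{..<n}. c i \<otimes>\<^bsub>A\<^esub> xs ! i) = \<pi> (\<Oplus>i\<in>{..<n}. c' i \<otimes> x i)"
    if c: "c \<in> {..<n} \<rightarrow> carrier A" for c
  proof -
    obtain c' where c': "\<And>i. i < n \<Longrightarrow> c' i \<in> carrier R \<and> c i = \<pi> (c' i)"
      using quotient_lift[OF J, of c n] c unfolding A_def \<pi>_def by blast
    have "\<pi> (\<Oplus>i\<in>{..<n}. c' i \<otimes> x i) = (\<Oplus>\<^bsub>A\<^esub> i\<in>{..<n}. \<pi> (c' i) \<otimes>\<^bsub>A\<^esub> xs ! i)"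
      unfolding A_def \<pi>_def n_def
      by (rule quotient_combination[OF J]) (use xc xs' c' in \<open>auto simp: n_def \<pi>_def\<close>)
    also have "\<dots> = (\<Oplus>\<^bsub>A\<^esub> i\<in>{..<n}. c i \<otimes>\<^bsub>A\<^esub> xs ! i)"
      by (rule A.finsum_cong') (use c' xc xs' in auto)
    finally show ?thesis using c' by (intro bexI[of _ c']) auto
  qed
  have exact_R: "koszul_exact n x"
  proof -
    define y where "y i = [y1, y2, y3] ! i" for i
    have "koszul_exact 3 y"
      unfolding y_def using koszul_exact_regular_sequence3[OF y(1-3,5)] .
    have "{..<3::nat} = {0, 1, 2}" by auto
    then have im: "y ` {..<3} = {y1, y2, y3}" by (simp add: y_def)
    have y_sub: "{y1, y2, y3} \<subseteq> carrier R" using y(1-3) by simp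
    then have yc: "y \<in> {..<3} \<rightarrow> carrier R" unfolding im[symmetric] by blast
    have ym: "y ` {..<3} \<subseteq> m" using genideal_self[OF y_sub] y(4) im by simp
    have "\<forall>i. \<exists>c. i < n \<longrightarrow> c \<in> {..<3} \<rightarrow> carrier R \<and> x i = (\<Oplus>j\<in>{..<3}. c j \<otimes> y j)"
      using genideal_combination[OF yc] xm unfolding im y(4) by blast
    then obtain M where M: "\<And>i. i < n \<Longrightarrow> M i \<in> {..<3} \<rightarrow> carrier R \<and> x i = (\<Oplus>j\<in>{..<3}. M i j \<otimes> y j)"
      by - (drule choice, blast)
    have "\<forall>j. \<exists>c. j < 3 \<longrightarrow> c \<in> {..<n} \<rightarrow> carrier R \<and> y j = (\<Oplus>i\<in>{..<n}. c i \<otimes> x i)"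
      using genideal_combination[of x n] x ym unfolding n_def by blast
    then obtain N where N: "\<And>j. j < 3 \<Longrightarrow> N j \<in> {..<n} \<rightarrow> carrier R \<and> y j = (\<Oplus>i\<in>{..<n}. N j i \<otimes> x i)"
      by - (drule choice, blast)
    show ?thesis
    proof (rule koszul_exact_change_generators[OF yc \<open>koszul_exact 3 y\<close>])
      fix a i assume a: "a \<in> {..<n} \<rightarrow> carrier R" "(\<Oplus>i\<in>{..<n}. a i \<otimes> x i) = \<zero>" "i < n"
      \<comment> \<open>A relation over \<open>R\<close> is in particular one modulo
        \<open>I m\<close>; its coefficients lie in \<open>m\<close>, hence are combinations of the
        lifts.\<close>
      then have "a i \<in> m" using indep[of a i] J.zero_closed unfolding n_def J_def by simp
      then show "\<exists>c\<in>{..<n} \<rightarrow> carrier R. a i = (\<Oplus>q\<in>{..<n}. c q \<otimes> x q)"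
        using genideal_combination[of x n] x unfolding n_def by blast
    qed (use M N in \<open>auto dest: funcset_mem\<close>)
  qed
  interpret koszul_golod A xs "\<pi> ` m" "\<pi> ` I"
  proof unfold_locales
    show "set xs \<subseteq> carrier A" by (rule xs_closed)
    show "genideal A (set xs) = \<pi> ` m"
    proof
      have "ideal (\<pi> ` m) A" unfolding \<pi>_def A_def by (rule ring_ideal_imp_quot_ideal[OF J m(1)])
      then show "genideal A (set xs) \<subseteq> \<pi> ` m"
        by (rule A.genideal_minimal) (use set_xs xm in blast)
      have "ideal {r \<in> carrier R. \<pi> r \<in> genideal A (set xs)} R"
        by (rule ring_hom_ring.ideal_vimage[OF \<pi>_ring A.genideal_ideal[OF xs_closed]])
      then have "Idl (x ` {..<n}) \<subseteq> {r \<in> carrier R. \<pi> r \<in> genideal A (set xs)}"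
        by (rule genideal_minimal) (use xc set_xs A.genideal_self[OF xs_closed] in auto)
      then show "\<pi> ` m \<subseteq> genideal A (set xs)" using x(2) unfolding n_def by blast
    qed
    show "\<one>\<^bsub>A\<^esub> \<notin> \<pi> ` m" using \<pi>_m[OF one_closed] m(2) by simp
    show "\<exists>b\<in>carrier A. a \<otimes>\<^bsub>A\<^esub> b \<ominus>\<^bsub>A\<^esub> \<one>\<^bsub>A\<^esub> \<in> \<pi> ` m" if a: "a \<in> carrier A" "a \<notin> \<pi> ` m" for a
    proof -
      obtain r where r: "r \<in> carrier R" "a = \<pi> r" using a(1) A_carrier by blast
      then obtain s where s: "s \<in> carrier R" "r \<otimes> s \<ominus> \<one> \<in> m" using inverse a(2) by blast
      have "\<pi> (r \<otimes> s \<ominus> \<one>) = a \<otimes>\<^bsub>A\<^esub> \<pi> s \<ominus>\<^bsub>A\<^esub> \<one>\<^bsub>A\<^esub>" using r s by (simp add: a_minus_def)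
      then show ?thesis using s by (metis imageI \<pi>.hom_closed)
    qed
    show "length xs \<le> 3"
    proof -
      have "{..<3::nat} = {0, 1, 2}" by auto
      then have im: "(\<lambda>i. [y1, y2, y3] ! i) ` {..<3} = {y1, y2, y3}" by simp
      \<comment> \<open>As relations of the lifts have coefficients in \<open>m\<close>, the lifts
        are independent modulo \<open>m\<close> and cannot outnumber the three generators.\<close>
      have "n \<le> 3"
      proof (rule generator_count_bound[OF m inverse, of x n "\<lambda>i. [y1, y2, y3] ! i" 3])
        show "x ` {..<n} \<subseteq> Idl ((\<lambda>i. [y1, y2, y3] ! i) ` {..<3})" unfolding im y(4) by (rule xm)
        show "(\<lambda>i. [y1, y2, y3] ! i) ` {..<3} \<subseteq> Idl (x ` {..<n})"
          unfolding im using x(2) y(4) genideal_self[of "{y1, y2, y3}"] y(1-3) unfolding n_def by simp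
        have "(\<lambda>i. [y1, y2, y3] ! i) ` {..<3} \<subseteq> carrier R" unfolding im using y(1-3) by simp
        then show "(\<lambda>i. [y1, y2, y3] ! i) \<in> {..<3} \<rightarrow> carrier R" by blast
        show "a i \<in> m" if "a \<in> {..<n} \<rightarrow> carrier R" "(\<Oplus>i\<in>{..<n}. a i \<otimes> x i) = \<zero>" "i < n" for a i
          using indep[of a i] that J.zero_closed unfolding n_def J_def by simp
      qed (use xc in auto)
      then show ?thesis by (simp add: n_def)
    qed
    show "c i \<in> \<pi> ` m" if c: "c \<in> {..<length xs} \<rightarrow> carrier A"
      "(\<Oplus>\<^bsub>A\<^esub> i\<in>{..<length xs}. c i \<otimes>\<^bsub>A\<^esub> xs ! i) = \<zero>\<^bsub>A\<^esub>" "i < length xs" for c i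
    proof -
      obtain c' where c': "c' \<in> {..<n} \<rightarrow> carrier R" "\<And>i. i < n \<Longrightarrow> c i = \<pi> (c' i)"
        "(\<Oplus>\<^bsub>A\<^esub> i\<in>{..<n}. c i \<otimes>\<^bsub>A\<^esub> xs ! i) = \<pi> (\<Oplus>i\<in>{..<n}. c' i \<otimes> x i)"
        using lift[of c] c(1) unfolding n_def by blast
      have "(\<Oplus>i\<in>{..<n}. c' i \<otimes> x i) \<in> carrier R" using c'(1) xc by (auto intro!: finsum_closed)
      then have "(\<Oplus>i\<in>{..<n}. c' i \<otimes> x i) \<in> J" using \<pi>_zero c'(3) c(2) unfolding n_def by metis
      then have "c' i \<in> m" using indep[of c' i] c'(1) c(3) unfolding n_def J_def by blast
      then show ?thesis using c'(2) c(3) unfolding n_def by blast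
    qed
    show "\<pi> ` I \<subseteq> \<pi> ` m" using I(2) by blast
    show "\<zero>\<^bsub>A\<^esub> \<in> \<pi> ` I" using I.zero_closed \<pi>.hom_zero by (metis imageI)
    show "a \<otimes>\<^bsub>A\<^esub> b = \<zero>\<^bsub>A\<^esub>" if ab: "a \<in> \<pi> ` I" "b \<in> \<pi> ` m" for a b
    proof -
      obtain r s where rs: "r \<in> I" "s \<in> m" "a = \<pi> r" "b = \<pi> s" using ab by blast
      have "r \<otimes> s \<in> J" unfolding J_def using rs by (intro ideal_prod.prod)
      then have "\<pi> (r \<otimes> s) = \<zero>\<^bsub>A\<^esub>" using \<pi>_zero J.Icarr by blast
      then show ?thesis using rs I.Icarr m.Icarr by simp
    qed
    show "\<exists>T\<in>{..<length xs} \<rightarrow> {..<length xs} \<rightarrow> carrier A.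
         \<forall>i<length xs. c i \<ominus>\<^bsub>A\<^esub> (\<Oplus>\<^bsub>A\<^esub> j\<in>{..<length xs}. (T i j \<ominus>\<^bsub>A\<^esub> T j i) \<otimes>\<^bsub>A\<^esub> xs ! j) \<in> \<pi> ` I"
      if c: "c \<in> {..<length xs} \<rightarrow> carrier A" "(\<Oplus>\<^bsub>A\<^esub> i\<in>{..<length xs}. c i \<otimes>\<^bsub>A\<^esub> xs ! i) = \<zero>\<^bsub>A\<^esub>" for c
    proof -
      obtain c' where c': "c' \<in> {..<n} \<rightarrow> carrier R" "\<And>i. i < n \<Longrightarrow> c i = \<pi> (c' i)"
        "(\<Oplus>\<^bsub>A\<^esub> i\<in>{..<n}. c i \<otimes>\<^bsub>A\<^esub> xs ! i) = \<pi> (\<Oplus>i\<in>{..<n}. c' i \<otimes> x i)"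
        using lift[of c] c(1) unfolding n_def by blast
      have cc: "c' i \<in> carrier R" if "i < n" for i using c'(1) that by auto
      have sc: "(\<Oplus>i\<in>{..<n}. c' i \<otimes> x i) \<in> carrier R" using cc xc by (auto intro!: finsum_closed)
      then have "(\<Oplus>i\<in>{..<n}. c' i \<otimes> x i) \<in> J" using \<pi>_zero c'(3) c(2) unfolding n_def by metis
      then have "(\<Oplus>i\<in>{..<n}. c' i \<otimes> x i) \<in> I \<cdot> (Idl (x ` {..<n}))" using x(2) unfolding J_def n_def by simp
      then obtain b where b: "b \<in> {..<n} \<rightarrow> I" "(\<Oplus>i\<in>{..<n}. c' i \<otimes> x i) = (\<Oplus>i\<in>{..<n}. b i \<otimes> x i)"
        using ideal_prod_combination[of x n I] x(1) I(1) unfolding n_def by blast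
      have bI: "b i \<in> I" if "i < n" for i using b(1) that by auto
      have bc: "b i \<in> carrier R" if "i < n" for i using bI[OF that] I.Icarr by blast
      \<comment> \<open>Subtracting the combination with coefficients \<open>b\<close> in
        \<open>I\<close> turns the relation modulo \<open>I m\<close> into a true relation over
        \<open>R\<close>. Exactness makes it alternating, and the image of \<open>b\<close> is the
        remainder in \<open>L\<close>.\<close>
      define a where "a i = c' i \<ominus> b i" for i
      have ac: "a \<in> {..<n} \<rightarrow> carrier R" unfolding a_def using cc bc by auto
      have "(\<Oplus>i\<in>{..<n}. a i \<otimes> x i) = (\<Oplus>i\<in>{..<n}. c' i \<otimes> x i \<ominus> b i \<otimes> x i)"
        unfolding a_def using cc bc xc by (intro finsum_cong') (auto simp: a_minus_def l_distr l_minus)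
      also have "\<dots> = (\<Oplus>i\<in>{..<n}. c' i \<otimes> x i) \<ominus> (\<Oplus>i\<in>{..<n}. b i \<otimes> x i)"
        by (rule finsum_diff) (use cc bc xc in auto)
      also have "\<dots> = \<zero>" using sc unfolding b(2) by (simp add: a_minus_def r_neg)
      finally obtain T where T: "T \<in> {..<n} \<rightarrow> {..<n} \<rightarrow> carrier R"
        and aT: "\<And>i. i < n \<Longrightarrow> a i = (\<Oplus>j\<in>{..<n}. (T i j \<ominus> T j i) \<otimes> x j)"
        using exact_R ac unfolding koszul_exact_def by blast
      have Tc: "T i j \<in> carrier R" if "i < n" "j < n" for i j
        using funcset_mem[OF funcset_mem[OF T, of i], of j] that by simp
      define T' where "T' i j = \<pi> (T i j)" for i j
      have "c i \<ominus>\<^bsub>A\<^esub> (\<Oplus>\<^bsub>A\<^esub> j\<in>{..<n}. (T' i j \<ominus>\<^bsub>A\<^esub> T' j i) \<otimes>\<^bsub>A\<^esub> xs ! j) \<in> \<pi> ` I" if i: "i < n" for i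
      proof -
        have "\<pi> (a i) = (\<Oplus>\<^bsub>A\<^esub> j\<in>{..<n}. (\<pi> \<circ> (\<lambda>j. (T i j \<ominus> T j i) \<otimes> x j)) j)"
          unfolding aT[OF i] using Tc xc i by (intro \<pi>.hom_finsum) auto
        also have "\<dots> = (\<Oplus>\<^bsub>A\<^esub> j\<in>{..<n}. (T' i j \<ominus>\<^bsub>A\<^esub> T' j i) \<otimes>\<^bsub>A\<^esub> xs ! j)"
          by (rule A.finsum_cong') (use Tc xc xs' i in \<open>auto simp: T'_def a_minus_def\<close>)
        finally have "c i \<ominus>\<^bsub>A\<^esub> (\<Oplus>\<^bsub>A\<^esub> j\<in>{..<n}. (T' i j \<ominus>\<^bsub>A\<^esub> T' j i) \<otimes>\<^bsub>A\<^esub> xs ! j) = \<pi> (c' i) \<ominus>\<^bsub>A\<^esub> \<pi> (a i)"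
          using c'(2)[OF i] by simp
        also have "\<dots> = \<pi> (c' i \<ominus> a i)" using cc[OF i] bc[OF i] by (simp add: a_def a_minus_def)
        also have "c' i \<ominus> a i = b i" unfolding a_def using cc[OF i] bc[OF i] by algebra
        finally show ?thesis using bI[OF i] by simp
      qed
      moreover have "T' \<in> {..<n} \<rightarrow> {..<n} \<rightarrow> carrier A" using Tc unfolding T'_def by auto
      ultimately show ?thesis unfolding n_def by blast
    qed
  qed
  show ?thesis using koszul_admits_trivial_massey_operation unfolding A_def J_def .
qed

end

section \<open>Regular local rings\<close>

context local_ring
begin

lemma maximalideal_maximal_ideal: "maximalideal (maximal_ideal R) R"
  unfolding maximal_ideal_def by (rule theI') (rule ex1_maximal)

lemma maximal_ideal_unique: "maximalideal m R \<Longrightarrow> m = maximal_ideal R"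
  using ex1_maximal maximalideal_maximal_ideal by blast

text \<open>A nonunit generates a proper ideal, which the Noetherian property enlarges to a maximal
  ideal, and there is only one.\<close>

lemma notin_maximal_ideal_Units:
  assumes r: "r \<in> carrier R" "r \<notin> maximal_ideal R"
  shows "r \<in> Units R"
proof (rule ccontr)
  assume nu: "r \<notin> Units R"
  define \<A> where "\<A> = {J. ideal J R \<and> r \<in> J \<and> \<one> \<notin> J}"
  have "\<one> \<notin> PIdl r"
  proof
    assume "\<one> \<in> PIdl r"
    then obtain s where "s \<in> carrier R" "\<one> = s \<otimes> r" by (auto simp: cgenideal_def)
    then have "r \<in> Units R" using r(1) m_comm[of s r] by (auto simp: Units_def)
    then show False using nu by blast
  qed
  then have "PIdl r \<in> \<A>" using cgenideal_ideal[OF r(1)] cgenideal_self[OF r(1)] by (simp add: \<A>_def)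
  then have "\<A> \<noteq> {}" by blast
  then obtain M where M: "M \<in> \<A>" and max: "\<And>J. J \<in> \<A> \<Longrightarrow> M \<subseteq> J \<Longrightarrow> J = M"
    by (rule ideal_max_element[OF noetherian_ring_axioms]) (auto simp: \<A>_def)
  have "maximalideal M R"
  proof (rule maximalidealI)
    show "ideal M R" using M by (simp add: \<A>_def)
    show "carrier R \<noteq> M" using M by (auto simp: \<A>_def)
    fix J assume J: "ideal J R" "M \<subseteq> J" "J \<subseteq> carrier R"
    show "J = M \<or> J = carrier R"
    proof (cases "\<one> \<in> J")
      case True
      then show ?thesis using ideal.one_imp_carrier[OF J(1)] by blast
    next
      case False
      then have "J \<in> \<A>" using J M by (auto simp: \<A>_def)
      then show ?thesis using max J(2) by blast
    qed
  qed
  then have "M = maximal_ideal R" by (rule maximal_ideal_unique)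
  then show False using M r(2) by (simp add: \<A>_def)
qed

lemma proper_ideal_subset_maximal_ideal:
  assumes "ideal I R" "I \<noteq> carrier R"
  shows "I \<subseteq> maximal_ideal R"
proof
  interpret I: ideal I R by fact
  fix r assume r: "r \<in> I"
  show "r \<in> maximal_ideal R"
  proof (rule ccontr)
    assume "r \<notin> maximal_ideal R"
    then have "r \<in> Units R" using notin_maximal_ideal_Units r I.Icarr by blast
    then have "inv r \<otimes> r \<in> I" by (rule I.I_l_closed[OF r Units_inv_closed])
    moreover have "inv r \<otimes> r = \<one>" using \<open>r \<in> Units R\<close> by (rule Units_l_inv)
    ultimately show False using I.one_imp_carrier assms(2) by simp
  qed
qed

text \<open>Units of \<open>R\<close> map to units, so a proper ideal of the quotient consists of
  cosets of elements of \<open>m\<close>.\<close>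

lemma maximal_ideal_quotient:
  assumes J: "ideal J R" "J \<subseteq> maximal_ideal R"
  shows "maximal_ideal (R Quot J) = (+>) J ` maximal_ideal R"
proof -
  define A where "A = R Quot J"
  define m where "m = maximal_ideal R"
  interpret m: maximalideal m R unfolding m_def by (rule maximalideal_maximal_ideal)
  interpret A: cring A unfolding A_def by (rule ideal.quotient_is_cring[OF J(1) is_cring])
  have hom: "ring_hom_cring R A ((+>) J)" unfolding A_def by (rule ideal.rcos_ring_hom_cring[OF J(1) is_cring])
  interpret h: ring_hom_cring R A "(+>) J" by (rule hom)
  have carr: "carrier A = (+>) J ` carrier R" unfolding A_def by (rule quotient_carrier[OF J(1)])
  have mem: "J +> a \<in> (+>) J ` m \<longleftrightarrow> a \<in> m" if "a \<in> carrier R" for a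
    by (rule quotient_image_mem_iff[OF J(1) m.is_ideal _ that]) (use J(2) m_def in blast)
  have idn: "ideal ((+>) J ` m) A" unfolding A_def by (rule ring_ideal_imp_quot_ideal[OF J(1) m.is_ideal])
  have "\<one> \<notin> m" using m.one_imp_carrier m.I_notcarr by auto
  then have one: "\<one>\<^bsub>A\<^esub> \<notin> (+>) J ` m" using mem[of \<one>] by simp
  have small: "L \<subseteq> (+>) J ` m" if L: "ideal L A" "L \<noteq> carrier A" for L
  proof
    fix a assume a: "a \<in> L"
    then have "a \<in> carrier A" using ideal.Icarr[OF L(1)] by blast
    then obtain r where r: "r \<in> carrier R" "a = J +> r" using carr by blast
    have "r \<in> m"
    proof (rule ccontr)
      assume "r \<notin> m"
      then have u: "r \<in> Units R" using notin_maximal_ideal_Units r(1) unfolding m_def by blast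
      have "(J +> inv r) \<otimes>\<^bsub>A\<^esub> a = \<one>\<^bsub>A\<^esub>" using r u h.hom_mult[of "inv r" r] by simp
      moreover have "(J +> inv r) \<otimes>\<^bsub>A\<^esub> a \<in> L" using ideal.I_l_closed[OF L(1) a] h.hom_closed u by blast
      ultimately show False using ideal.one_imp_carrier[OF L(1)] L(2) by simp
    qed
    then show "a \<in> (+>) J ` m" using r by blast
  qed
  have max_n: "maximalideal ((+>) J ` m) A"
  proof (rule maximalidealI[OF idn])
    show "carrier A \<noteq> (+>) J ` m" using one by auto
    show "L = (+>) J ` m \<or> L = carrier A" if "ideal L A" "(+>) J ` m \<subseteq> L" for L
      using small that by blast
  qed
  have unique: "M = (+>) J ` m" if M: "maximalideal M A" for M
  proof -
    interpret M: maximalideal M A by fact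
    have "M \<subseteq> (+>) J ` m" using small[OF M.is_ideal] M.I_notcarr by auto
    then show ?thesis using M.I_maximal[OF idn] idn one additive_subgroup.a_subset[OF ideal.axioms(1)[OF idn]] by auto
  qed
  have "maximal_ideal A = (+>) J ` m"
    unfolding maximal_ideal_def using max_n unique by (rule the_equality)
  then show ?thesis unfolding A_def m_def .
qed

text \<open>If every chain had length at most 2, so would the supremum. Of a chain of length at
  least 3 the first four members are used, and of the fourth only that it lies in the maximal
  ideal.\<close>

lemma prime_chain_of_krull_dim:
  assumes "krull_dim R = 3"
  obtains P0 P1 P2 where "primeideal P0 R" "primeideal P1 R" "primeideal P2 R"
    "P0 \<subset> P1" "P1 \<subset> P2" "P2 \<subset> maximal_ideal R"
proof -
  let ?S = "{enat n | n. \<exists>P :: nat \<Rightarrow> 'a set. (\<forall>i\<le>n. primeideal (P i) R) \<and> (\<forall>i<n. P i \<subset> P (Suc i))}"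
  have "\<exists>n\<ge>3. enat n \<in> ?S"
  proof (rule ccontr)
    assume no: "\<not> (\<exists>n\<ge>3. enat n \<in> ?S)"
    have "Sup ?S \<le> enat 2"
    proof (rule Sup_least)
      fix k assume k: "k \<in> ?S"
      then obtain n where n: "k = enat n" by blast
      then have "\<not> n \<ge> 3" using no k by blast
      then show "k \<le> enat 2" using n by simp
    qed
    then show False using assms by (simp add: krull_dim_def numeral_eq_enat)
  qed
  then obtain n and P :: "nat \<Rightarrow> 'a set" where n: "n \<ge> 3" "\<And>i. i \<le> n \<Longrightarrow> primeideal (P i) R" "\<And>i. i < n \<Longrightarrow> P i \<subset> P (Suc i)"
    by auto
  have "P 3 \<noteq> carrier R" "ideal (P 3) R"
    using primeideal.I_notcarr[OF n(2)[OF n(1)]] primeideal.axioms(1)[OF n(2)[OF n(1)]] by auto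
  then have "P 3 \<subseteq> maximal_ideal R" using proper_ideal_subset_maximal_ideal by blast
  moreover have "P 0 \<subset> P 1" "P 1 \<subset> P 2" "P 2 \<subset> P 3"
    using n(3)[of 0] n(3)[of 1] n(3)[of 2] n(1) by (auto simp: numeral_eq_Suc)
  ultimately show ?thesis using that[of "P 0" "P 1" "P 2"] n(1,2) by auto
qed

lemma embedding_dim_generators:
  obtains Y where "Y \<subseteq> carrier R" "finite Y" "card Y = embedding_dim R" "Idl Y = maximal_ideal R"
proof -
  interpret m: maximalideal "maximal_ideal R" R by (rule maximalideal_maximal_ideal)
  obtain Y where "Y \<subseteq> carrier R" "finite Y" "maximal_ideal R = Idl Y" using finetely_gen[OF m.is_ideal] by blast
  then have "\<exists>n Y. Y \<subseteq> carrier R \<and> finite Y \<and> card Y = n \<and> Idl Y = maximal_ideal R" by blast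
  then have "\<exists>Y. Y \<subseteq> carrier R \<and> finite Y \<and> card Y = embedding_dim R \<and> Idl Y = maximal_ideal R"
    unfolding embedding_dim_def by (rule LeastI_ex)
  then show ?thesis using that by blast
qed

end

text \<open>By regularity the embedding dimension is 3 as well, so \<open>m\<close> has three
  generators, and a prime chain of length three makes them a regular sequence. The given list of
  generators of the quotient is lifted separately and need not be related to this triple.\<close>

lemma (in regular_local_ring) golod_local_quotient:
  assumes dim: "krull_dim R = 3" and I: "ideal I R" "I \<noteq> carrier R"
  shows "golod_local (R Quot (I \<cdot> maximal_ideal R))"
  unfolding golod_local_def
proof (intro allI impI)
  define m where "m = maximal_ideal R"
  define J where "J = I \<cdot> m"
  define A where "A = R Quot J"
  fix xs assume "minimal_generators (R Quot (I \<cdot> maximal_ideal R)) (maximal_ideal (R Quot (I \<cdot> maximal_ideal R))) xs"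
  then have xs: "minimal_generators A (maximal_ideal A) xs" unfolding A_def J_def m_def .
  interpret m: maximalideal m R unfolding m_def by (rule maximalideal_maximal_ideal)
  interpret I: ideal I R by fact
  have m_prime: "primeideal m R" by (rule maximalideal_prime[OF m.is_maximalideal])
  have one: "\<one> \<notin> m" using m.one_imp_carrier m.I_notcarr by auto
  have unit: "r \<in> Units R" if "r \<in> carrier R" "r \<notin> m" for r
    using notin_maximal_ideal_Units that unfolding m_def by blast
  have Im: "I \<subseteq> m" using proper_ideal_subset_maximal_ideal[OF I] by (simp add: m_def)
  have J: "ideal J R" unfolding J_def by (rule ideal_prod_is_ideal[OF I(1) m.is_ideal])
  have Jm: "J \<subseteq> m" using ideal_prod_subset_left[OF I(1) m.is_ideal] Im unfolding J_def by blast
  interpret A: cring A unfolding A_def by (rule ideal.quotient_is_cring[OF J is_cring])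
  have max_A: "maximal_ideal A = (+>) J ` m"
    unfolding A_def m_def using maximal_ideal_quotient[OF J] Jm m_def by simp
  have xs_props: "set xs \<subseteq> carrier A" "genideal A (set xs) = (+>) J ` m"
    using xs max_A by (auto simp: minimal_generators_def)
  have "(\<lambda>i. xs ! i) \<in> {..<length xs} \<rightarrow> carrier (R Quot J)" using xs_props(1) unfolding A_def by auto
  then obtain x where x: "\<And>i. i < length xs \<Longrightarrow> x i \<in> carrier R \<and> xs ! i = J +> x i"
    using quotient_lift[OF J, of "\<lambda>i. xs ! i"] by blast
  have xc: "x \<in> {..<length xs} \<rightarrow> carrier R" using x by auto
  have xm: "x ` {..<length xs} \<subseteq> m"
  proof
    fix r assume "r \<in> x ` {..<length xs}"
    then obtain i where i: "i < length xs" "r = x i" by blast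
    have "xs ! i \<in> (+>) J ` m" using A.genideal_self[OF xs_props(1)] xs_props(2) i(1) by auto
    then show "r \<in> m" using quotient_image_mem_iff[OF J m.is_ideal Jm, of r] x i by simp
  qed
  have x_sub: "x ` {..<length xs} \<subseteq> carrier R" using xc by auto
  have idx: "ideal (Idl (x ` {..<length xs})) R" by (rule genideal_ideal[OF x_sub])
  \<comment> \<open>The lifts generate \<open>m\<close> modulo \<open>J\<close>, and
    \<open>J = I m\<close> lies in \<open>m m\<close> because \<open>I\<close> is proper; Nakayama's
    lemma then makes them generate \<open>m\<close>.\<close>
  have "m \<subseteq> saturation m (Idl (x ` {..<length xs}) <+>\<^bsub>R\<^esub> (m \<cdot> m))"
  proof
    fix r assume r: "r \<in> m"
    have rc: "r \<in> carrier R" by (rule m.Icarr[OF r])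
    have "J +> r \<in> genideal A (set xs)" using r xs_props(2) by simp
    then obtain s where s: "\<And>i. i < length xs \<Longrightarrow> s i \<in> carrier R" "r \<ominus> (\<Oplus>i\<in>{..<length xs}. s i \<otimes> x i) \<in> J"
      using quotient_genideal_lift[OF J x rc] unfolding A_def by blast
    define t where "t = (\<Oplus>i\<in>{..<length xs}. s i \<otimes> x i)"
    have t_in: "t \<in> Idl (x ` {..<length xs})"
      unfolding t_def
    proof (rule finsum_in_ideal[OF idx])
      fix i assume "i \<in> {..<length xs}"
      then show "s i \<otimes> x i \<in> Idl (x ` {..<length xs})"
        using s genideal_self[OF x_sub] by (intro ideal.I_l_closed[OF idx]) auto
    qed simp
    have tc: "t \<in> carrier R" by (rule ideal.Icarr[OF idx t_in])
    have "r \<ominus> t \<in> J" unfolding t_def by (rule s(2))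
    moreover have "J \<subseteq> m \<cdot> m"
    proof
      fix j assume "j \<in> J"
      then show "j \<in> m \<cdot> m" unfolding J_def
        by (induction rule: ideal_prod.induct) (use Im in \<open>auto intro: ideal_prod.intros\<close>)
    qed
    ultimately have "r \<ominus> t \<in> m \<cdot> m" by blast
    moreover have "r = t \<oplus> (r \<ominus> t)" using rc tc by algebra
    ultimately have "r \<in> Idl (x ` {..<length xs}) <+>\<^bsub>R\<^esub> (m \<cdot> m)" using t_in unfolding set_add_def' by blast
    then show "r \<in> saturation m (Idl (x ` {..<length xs}) <+>\<^bsub>R\<^esub> (m \<cdot> m))"
      using rc one by (intro saturationI[of r \<one>]) auto
  qed
  then have "m \<subseteq> saturation m (Idl (x ` {..<length xs}))"
    by (rule nakayama_at_prime[OF noetherian_ring_axioms m_prime m.is_ideal idx])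
  also have "\<dots> \<subseteq> Idl (x ` {..<length xs})"
  proof
    fix r assume "r \<in> saturation m (Idl (x ` {..<length xs}))"
    then obtain s where s: "r \<in> carrier R" "s \<in> carrier R" "s \<notin> m" "s \<otimes> r \<in> Idl (x ` {..<length xs})"
      by (rule saturationE)
    then have sU: "s \<in> Units R" using unit by blast
    have "r = inv s \<otimes> (s \<otimes> r)" using s sU by (simp add: m_assoc[symmetric])
    also have "\<dots> \<in> Idl (x ` {..<length xs})" using s sU ideal.I_l_closed[OF idx] by blast
    finally show "r \<in> Idl (x ` {..<length xs})" .
  qed
  finally have gen: "Idl (x ` {..<length xs}) = m" using genideal_minimal[OF m.is_ideal xm] by blast
  obtain Y where Y: "Y \<subseteq> carrier R" "finite Y" "card Y = embedding_dim R" "Idl Y = m"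
    using embedding_dim_generators m_def by metis
  have "embedding_dim R = 3" using regular dim by (simp add: numeral_eq_enat)
  then obtain y1 y2 y3 where y: "Y = {y1, y2, y3}" using Y(3) by (metis card_3_iff)
  obtain P0 P1 P2 where P: "primeideal P0 R" "primeideal P1 R" "primeideal P2 R" "P0 \<subset> P1" "P1 \<subset> P2" "P2 \<subset> m"
    using prime_chain_of_krull_dim[OF dim] m_def by metis
  have yc: "y1 \<in> carrier R" "y2 \<in> carrier R" "y3 \<in> carrier R" using Y(1) y by auto
  have reg: "regular_sequence3 y1 y2 y3"
    by (rule regular_sequence3_of_prime_chain[OF noetherian_ring_axioms unit yc _ P(1-3) m_prime P(4-6)])
       (use Y(4) y in auto)
  have "admits_trivial_massey_operation (koszul (R Quot (I \<cdot> m)) xs)"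
  proof (rule quotient_by_product_admits_trivial_massey_operation[OF m.is_ideal one _ I(1) Im yc _ reg xc gen])
    show "\<exists>b\<in>carrier R. a \<otimes> b \<ominus> \<one> \<in> m" if "a \<in> carrier R" "a \<notin> m" for a
    proof -
      have "a \<in> Units R" using unit that by blast
      then have "a \<otimes> inv a \<ominus> \<one> = \<zero>" by (simp add: a_minus_def r_neg)
      then show ?thesis using \<open>a \<in> Units R\<close> m.zero_closed by (metis Units_inv_closed)
    qed
    show "Idl {y1, y2, y3} = m" using Y(4) y by simp
    show "xs ! i = (I \<cdot> m) +> x i" if "i < length xs" for i using x that unfolding J_def by blast
    show "c i \<in> m" if c: "c \<in> {..<length xs} \<rightarrow> carrier R" "(\<Oplus>i\<in>{..<length xs}. c i \<otimes> x i) \<in> I \<cdot> m" "i < length xs" for c i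
    proof (rule ccontr)
      assume "c i \<notin> m"
      then have "c i \<in> Units R" using unit c(1,3) by auto
      then show False
        using quotient_minimal_generators_no_unit_relation[OF J x xs[unfolded A_def], of c i] c unfolding J_def by blast
    qed
  qed
  then show "admits_trivial_massey_operation (koszul (R Quot (I \<cdot> maximal_ideal R)) xs)" unfolding m_def .
qed

section \<open>Polynomial rings\<close>

text \<open>\<open>E p\<close> and \<open>Lin p\<close> stand for the constant and the linear part of a polynomial \<open>p\<close>.\<close>

locale graded_linear_part = cring R for R (structure) +
  fixes E Lin :: "'a \<Rightarrow> 'a" and G :: "nat \<Rightarrow> 'a set" and y1 y2 y3 :: 'a
  assumes nontrivial: "\<one> \<noteq> \<zero>"
    and regular: "regular_sequence3 y1 y2 y3"
    and E_hom: "E \<in> ring_hom R R"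
    and E_E: "p \<in> carrier R \<Longrightarrow> E (E p) = E p"
    and E_Units: "p \<in> carrier R \<Longrightarrow> E p \<noteq> \<zero> \<Longrightarrow> E p \<in> Units R"
    and kernel_E: "Idl {y1, y2, y3} = {p \<in> carrier R. E p = \<zero>}"
    and Lin_closed: "p \<in> carrier R \<Longrightarrow> Lin p \<in> carrier R"
    and Lin_add: "p \<in> carrier R \<Longrightarrow> q \<in> carrier R \<Longrightarrow> Lin (p \<oplus> q) = Lin p \<oplus> Lin q"
    and Lin_mult: "p \<in> carrier R \<Longrightarrow> q \<in> carrier R \<Longrightarrow> Lin (p \<otimes> q) = E p \<otimes> Lin q \<oplus> E q \<otimes> Lin p"
    and G_closed: "G d \<subseteq> carrier R"
    and G_0: "p \<in> G 0 \<Longrightarrow> E p = p"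
    and G_positive: "p \<in> G d \<Longrightarrow> 1 \<le> d \<Longrightarrow> E p = \<zero>"
    and G_1: "p \<in> G 1 \<Longrightarrow> Lin p = p"
    and G_not_1: "p \<in> G d \<Longrightarrow> d \<noteq> 1 \<Longrightarrow> Lin p = \<zero>"
    and y_G: "{y1, y2, y3} \<subseteq> G 1"
begin

sublocale E: ring_hom_cring R R E
  by (intro ring_hom_cring.intro ring_hom_cring_axioms.intro is_cring E_hom)

lemma y_closed: "y1 \<in> carrier R" "y2 \<in> carrier R" "y3 \<in> carrier R"
  using y_G G_closed by auto

text \<open>Homogeneous elements of positive degree have no constant part, and conversely the kernel
  of \<open>E\<close> is generated by elements of degree one.\<close>

lemma irrelevant_ideal_eq: "irrelevant_ideal R G = {p \<in> carrier R. E p = \<zero>}"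
proof
  have id: "ideal {p \<in> carrier R. E p = \<zero>} R"
    unfolding kernel_E[symmetric] by (rule genideal_ideal) (use y_closed in simp)
  show "irrelevant_ideal R G \<subseteq> {p \<in> carrier R. E p = \<zero>}"
    unfolding irrelevant_ideal_def by (rule genideal_minimal[OF id]) (use G_closed G_positive in auto)
  have sub: "(\<Union>d\<in>{1..}. G d) \<subseteq> carrier R" using G_closed by blast
  have "{y1, y2, y3} \<subseteq> irrelevant_ideal R G"
    unfolding irrelevant_ideal_def using genideal_self[OF sub] y_G by auto
  then show "{p \<in> carrier R. E p = \<zero>} \<subseteq> irrelevant_ideal R G"
    unfolding kernel_E[symmetric] irrelevant_ideal_def by (rule genideal_minimal[OF genideal_ideal[OF sub]])
qed

lemma Lin_zero: "Lin \<zero> = \<zero>"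
proof -
  have "Lin \<zero> = Lin \<zero> \<oplus> Lin \<zero>" using Lin_add[of \<zero> \<zero>] by simp
  then show ?thesis using Lin_closed[of \<zero>] by (metis add.l_cancel_one zero_closed)
qed

lemma Lin_finsum:
  assumes "finite A" "f \<in> A \<rightarrow> carrier R"
  shows "Lin (\<Oplus>i\<in>A. f i) = (\<Oplus>i\<in>A. Lin (f i))"
  using assms
proof (induction A)
  case empty
  then show ?case by (simp add: Lin_zero)
next
  case (insert a A)
  then show ?case by (simp add: Lin_add Lin_closed Pi_def)
qed

text \<open>\<open>Lin\<close> obeys the product rule of a derivation at the origin, so it kills
  products of two elements without constant part. This is how \<open>I m \<subseteq> m^2\<close>
  enters the graded case.\<close>

lemma Lin_square_zero:
  assumes I: "I \<subseteq> {p \<in> carrier R. E p = \<zero>}" and r: "r \<in> I \<cdot> {p \<in> carrier R. E p = \<zero>}"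
  shows "r \<in> carrier R \<and> Lin r = \<zero>"
  using r
proof (induction r rule: ideal_prod.induct)
  case (prod p q)
  then have "p \<in> carrier R" "E p = \<zero>" "q \<in> carrier R" "E q = \<zero>" using I by auto
  then show ?case by (simp add: Lin_mult Lin_closed)
qed (simp add: Lin_add)

text \<open>A homogeneous element of degree zero is a constant, and a nonzero constant in
  \<open>I\<close> would make \<open>I\<close> the whole ring. Homogeneity is essential: in a
  polynomial ring \<open>1 + x\<close> generates a proper ideal that is not contained in the
  irrelevant one.\<close>

lemma proper_homogeneous_ideal:
  assumes hI: "homogeneous_ideal R G I" and proper: "I \<noteq> carrier R"
  shows "I \<subseteq> {p \<in> carrier R. E p = \<zero>}"
proof -
  have I: "ideal I R" "I = Idl (I \<inter> (\<Union>d. G d))" using hI by (auto simp: homogeneous_ideal_def)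
  have id: "ideal {p \<in> carrier R. E p = \<zero>} R"
    unfolding kernel_E[symmetric] by (rule genideal_ideal) (use y_closed in simp)
  have "I \<inter> (\<Union>d. G d) \<subseteq> {p \<in> carrier R. E p = \<zero>}"
  proof
    fix p assume p: "p \<in> I \<inter> (\<Union>d. G d)"
    then obtain d where d: "p \<in> G d" by blast
    have pc: "p \<in> carrier R" using d G_closed by blast
    have "E p = \<zero>"
    proof (cases "d = 0")
      case True
      show ?thesis
      proof (rule ccontr)
        assume "E p \<noteq> \<zero>"
        then have u: "p \<in> Units R" using E_Units[OF pc] G_0 d True by metis
        have "inv p \<otimes> p \<in> I" by (rule ideal.I_l_closed[OF I(1) _ Units_inv_closed[OF u]]) (use p in blast)
        then show False using ideal.one_imp_carrier[OF I(1)] proper Units_l_inv[OF u] by simp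
      qed
    next
      case False
      then show ?thesis using G_positive[OF d] by simp
    qed
    then show "p \<in> {p \<in> carrier R. E p = \<zero>}" using pc by blast
  qed
  then have "Idl (I \<inter> (\<Union>d. G d)) \<subseteq> {p \<in> carrier R. E p = \<zero>}" by (rule genideal_minimal[OF id])
  then show ?thesis using I(2) by simp
qed

text \<open>Linear parts take the place of Nakayama's lemma. A homogeneous lift of a generator is
  either linear or has no linear part; minimality excludes the latter, so the lifts are linear forms
  that generate \<open>m\<close>.\<close>

lemma golod_graded_quotient:
  assumes hI: "homogeneous_ideal R G I" and proper: "I \<noteq> carrier R"
  shows "golod_graded (R Quot (I \<cdot> irrelevant_ideal R G)) (quotient_grading R G (I \<cdot> irrelevant_ideal R G))"
  unfolding golod_graded_def
proof (intro allI impI, elim conjE)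
  define m where "m = irrelevant_ideal R G"
  define J where "J = I \<cdot> m"
  define A where "A = R Quot J"
  fix xs
  assume "minimal_generators (R Quot (I \<cdot> irrelevant_ideal R G))
      (irrelevant_ideal (R Quot (I \<cdot> irrelevant_ideal R G)) (quotient_grading R G (I \<cdot> irrelevant_ideal R G))) xs"
    and "set xs \<subseteq> (\<Union>d. quotient_grading R G (I \<cdot> irrelevant_ideal R G) d)"
  then have xs: "minimal_generators A (irrelevant_ideal A (quotient_grading R G J)) xs"
    and xs_hom: "set xs \<subseteq> (\<Union>d. quotient_grading R G J d)"
    unfolding A_def J_def m_def .
  have m_eq: "m = {p \<in> carrier R. E p = \<zero>}" unfolding m_def by (rule irrelevant_ideal_eq)
  have m_y: "Idl {y1, y2, y3} = m" unfolding m_eq by (rule kernel_E)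
  have m: "ideal m R" unfolding m_y[symmetric] by (rule genideal_ideal) (use y_closed in simp)
  interpret m: ideal m R by (rule m)
  have I: "ideal I R" using hI by (simp add: homogeneous_ideal_def)
  have Im: "I \<subseteq> m" unfolding m_eq by (rule proper_homogeneous_ideal[OF hI proper])
  have one: "\<one> \<notin> m" unfolding m_eq using nontrivial by simp
  have J: "ideal J R" unfolding J_def by (rule ideal_prod_is_ideal[OF I m])
  have Jm: "J \<subseteq> m" using ideal_prod_subset_left[OF I m] Im unfolding J_def by blast
  have Lin_J: "Lin r = \<zero>" if "r \<in> J" for r
    using Lin_square_zero[of I r] Im that unfolding J_def m_eq by blast
  interpret A: cring A unfolding A_def by (rule ideal.quotient_is_cring[OF J is_cring])
  have h_ring: "ring_hom_ring R A ((+>) J)" unfolding A_def by (rule ideal.rcos_ring_hom_ring[OF J])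
  have carr: "carrier A = (+>) J ` carrier R" unfolding A_def by (rule quotient_carrier[OF J])
  define n where "n = irrelevant_ideal A (quotient_grading R G J)"
  have xs_props: "distinct xs" "set xs \<subseteq> carrier A" "genideal A (set xs) = n"
      and no: "\<And>Y. Y \<subset> set xs \<Longrightarrow> genideal A Y \<noteq> n"
    using xs by (auto simp: minimal_generators_def n_def)
  have idn: "ideal ((+>) J ` m) A" unfolding A_def by (rule ring_ideal_imp_quot_ideal[OF J m])
  have n_m: "n \<subseteq> (+>) J ` m"
    unfolding n_def irrelevant_ideal_def
  proof (rule A.genideal_minimal[OF idn])
    show "(\<Union>d\<in>{1..}. quotient_grading R G J d) \<subseteq> (+>) J ` m"
      using G_closed G_positive unfolding quotient_grading_def m_eq by blast
  qed
  have grading_closed: "(\<Union>d\<in>{1..}. quotient_grading R G J d) \<subseteq> carrier A"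
    using G_closed unfolding quotient_grading_def carr by blast
  have y_n: "J +> y \<in> n" if "y \<in> {y1, y2, y3}" for y
  proof -
    have "J +> y \<in> (\<Union>d\<in>{1..}. quotient_grading R G J d)"
      using that y_G unfolding quotient_grading_def by auto
    then show ?thesis unfolding n_def irrelevant_ideal_def using A.genideal_self[OF grading_closed] by blast
  qed
  have "\<forall>i. \<exists>r. i < length xs \<longrightarrow> (\<exists>d. r \<in> G d) \<and> xs ! i = J +> r"
  proof
    fix i
    have "xs ! i \<in> (\<Union>d. quotient_grading R G J d)" if "i < length xs"
      using xs_hom nth_mem[OF that] by blast
    then show "\<exists>r. i < length xs \<longrightarrow> (\<exists>d. r \<in> G d) \<and> xs ! i = J +> r"
      unfolding quotient_grading_def by blast
  qed
  then obtain x where x: "\<And>i. i < length xs \<Longrightarrow> (\<exists>d. x i \<in> G d) \<and> xs ! i = J +> x i"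
    by - (drule choice, blast)
  have xc: "x i \<in> carrier R" if "i < length xs" for i using x[OF that] G_closed by blast
  have x': "x i \<in> carrier R \<and> xs ! i = J +> x i" if "i < length xs" for i using x xc that by blast
  have xm: "x i \<in> m" if i: "i < length xs" for i
  proof -
    have "xs ! i \<in> (+>) J ` m" using A.genideal_self[OF xs_props(2)] xs_props(3) n_m nth_mem[OF i] by blast
    then show ?thesis using quotient_image_mem_iff[OF J m Jm xc[OF i]] x[OF i] by simp
  qed
  have Ex: "E (x i) = \<zero>" if "i < length xs" for i using xm[OF that] unfolding m_eq by blast
  have Lin_sum: "Lin (\<Oplus>i\<in>{..<length xs}. c i \<otimes> x i) = (\<Oplus>i\<in>{..<length xs}. E (c i) \<otimes> Lin (x i))"
    if c: "\<And>i. i < length xs \<Longrightarrow> c i \<in> carrier R" for c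
  proof -
    have "Lin (\<Oplus>i\<in>{..<length xs}. c i \<otimes> x i) = (\<Oplus>i\<in>{..<length xs}. Lin (c i \<otimes> x i))"
      using c xc by (intro Lin_finsum) auto
    also have "\<dots> = (\<Oplus>i\<in>{..<length xs}. E (c i) \<otimes> Lin (x i))"
      using c xc Ex by (intro finsum_cong') (auto simp: Lin_mult Lin_closed)
    finally show ?thesis .
  qed
  \<comment> \<open>Taking linear parts in an expression of \<open>y\<close> by the lifts modulo
    \<open>J\<close> removes the element of \<open>J\<close>. As the lifts have no constant part,
    only the constant parts of the coefficients survive.\<close>
  have y_rep: "\<exists>c. (\<forall>i<length xs. c i \<in> carrier R) \<and> y = (\<Oplus>i\<in>{..<length xs}. E (c i) \<otimes> Lin (x i))"
    if y: "y \<in> {y1, y2, y3}" for y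
  proof -
    have yc: "y \<in> carrier R" using y y_closed by blast
    have "J +> y \<in> genideal A (set xs)" using y_n[OF y] xs_props(3) by simp
    then obtain s where s: "\<And>i. i < length xs \<Longrightarrow> s i \<in> carrier R" "y \<ominus> (\<Oplus>i\<in>{..<length xs}. s i \<otimes> x i) \<in> J"
      using quotient_genideal_lift[OF J x' yc] unfolding A_def by blast
    define t where "t = (\<Oplus>i\<in>{..<length xs}. s i \<otimes> x i)"
    have tc: "t \<in> carrier R" unfolding t_def using s xc by (auto intro!: finsum_closed)
    have "y \<ominus> t \<in> J" unfolding t_def by (rule s(2))
    then have "Lin (y \<ominus> t) = \<zero>" by (rule Lin_J)
    moreover have "y = t \<oplus> (y \<ominus> t)" using yc tc by algebra
    then have "Lin y = Lin t \<oplus> Lin (y \<ominus> t)" using Lin_add[of t "y \<ominus> t"] yc tc by simp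
    moreover have "Lin y = y" using y y_G by (intro G_1) auto
    ultimately have "y = Lin t" using Lin_closed[OF tc] by simp
    also have "\<dots> = (\<Oplus>i\<in>{..<length xs}. E (s i) \<otimes> Lin (x i))" unfolding t_def by (rule Lin_sum) (use s in auto)
    finally show ?thesis using s by blast
  qed
  have Lin_x: "Lin (x j) = x j" if j: "j < length xs" for j
  proof (rule ccontr)
    assume ne: "Lin (x j) \<noteq> x j"
    have other: "Lin (x i) = x i \<or> Lin (x i) = \<zero>" if "i < length xs" for i
      using x[OF that] G_1 G_not_1 by metis
    then have Lj: "Lin (x j) = \<zero>" using ne j by blast
    \<comment> \<open>A lift without linear part does not contribute to the expressions of
      \<open>y1\<close>, \<open>y2\<close>, \<open>y3\<close>, so the other generators already
      generate \<open>n\<close>, against minimality.\<close>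
    define Y where "Y = set xs - {xs ! j}"
    have Y: "Y \<subseteq> carrier A" "Y \<subset> set xs" using xs_props(2) j by (auto simp: Y_def)
    interpret Y: ideal "genideal A Y" A by (rule A.genideal_ideal[OF Y(1)])
    have idY: "ideal {r \<in> carrier R. J +> r \<in> genideal A Y} R"
      by (rule ring_hom_ring.ideal_vimage[OF h_ring Y.is_ideal])
    have "{y1, y2, y3} \<subseteq> {r \<in> carrier R. J +> r \<in> genideal A Y}"
    proof
      fix y assume "y \<in> {y1, y2, y3}"
      then obtain c where c: "\<And>i. i < length xs \<Longrightarrow> c i \<in> carrier R"
        and yc: "y = (\<Oplus>i\<in>{..<length xs}. E (c i) \<otimes> Lin (x i))" using y_rep by blast
      show "y \<in> {r \<in> carrier R. J +> r \<in> genideal A Y}"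
        unfolding yc
      proof (rule finsum_in_ideal[OF idY])
        fix i assume "i \<in> {..<length xs}"
        then have i: "i < length xs" by simp
        have "Lin (x i) \<in> {r \<in> carrier R. J +> r \<in> genideal A Y}"
        proof (cases "Lin (x i) = \<zero>")
          case True
          then show ?thesis using additive_subgroup.zero_closed[OF ideal.axioms(1)[OF idY]] by simp
        next
          case False
          then have "Lin (x i) = x i" "i \<noteq> j" using other[OF i] Lj by auto
          moreover have "xs ! i \<in> Y" using \<open>i \<noteq> j\<close> i j xs_props(1) by (auto simp: Y_def nth_eq_iff_index_eq)
          ultimately show ?thesis using A.genideal_self[OF Y(1)] x[OF i] xc[OF i] by auto
        qed
        then show "E (c i) \<otimes> Lin (x i) \<in> {r \<in> carrier R. J +> r \<in> genideal A Y}"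
          by (rule ideal.I_l_closed[OF idY]) (use c[OF i] in simp)
      qed simp
    qed
    then have "m \<subseteq> {r \<in> carrier R. J +> r \<in> genideal A Y}"
      unfolding m_y[symmetric] by (rule genideal_minimal[OF idY])
    then have "n \<subseteq> genideal A Y" using n_m by blast
    moreover have "genideal A Y \<subseteq> n" using A.subset_Idl_subset[OF xs_props(2)] Y(2) xs_props(3) by blast
    ultimately show False using no[OF Y(2)] by blast
  qed
  have gen: "Idl (x ` {..<length xs}) = m"
  proof
    show "Idl (x ` {..<length xs}) \<subseteq> m" by (rule genideal_minimal[OF m]) (use xm in blast)
    have x_sub: "x ` {..<length xs} \<subseteq> carrier R" using xc by blast
    have idx: "ideal (Idl (x ` {..<length xs})) R" by (rule genideal_ideal[OF x_sub])
    have "{y1, y2, y3} \<subseteq> Idl (x ` {..<length xs})"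
    proof
      fix y assume "y \<in> {y1, y2, y3}"
      then obtain c where c: "\<And>i. i < length xs \<Longrightarrow> c i \<in> carrier R"
        and yc: "y = (\<Oplus>i\<in>{..<length xs}. E (c i) \<otimes> Lin (x i))" using y_rep by blast
      show "y \<in> Idl (x ` {..<length xs})"
        unfolding yc
      proof (rule finsum_in_ideal[OF idx])
        fix i assume i: "i \<in> {..<length xs}"
        then show "E (c i) \<otimes> Lin (x i) \<in> Idl (x ` {..<length xs})"
          using Lin_x[of i] genideal_self[OF x_sub] c[of i] by (intro ideal.I_l_closed[OF idx]) auto
      qed simp
    qed
    then show "m \<subseteq> Idl (x ` {..<length xs})" unfolding m_y[symmetric] by (rule genideal_minimal[OF idx])
  qed
  have "admits_trivial_massey_operation (koszul (R Quot (I \<cdot> m)) xs)"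
  proof (rule quotient_by_product_admits_trivial_massey_operation[OF m one _ I Im y_closed m_y regular _ gen])
    show "\<exists>b\<in>carrier R. a \<otimes> b \<ominus> \<one> \<in> m" if a: "a \<in> carrier R" "a \<notin> m" for a
    proof -
      \<comment> \<open>The constant part of \<open>a\<close> is invertible and differs from
        \<open>a\<close> by an element of \<open>m\<close>, so its inverse is an inverse of
        \<open>a\<close> modulo \<open>m\<close>.\<close>
      have u: "E a \<in> Units R" using E_Units a unfolding m_eq by blast
      have "a \<ominus> E a \<in> m" unfolding m_eq using a(1) E_E by (simp add: a_minus_def r_neg)
      then have "inv (E a) \<otimes> (a \<ominus> E a) \<in> m" by (rule m.I_l_closed[OF _ Units_inv_closed[OF u]])
      moreover have "inv (E a) \<otimes> (a \<ominus> E a) = a \<otimes> inv (E a) \<ominus> inv (E a) \<otimes> E a"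
        using a(1) u by (simp add: a_minus_def r_distr r_minus m_comm)
      ultimately have "a \<otimes> inv (E a) \<ominus> \<one> \<in> m" using u by simp
      then show ?thesis using u by blast
    qed
    show "x \<in> {..<length xs} \<rightarrow> carrier R" using xc by blast
    show "xs ! i = (I \<cdot> m) +> x i" if "i < length xs" for i using x[OF that] unfolding J_def by blast
    show "c i \<in> m" if c: "c \<in> {..<length xs} \<rightarrow> carrier R" "(\<Oplus>i\<in>{..<length xs}. c i \<otimes> x i) \<in> I \<cdot> m" "i < length xs" for c i
    proof (rule ccontr)
      \<comment> \<open>Passing to the constant parts of the coefficients keeps the relation, since
        the lifts are linear and \<open>Lin\<close> vanishes on \<open>J\<close>; the coefficient
        outside \<open>m\<close> becomes a unit.\<close>
      assume "c i \<notin> m"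
      have cc: "c k \<in> carrier R" if "k < length xs" for k using c(1) that by blast
      have u: "E (c i) \<in> Units R" using E_Units[OF cc[OF c(3)]] \<open>c i \<notin> m\<close> cc[OF c(3)] unfolding m_eq by blast
      have "(\<Oplus>k\<in>{..<length xs}. E (c k) \<otimes> x k) = (\<Oplus>k\<in>{..<length xs}. E (c k) \<otimes> Lin (x k))"
        using cc xc Lin_x by (intro finsum_cong') auto
      also have "\<dots> = Lin (\<Oplus>k\<in>{..<length xs}. c k \<otimes> x k)" using Lin_sum[of c] cc by simp
      also have "\<dots> = \<zero>" using Lin_J c(2) unfolding J_def by blast
      finally have "(\<Oplus>k\<in>{..<length xs}. E (c k) \<otimes> x k) \<in> J"
        using additive_subgroup.zero_closed[OF ideal.axioms(1)[OF J]] by simp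
      then show False
        using quotient_minimal_generators_no_unit_relation[OF J x' xs[unfolded A_def], of "\<lambda>k. E (c k)" i] u cc c(3) by simp
    qed
  qed
  then show "admits_trivial_massey_operation (koszul (R Quot (I \<cdot> irrelevant_ideal R G)) xs)" unfolding m_def .
qed

end

section \<open>Univariate polynomials: constant coefficient and division by the variable\<close>

context UP_cring
begin

lemma coeff_mult_0: "p \<in> carrier P \<Longrightarrow> q \<in> carrier P \<Longrightarrow> up_ring.coeff P (p \<otimes>\<^bsub>P\<^esub> q) 0 = up_ring.coeff P p 0 \<otimes> up_ring.coeff P q 0"
  by simp

lemma coeff_mult_1:
  "p \<in> carrier P \<Longrightarrow> q \<in> carrier P \<Longrightarrow>
    up_ring.coeff P (p \<otimes>\<^bsub>P\<^esub> q) (Suc 0) = up_ring.coeff P p (Suc 0) \<otimes> up_ring.coeff P q 0 \<oplus> up_ring.coeff P p 0 \<otimes> up_ring.coeff P q (Suc 0)"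
  by (simp add: Pi_def)

lemma coeff_const_mult:
  "a \<in> carrier R \<Longrightarrow> p \<in> carrier P \<Longrightarrow> up_ring.coeff P (up_ring.monom P a 0 \<otimes>\<^bsub>P\<^esub> p) n = a \<otimes> up_ring.coeff P p n"
  by (simp only: monom_mult_is_smult coeff_smult)

lemma coeff_var_mult_0: "p \<in> carrier P \<Longrightarrow> up_ring.coeff P (up_ring.monom P \<one> 1 \<otimes>\<^bsub>P\<^esub> p) 0 = \<zero>"
  by simp

lemma coeff_var_mult_Suc: "p \<in> carrier P \<Longrightarrow> up_ring.coeff P (up_ring.monom P \<one> 1 \<otimes>\<^bsub>P\<^esub> p) (Suc n) = up_ring.coeff P p n"
  using coeff_monom_mult[of \<one> p 1 n] by simp

lemma coeff_0_hom: "(\<lambda>p. up_ring.coeff P p 0) \<in> ring_hom P R"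
  by (rule ring_hom_memI) auto

lemma const_plus_var_mult:
  assumes p: "p \<in> carrier P"
  shows "\<exists>q\<in>carrier P. p = up_ring.monom P (up_ring.coeff P p 0) 0 \<oplus>\<^bsub>P\<^esub> up_ring.monom P \<one> 1 \<otimes>\<^bsub>P\<^esub> q"
proof -
  \<comment> \<open>The quotient on division by the variable is the coefficient sequence shifted by
    one.\<close>
  define q where "q = (\<lambda>n. up_ring.coeff P p (Suc n))"
  have carrier_P: "carrier P = up R" unfolding P_def UP_def by simp
  have coeff_P: "up_ring.coeff P f = f" if "f \<in> up R" for f unfolding P_def UP_def using that by simp
  have p_up: "p \<in> up R" using p carrier_P by simp
  obtain b where b: "bound \<zero> b p" using R.bound_upD[OF p_up] by blast
  have q_up: "q \<in> up R"
  proof (rule mem_upI)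
    show "q n \<in> carrier R" for n unfolding q_def using p by simp
    have "bound \<zero> b q" using b unfolding q_def coeff_P[OF p_up] bound_def by auto
    then show "\<exists>n. bound \<zero> n q" by blast
  qed
  then have q: "q \<in> carrier P" using carrier_P by simp
  have cq: "up_ring.coeff P q n = up_ring.coeff P p (Suc n)" for n unfolding coeff_P[OF q_up] by (simp add: q_def)
  have "p = up_ring.monom P (up_ring.coeff P p 0) 0 \<oplus>\<^bsub>P\<^esub> up_ring.monom P \<one> 1 \<otimes>\<^bsub>P\<^esub> q"
  proof (rule up_eqI)
    fix n
    have "up_ring.coeff P (up_ring.monom P (up_ring.coeff P p 0) 0 \<oplus>\<^bsub>P\<^esub> up_ring.monom P \<one> 1 \<otimes>\<^bsub>P\<^esub> q) n =
        up_ring.coeff P (up_ring.monom P (up_ring.coeff P p 0) 0) n \<oplus> up_ring.coeff P (up_ring.monom P \<one> 1 \<otimes>\<^bsub>P\<^esub> q) n"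
      using p q by (intro coeff_add) simp_all
    also have "\<dots> = up_ring.coeff P p n"
    proof (cases n)
      case 0
      then show ?thesis using p q coeff_var_mult_0[OF q] by (simp del: coeff_mult)
    next
      case (Suc k)
      then show ?thesis using p q coeff_var_mult_Suc[OF q, of k] cq[of k] by (simp del: coeff_mult)
    qed
    finally show "up_ring.coeff P p n = up_ring.coeff P (up_ring.monom P (up_ring.coeff P p 0) 0 \<oplus>\<^bsub>P\<^esub> up_ring.monom P \<one> 1 \<otimes>\<^bsub>P\<^esub> q) n" by simp
  qed (use p q in simp_all)
  then show ?thesis using q by blast
qed

lemma var_mult_cancel:
  assumes p: "p \<in> carrier P" and eq: "up_ring.monom P \<one> 1 \<otimes>\<^bsub>P\<^esub> p = \<zero>\<^bsub>P\<^esub>"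
  shows "p = \<zero>\<^bsub>P\<^esub>"
proof (rule up_eqI)
  show "up_ring.coeff P p n = up_ring.coeff P \<zero>\<^bsub>P\<^esub> n" for n
    using coeff_var_mult_Suc[OF p, of n] eq by (simp del: coeff_mult)
qed (use p in simp_all)

end

section \<open>The polynomial ring in three variables\<close>

locale poly3_field = K: field K for K (structure)
begin

abbreviation S2 where "S2 \<equiv> UP K"
abbreviation S1 where "S1 \<equiv> UP S2"
abbreviation S0 where "S0 \<equiv> UP S1"

sublocale U2: UP_cring K S2 by unfold_locales simp
sublocale U1: UP_cring S2 S1 by (rule UP_cring.intro[OF U2.UP_cring]) simp
sublocale U0: UP_cring S1 S0 by (rule UP_cring.intro[OF U1.UP_cring]) simp

abbreviation co where "co \<equiv> poly3_coeff K"
text \<open>Each stage of the tower has its own constants and its own variable, so the second and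
  third variables of the full ring are \<open>c0 x1\<close> and \<open>c0 (c1 x2)\<close>.\<close>

abbreviation c0 where "c0 a \<equiv> up_ring.monom S0 a 0"
abbreviation c1 where "c1 a \<equiv> up_ring.monom S1 a 0"
abbreviation c2 where "c2 a \<equiv> up_ring.monom S2 a 0"
abbreviation x0 where "x0 \<equiv> up_ring.monom S0 \<one>\<^bsub>S1\<^esub> 1"
abbreviation x1 where "x1 \<equiv> up_ring.monom S1 \<one>\<^bsub>S2\<^esub> 1"
abbreviation x2 where "x2 \<equiv> up_ring.monom S2 \<one> 1"

definition const :: "'a \<Rightarrow> nat \<Rightarrow> nat \<Rightarrow> nat \<Rightarrow> 'a" where
  "const a = c0 (c1 (c2 a))"

definition const_part where "const_part p = const (co p 0 0 0)"

definition linear_part where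
  "linear_part p = const (co p 1 0 0) \<otimes>\<^bsub>S0\<^esub> x0 \<oplus>\<^bsub>S0\<^esub>
     (const (co p 0 1 0) \<otimes>\<^bsub>S0\<^esub> c0 x1 \<oplus>\<^bsub>S0\<^esub> const (co p 0 0 1) \<otimes>\<^bsub>S0\<^esub> c0 (c1 x2))"

lemma coeffs_closed: "p \<in> carrier S0 \<Longrightarrow> up_ring.coeff S0 p i \<in> carrier S1"
  "p \<in> carrier S0 \<Longrightarrow> up_ring.coeff S1 (up_ring.coeff S0 p i) j \<in> carrier S2"
  "p \<in> carrier S0 \<Longrightarrow> co p i j l \<in> carrier K"
  unfolding poly3_coeff_def
  by (blast intro: U0.coeff_closed U1.coeff_closed U2.coeff_closed)+

lemma vars_closed: "x2 \<in> carrier S2" "x1 \<in> carrier S1" "x0 \<in> carrier S0" "c1 x2 \<in> carrier S1"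
  "c0 x1 \<in> carrier S0" "c0 (c1 x2) \<in> carrier S0"
  by (intro U0.monom_closed U1.monom_closed U2.monom_closed U2.UP_one_closed U1.UP_one_closed K.one_closed)+

lemma const_closed: "a \<in> carrier K \<Longrightarrow> c2 a \<in> carrier S2" "a \<in> carrier K \<Longrightarrow> c1 (c2 a) \<in> carrier S1"
  "a \<in> carrier K \<Longrightarrow> const a \<in> carrier S0"
  unfolding const_def by (intro U0.monom_closed U1.monom_closed U2.monom_closed; assumption)+

lemma const_hom: "const \<in> ring_hom K S0"
proof -
  have "(c0 \<circ> (c1 \<circ> c2)) \<in> ring_hom K S0"
    by (intro ring_hom_trans[OF _ U0.const_ring_hom] ring_hom_trans[OF _ U1.const_ring_hom] U2.const_ring_hom)
  moreover have "c0 \<circ> (c1 \<circ> c2) = const" by (auto simp: const_def fun_eq_iff)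
  ultimately show ?thesis by simp
qed

lemma co_000_hom: "(\<lambda>p. co p 0 0 0) \<in> ring_hom S0 K"
proof -
  have "((\<lambda>p. up_ring.coeff S2 p 0) \<circ> ((\<lambda>p. up_ring.coeff S1 p 0) \<circ> (\<lambda>p. up_ring.coeff S0 p 0))) \<in> ring_hom S0 K"
    by (intro ring_hom_trans[OF _ U2.coeff_0_hom] ring_hom_trans[OF _ U1.coeff_0_hom] U0.coeff_0_hom)
  moreover have "((\<lambda>p. up_ring.coeff S2 p 0) \<circ> ((\<lambda>p. up_ring.coeff S1 p 0) \<circ> (\<lambda>p. up_ring.coeff S0 p 0))) = (\<lambda>p. co p 0 0 0)"
    by (auto simp: poly3_coeff_def fun_eq_iff)
  ultimately show ?thesis by simp
qed

lemma co_eqI: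
  assumes "p \<in> carrier S0" "q \<in> carrier S0" "\<And>i j l. co p i j l = co q i j l"
  shows "p = q"
proof (rule U0.up_eqI[OF _ assms(1,2)])
  fix i
  show "up_ring.coeff S0 p i = up_ring.coeff S0 q i"
  proof (rule U1.up_eqI[OF _ coeffs_closed(1)[OF assms(1)] coeffs_closed(1)[OF assms(2)]])
    fix j
    show "up_ring.coeff S1 (up_ring.coeff S0 p i) j = up_ring.coeff S1 (up_ring.coeff S0 q i) j"
      by (rule U2.up_eqI[OF _ coeffs_closed(2)[OF assms(1)] coeffs_closed(2)[OF assms(2)]])
        (rule assms(3)[unfolded poly3_coeff_def])
  qed
qed

lemma co_add:
  assumes "p \<in> carrier S0" "q \<in> carrier S0"
  shows "co (p \<oplus>\<^bsub>S0\<^esub> q) i j l = co p i j l \<oplus> co q i j l"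
  unfolding poly3_coeff_def U0.coeff_add[OF assms]
    U1.coeff_add[OF coeffs_closed(1)[OF assms(1)] coeffs_closed(1)[OF assms(2)]]
  by (rule U2.coeff_add[OF coeffs_closed(2)[OF assms(1)] coeffs_closed(2)[OF assms(2)]])

lemma co_const:
  assumes "a \<in> carrier K"
  shows "co (const a) i j l = (if i = 0 \<and> j = 0 \<and> l = 0 then a else \<zero>)"
  unfolding poly3_coeff_def const_def U0.coeff_monom[OF const_closed(2)[OF assms]]
  using U1.coeff_monom[OF const_closed(1)[OF assms]] U2.coeff_monom[OF assms]
  by (simp add: U1.coeff_zero U2.coeff_zero)

lemma co_const_mult:
  assumes a: "a \<in> carrier K" and p: "p \<in> carrier S0"
  shows "co (const a \<otimes>\<^bsub>S0\<^esub> p) i j l = a \<otimes> co p i j l"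
  unfolding poly3_coeff_def const_def U0.coeff_const_mult[OF const_closed(2)[OF a] p]
    U1.coeff_const_mult[OF const_closed(1)[OF a] coeffs_closed(1)[OF p]]
  by (rule U2.coeff_const_mult[OF a coeffs_closed(2)[OF p]])

lemma co_vars:
  "co x0 i j l = (if i = 1 \<and> j = 0 \<and> l = 0 then \<one> else \<zero>)"
  "co (c0 x1) i j l = (if i = 0 \<and> j = 1 \<and> l = 0 then \<one> else \<zero>)"
  "co (c0 (c1 x2)) i j l = (if i = 0 \<and> j = 0 \<and> l = 1 then \<one> else \<zero>)"
  unfolding poly3_coeff_def
    U0.coeff_monom[OF U1.UP_one_closed] U0.coeff_monom[OF vars_closed(2)] U0.coeff_monom[OF vars_closed(4)]
  using U1.coeff_monom[OF vars_closed(1)] U1.coeff_monom[OF U2.UP_one_closed] U2.coeff_monom[OF K.one_closed]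
  by (auto simp: U1.coeff_zero U2.coeff_zero U1.coeff_one U2.coeff_one)

lemma linear_part_closed: "p \<in> carrier S0 \<Longrightarrow> linear_part p \<in> carrier S0"
  unfolding linear_part_def
  by (intro U0.UP_a_closed U0.UP_mult_closed const_closed(3) coeffs_closed(3) vars_closed)

lemma co_linear_part:
  assumes p: "p \<in> carrier S0"
  shows "co (linear_part p) i j l = (if i + j + l = 1 then co p i j l else \<zero>)"
proof -
  note cl = const_closed(3)[OF coeffs_closed(3)[OF p]]
  have t: "const (co p 1 0 0) \<otimes>\<^bsub>S0\<^esub> x0 \<in> carrier S0" "const (co p 0 1 0) \<otimes>\<^bsub>S0\<^esub> c0 x1 \<in> carrier S0"
    "const (co p 0 0 1) \<otimes>\<^bsub>S0\<^esub> c0 (c1 x2) \<in> carrier S0"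
    by (intro U0.UP_mult_closed cl vars_closed)+
  have "co (linear_part p) i j l = co p 1 0 0 \<otimes> co x0 i j l \<oplus>
      (co p 0 1 0 \<otimes> co (c0 x1) i j l \<oplus> co p 0 0 1 \<otimes> co (c0 (c1 x2)) i j l)"
    unfolding linear_part_def
    using t by (simp only: co_add U0.UP_a_closed co_const_mult coeffs_closed(3)[OF p] vars_closed)
  also have "\<dots> = (if i + j + l = 1 then co p i j l else \<zero>)"
  proof -
    have c: "co p 1 0 0 \<in> carrier K" "co p 0 1 0 \<in> carrier K" "co p 0 0 1 \<in> carrier K"
      using coeffs_closed(3)[OF p] by auto
    consider "i = 1 \<and> j = 0 \<and> l = 0" | "i = 0 \<and> j = 1 \<and> l = 0" | "i = 0 \<and> j = 0 \<and> l = 1" | "i + j + l \<noteq> 1"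
      by linarith
    then show ?thesis unfolding co_vars using c by cases auto
  qed
  finally show ?thesis .
qed

text \<open>The constant coefficient of each stage is multiplicative, so the product rule arises
  only at the stage whose variable has exponent one.\<close>

lemma co_mult_linear:
  assumes p: "p \<in> carrier S0" and q: "q \<in> carrier S0"
  shows "co (p \<otimes>\<^bsub>S0\<^esub> q) 1 0 0 = co p 0 0 0 \<otimes> co q 1 0 0 \<oplus> co q 0 0 0 \<otimes> co p 1 0 0"
    "co (p \<otimes>\<^bsub>S0\<^esub> q) 0 1 0 = co p 0 0 0 \<otimes> co q 0 1 0 \<oplus> co q 0 0 0 \<otimes> co p 0 1 0"
    "co (p \<otimes>\<^bsub>S0\<^esub> q) 0 0 1 = co p 0 0 0 \<otimes> co q 0 0 1 \<oplus> co q 0 0 0 \<otimes> co p 0 0 1"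
proof -
  note p1 = coeffs_closed(1)[OF p] and q1 = coeffs_closed(1)[OF q]
  note p2 = coeffs_closed(2)[OF p] and q2 = coeffs_closed(2)[OF q]
  note p3 = coeffs_closed(3)[OF p, unfolded poly3_coeff_def] and q3 = coeffs_closed(3)[OF q, unfolded poly3_coeff_def]
  show "co (p \<otimes>\<^bsub>S0\<^esub> q) 1 0 0 = co p 0 0 0 \<otimes> co q 1 0 0 \<oplus> co q 0 0 0 \<otimes> co p 1 0 0"
    unfolding poly3_coeff_def One_nat_def U0.coeff_mult_1[OF p q]
      U1.coeff_add[OF U1.UP_mult_closed[OF p1 q1] U1.UP_mult_closed[OF p1 q1]]
      U1.coeff_mult_0[OF p1 q1] U2.coeff_add[OF U2.UP_mult_closed[OF p2 q2] U2.UP_mult_closed[OF p2 q2]]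
      U2.coeff_mult_0[OF p2 q2]
    using p3 q3 by (simp add: K.m_comm K.a_comm)
  show "co (p \<otimes>\<^bsub>S0\<^esub> q) 0 1 0 = co p 0 0 0 \<otimes> co q 0 1 0 \<oplus> co q 0 0 0 \<otimes> co p 0 1 0"
    unfolding poly3_coeff_def One_nat_def U0.coeff_mult_0[OF p q] U1.coeff_mult_1[OF p1 q1]
      U2.coeff_add[OF U2.UP_mult_closed[OF p2 q2] U2.UP_mult_closed[OF p2 q2]] U2.coeff_mult_0[OF p2 q2]
    using p3 q3 by (simp add: K.m_comm K.a_comm)
  show "co (p \<otimes>\<^bsub>S0\<^esub> q) 0 0 1 = co p 0 0 0 \<otimes> co q 0 0 1 \<oplus> co q 0 0 0 \<otimes> co p 0 0 1"
    unfolding poly3_coeff_def One_nat_def U0.coeff_mult_0[OF p q] U1.coeff_mult_0[OF p1 q1] U2.coeff_mult_1[OF p2 q2]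
    using p3 q3 by (simp add: K.m_comm K.a_comm)
qed

text \<open>Taking the constant coefficient at a stage is reduction modulo its variable. An equation
  modulo that variable thus moves to the next stage, where the next variable can be cancelled, and a
  vanishing constant coefficient means divisibility by the variable.\<close>

lemma regular_vars: "cring.regular_sequence3 S0 x0 (c0 x1) (c0 (c1 x2))"
  unfolding cring.regular_sequence3_def[OF U0.UP_cring]
proof (intro conjI ballI impI)
  fix p assume "p \<in> carrier S0" "x0 \<otimes>\<^bsub>S0\<^esub> p = \<zero>\<^bsub>S0\<^esub>"
  then show "p = \<zero>\<^bsub>S0\<^esub>" by (rule U0.var_mult_cancel)
next
  fix q a assume q: "q \<in> carrier S0" and a: "a \<in> carrier S0" and eq: "c0 x1 \<otimes>\<^bsub>S0\<^esub> q = x0 \<otimes>\<^bsub>S0\<^esub> a"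
  obtain q' where q': "q' \<in> carrier S0" "q = c0 (up_ring.coeff S0 q 0) \<oplus>\<^bsub>S0\<^esub> x0 \<otimes>\<^bsub>S0\<^esub> q'"
    using U0.const_plus_var_mult[OF q] by blast
  have "x1 \<otimes>\<^bsub>S1\<^esub> up_ring.coeff S0 q 0 = up_ring.coeff S0 (c0 x1 \<otimes>\<^bsub>S0\<^esub> q) 0"
    by (rule U0.coeff_const_mult[OF vars_closed(2) q, symmetric])
  also have "\<dots> = \<zero>\<^bsub>S1\<^esub>" unfolding eq by (rule U0.coeff_var_mult_0[OF a])
  finally have "up_ring.coeff S0 q 0 = \<zero>\<^bsub>S1\<^esub>" by (rule U1.var_mult_cancel[OF coeffs_closed(1)[OF q]])
  then have "q = x0 \<otimes>\<^bsub>S0\<^esub> q'"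
    using q' vars_closed(3) by (simp add: U0.monom_zero U0.UP_mult_closed)
  then show "\<exists>b\<in>carrier S0. q = x0 \<otimes>\<^bsub>S0\<^esub> b" using q'(1) by blast
next
  fix r a b assume r: "r \<in> carrier S0" and a: "a \<in> carrier S0" and b: "b \<in> carrier S0"
    and eq: "c0 (c1 x2) \<otimes>\<^bsub>S0\<^esub> r = x0 \<otimes>\<^bsub>S0\<^esub> a \<oplus>\<^bsub>S0\<^esub> c0 x1 \<otimes>\<^bsub>S0\<^esub> b"
  note r0 = coeffs_closed(1)[OF r, of 0] and b0 = coeffs_closed(1)[OF b, of 0]
  obtain r' where r': "r' \<in> carrier S0" "r = c0 (up_ring.coeff S0 r 0) \<oplus>\<^bsub>S0\<^esub> x0 \<otimes>\<^bsub>S0\<^esub> r'"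
    using U0.const_plus_var_mult[OF r] by blast
  obtain s where s: "s \<in> carrier S1"
      "up_ring.coeff S0 r 0 = c1 (up_ring.coeff S1 (up_ring.coeff S0 r 0) 0) \<oplus>\<^bsub>S1\<^esub> x1 \<otimes>\<^bsub>S1\<^esub> s"
    using U1.const_plus_var_mult[OF r0] by blast
  have "c1 x2 \<otimes>\<^bsub>S1\<^esub> up_ring.coeff S0 r 0 = up_ring.coeff S0 (c0 (c1 x2) \<otimes>\<^bsub>S0\<^esub> r) 0"
    by (rule U0.coeff_const_mult[OF vars_closed(4) r, symmetric])
  also have "\<dots> = up_ring.coeff S0 (x0 \<otimes>\<^bsub>S0\<^esub> a) 0 \<oplus>\<^bsub>S1\<^esub> up_ring.coeff S0 (c0 x1 \<otimes>\<^bsub>S0\<^esub> b) 0"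
    unfolding eq by (rule U0.coeff_add[OF U0.UP_mult_closed[OF vars_closed(3) a] U0.UP_mult_closed[OF vars_closed(5) b]])
  also have "\<dots> = x1 \<otimes>\<^bsub>S1\<^esub> up_ring.coeff S0 b 0"
    unfolding U0.coeff_var_mult_0[OF a] U0.coeff_const_mult[OF vars_closed(2) b]
    by (rule U1.UP_l_zero[OF U1.UP_mult_closed[OF vars_closed(2) b0]])
  finally have eq0: "c1 x2 \<otimes>\<^bsub>S1\<^esub> up_ring.coeff S0 r 0 = x1 \<otimes>\<^bsub>S1\<^esub> up_ring.coeff S0 b 0" .
  have "x2 \<otimes>\<^bsub>S2\<^esub> up_ring.coeff S1 (up_ring.coeff S0 r 0) 0 = up_ring.coeff S1 (c1 x2 \<otimes>\<^bsub>S1\<^esub> up_ring.coeff S0 r 0) 0"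
    by (rule U1.coeff_const_mult[OF vars_closed(1) r0, symmetric])
  also have "\<dots> = \<zero>\<^bsub>S2\<^esub>" unfolding eq0 by (rule U1.coeff_var_mult_0[OF b0])
  finally have "up_ring.coeff S1 (up_ring.coeff S0 r 0) 0 = \<zero>\<^bsub>S2\<^esub>"
    by (rule U2.var_mult_cancel[OF coeffs_closed(2)[OF r]])
  then have rs: "up_ring.coeff S0 r 0 = x1 \<otimes>\<^bsub>S1\<^esub> s"
    using s U1.UP_l_zero[OF U1.UP_mult_closed[OF vars_closed(2) s(1)]] by (simp only: U1.monom_zero)
  have cs: "c0 s \<in> carrier S0" using s(1) by (rule U0.monom_closed)
  have "r = c0 x1 \<otimes>\<^bsub>S0\<^esub> c0 s \<oplus>\<^bsub>S0\<^esub> x0 \<otimes>\<^bsub>S0\<^esub> r'"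
    using r'(2) ring_hom_mult[OF U0.const_ring_hom vars_closed(2) s(1)] unfolding rs by simp
  also have "\<dots> = x0 \<otimes>\<^bsub>S0\<^esub> r' \<oplus>\<^bsub>S0\<^esub> c0 x1 \<otimes>\<^bsub>S0\<^esub> c0 s"
    by (rule U0.UP_a_comm[OF U0.UP_mult_closed[OF vars_closed(5) cs] U0.UP_mult_closed[OF vars_closed(3) r'(1)]])
  finally show "\<exists>c\<in>carrier S0. \<exists>d\<in>carrier S0. r = x0 \<otimes>\<^bsub>S0\<^esub> c \<oplus>\<^bsub>S0\<^esub> c0 x1 \<otimes>\<^bsub>S0\<^esub> d"
    using r'(1) cs by blast
qed

text \<open>One variable is split off at each stage, and the remaining constant coefficient is
  carried to the full ring by the embeddings, which are ring homomorphisms.\<close>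

lemma minus_const_part_generated:
  assumes p: "p \<in> carrier S0"
  shows "\<exists>u\<in>carrier S0. \<exists>v\<in>carrier S0. \<exists>w\<in>carrier S0.
    p = const_part p \<oplus>\<^bsub>S0\<^esub> (x0 \<otimes>\<^bsub>S0\<^esub> u \<oplus>\<^bsub>S0\<^esub> (c0 x1 \<otimes>\<^bsub>S0\<^esub> v \<oplus>\<^bsub>S0\<^esub> c0 (c1 x2) \<otimes>\<^bsub>S0\<^esub> w))"
proof -
  note h0 = U0.const_ring_hom and h1 = U1.const_ring_hom
  obtain u where u: "u \<in> carrier S0" "p = c0 (up_ring.coeff S0 p 0) \<oplus>\<^bsub>S0\<^esub> x0 \<otimes>\<^bsub>S0\<^esub> u"
    using U0.const_plus_var_mult[OF p] by blast
  obtain v where v: "v \<in> carrier S1"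
      "up_ring.coeff S0 p 0 = c1 (up_ring.coeff S1 (up_ring.coeff S0 p 0) 0) \<oplus>\<^bsub>S1\<^esub> x1 \<otimes>\<^bsub>S1\<^esub> v"
    using U1.const_plus_var_mult[OF coeffs_closed(1)[OF p]] by blast
  obtain w where w: "w \<in> carrier S2"
      "up_ring.coeff S1 (up_ring.coeff S0 p 0) 0 = c2 (co p 0 0 0) \<oplus>\<^bsub>S2\<^esub> x2 \<otimes>\<^bsub>S2\<^esub> w"
    using U2.const_plus_var_mult[OF coeffs_closed(2)[OF p]] unfolding poly3_coeff_def by blast
  note k = coeffs_closed(3)[OF p, of 0 0 0]
  have cw: "c1 w \<in> carrier S1" "c0 (c1 w) \<in> carrier S0" and cv: "c0 v \<in> carrier S0"
    using w(1) v(1) by (auto intro: U1.monom_closed U0.monom_closed)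
  have e1: "c1 (up_ring.coeff S1 (up_ring.coeff S0 p 0) 0) = c1 (c2 (co p 0 0 0)) \<oplus>\<^bsub>S1\<^esub> c1 x2 \<otimes>\<^bsub>S1\<^esub> c1 w"
    unfolding w(2) ring_hom_add[OF h1 const_closed(1)[OF k] U2.UP_mult_closed[OF vars_closed(1) w(1)]]
      ring_hom_mult[OF h1 vars_closed(1) w(1)] ..
  have m1: "c1 x2 \<otimes>\<^bsub>S1\<^esub> c1 w \<in> carrier S1" by (rule U1.UP_mult_closed[OF vars_closed(4) cw(1)])
  have e0: "c0 (c1 (up_ring.coeff S1 (up_ring.coeff S0 p 0) 0)) = const_part p \<oplus>\<^bsub>S0\<^esub> c0 (c1 x2) \<otimes>\<^bsub>S0\<^esub> c0 (c1 w)"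
    unfolding e1 ring_hom_add[OF h0 const_closed(2)[OF k] m1] ring_hom_mult[OF h0 vars_closed(4) cw(1)]
      const_part_def const_def ..
  have c1c: "c1 (up_ring.coeff S1 (up_ring.coeff S0 p 0) 0) \<in> carrier S1" by (rule U1.monom_closed[OF coeffs_closed(2)[OF p]])
  have "c0 (up_ring.coeff S0 p 0) = c0 (c1 (up_ring.coeff S1 (up_ring.coeff S0 p 0) 0)) \<oplus>\<^bsub>S0\<^esub> c0 x1 \<otimes>\<^bsub>S0\<^esub> c0 v"
    using v(2) ring_hom_add[OF h0 c1c U1.UP_mult_closed[OF vars_closed(2) v(1)]]
      ring_hom_mult[OF h0 vars_closed(2) v(1)] by metis
  then have "p = (const_part p \<oplus>\<^bsub>S0\<^esub> c0 (c1 x2) \<otimes>\<^bsub>S0\<^esub> c0 (c1 w)) \<oplus>\<^bsub>S0\<^esub> c0 x1 \<otimes>\<^bsub>S0\<^esub> c0 v \<oplus>\<^bsub>S0\<^esub> x0 \<otimes>\<^bsub>S0\<^esub> u"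
    using u(2) unfolding e0 by simp
  also have "\<dots> = const_part p \<oplus>\<^bsub>S0\<^esub> (x0 \<otimes>\<^bsub>S0\<^esub> u \<oplus>\<^bsub>S0\<^esub> (c0 x1 \<otimes>\<^bsub>S0\<^esub> c0 v \<oplus>\<^bsub>S0\<^esub> c0 (c1 x2) \<otimes>\<^bsub>S0\<^esub> c0 (c1 w)))"
    using const_closed(3)[OF k] vars_closed u(1) cv cw(2) unfolding const_part_def
    by (simp only: U0.P.a_ac U0.P.m_closed U0.P.a_closed)
  finally show ?thesis using u(1) cv cw(2) by blast
qed

lemma poly3_graded_linear_part:
  "graded_linear_part S0 const_part linear_part (poly3_grading K) x0 (c0 x1) (c0 (c1 x2))"
proof -
  have E_hom: "const_part \<in> ring_hom S0 S0"
  proof -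
    have "const \<circ> (\<lambda>p. co p 0 0 0) \<in> ring_hom S0 S0" by (rule ring_hom_trans[OF co_000_hom const_hom])
    moreover have "const \<circ> (\<lambda>p. co p 0 0 0) = const_part" by (auto simp: const_part_def fun_eq_iff)
    ultimately show ?thesis by simp
  qed
  interpret E: ring_hom_cring S0 S0 const_part
    by (intro ring_hom_cring.intro ring_hom_cring_axioms.intro U0.UP_cring E_hom)
  interpret c: ring_hom_cring K S0 const
    by (intro ring_hom_cring.intro ring_hom_cring_axioms.intro U0.UP_cring K.is_cring const_hom)
  have const_zero: "const a = \<zero>\<^bsub>S0\<^esub> \<longleftrightarrow> a = \<zero>" if "a \<in> carrier K" for a
  proof
    assume z: "const a = \<zero>\<^bsub>S0\<^esub>"
    have "const \<zero> = \<zero>\<^bsub>S0\<^esub>" by simp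
    then have "co (const a) 0 0 0 = co (const \<zero>) 0 0 0" using z by simp
    then show "a = \<zero>" using co_const[OF that, of 0 0 0] co_const[OF K.zero_closed, of 0 0 0] by simp
  qed simp
  have E_zero: "const_part p = \<zero>\<^bsub>S0\<^esub> \<longleftrightarrow> co p 0 0 0 = \<zero>" if "p \<in> carrier S0" for p
    unfolding const_part_def using const_zero[OF coeffs_closed(3)[OF that]] .
  have co_E: "co (const_part p) i j l = (if i = 0 \<and> j = 0 \<and> l = 0 then co p 0 0 0 else \<zero>)" if "p \<in> carrier S0" for p i j l
    unfolding const_part_def by (rule co_const[OF coeffs_closed(3)[OF that]])
  have vars: "{x0, c0 x1, c0 (c1 x2)} \<subseteq> carrier S0" using vars_closed by simp
  have co_zero: "co \<zero>\<^bsub>S0\<^esub> i j l = \<zero>" for i j l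
    using co_const[OF K.zero_closed, of i j l] c.hom_zero by simp
  show ?thesis
  proof unfold_locales
    show "\<one>\<^bsub>S0\<^esub> \<noteq> \<zero>\<^bsub>S0\<^esub>" using const_zero[OF K.one_closed] c.hom_one K.one_not_zero by simp
    show "cring.regular_sequence3 S0 x0 (c0 x1) (c0 (c1 x2))" by (rule regular_vars)
    show "const_part \<in> ring_hom S0 S0" by (rule E_hom)
    show "const_part (const_part p) = const_part p" if p: "p \<in> carrier S0" for p
      unfolding const_part_def[of "const_part p"] using co_E[OF p, of 0 0 0] by (simp add: const_part_def)
    show "const_part p \<in> Units S0" if p: "p \<in> carrier S0" "const_part p \<noteq> \<zero>\<^bsub>S0\<^esub>" for p
    proof -
      have "co p 0 0 0 \<in> Units K" using E_zero[OF p(1)] p coeffs_closed(3)[OF p(1)] K.field_Units by simp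
      then have l: "const (inv co p 0 0 0) \<otimes>\<^bsub>S0\<^esub> const_part p = \<one>\<^bsub>S0\<^esub>" and cl: "const (inv co p 0 0 0) \<in> carrier S0"
        using c.hom_mult[of "inv co p 0 0 0" "co p 0 0 0"] by (auto simp: const_part_def)
      have pc: "const_part p \<in> carrier S0" using p by simp
      have "const_part p \<otimes>\<^bsub>S0\<^esub> const (inv co p 0 0 0) = \<one>\<^bsub>S0\<^esub>" using U0.P.m_comm[OF pc cl] l by simp
      then show ?thesis unfolding Units_def using l pc cl by blast
    qed
    show "linear_part p \<in> carrier S0" if "p \<in> carrier S0" for p using that by (rule linear_part_closed)
    show "linear_part (p \<oplus>\<^bsub>S0\<^esub> q) = linear_part p \<oplus>\<^bsub>S0\<^esub> linear_part q"
      if p: "p \<in> carrier S0" and q: "q \<in> carrier S0" for p q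
    proof (rule co_eqI)
      fix i j l
      show "co (linear_part (p \<oplus>\<^bsub>S0\<^esub> q)) i j l = co (linear_part p \<oplus>\<^bsub>S0\<^esub> linear_part q) i j l"
        unfolding co_linear_part[OF U0.P.a_closed[OF p q]] co_add[OF linear_part_closed[OF p] linear_part_closed[OF q]]
          co_linear_part[OF p] co_linear_part[OF q] co_add[OF p q] by simp
    qed (use p q linear_part_closed in auto)
    show "linear_part (p \<otimes>\<^bsub>S0\<^esub> q) = const_part p \<otimes>\<^bsub>S0\<^esub> linear_part q \<oplus>\<^bsub>S0\<^esub> const_part q \<otimes>\<^bsub>S0\<^esub> linear_part p"
      if p: "p \<in> carrier S0" and q: "q \<in> carrier S0" for p q
    proof (rule co_eqI)
      note lp = linear_part_closed[OF p] and lq = linear_part_closed[OF q]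
      note kp = coeffs_closed(3)[OF p] and kq = coeffs_closed(3)[OF q]
      fix i j l
      have "co (const_part p \<otimes>\<^bsub>S0\<^esub> linear_part q \<oplus>\<^bsub>S0\<^esub> const_part q \<otimes>\<^bsub>S0\<^esub> linear_part p) i j l =
          co p 0 0 0 \<otimes> co (linear_part q) i j l \<oplus> co q 0 0 0 \<otimes> co (linear_part p) i j l"
        unfolding const_part_def
          co_add[OF U0.P.m_closed[OF const_closed(3)[OF kp] lq] U0.P.m_closed[OF const_closed(3)[OF kq] lp]]
          co_const_mult[OF kp lq] co_const_mult[OF kq lp] ..
      also have "\<dots> = (if i + j + l = 1 then co p 0 0 0 \<otimes> co q i j l \<oplus> co q 0 0 0 \<otimes> co p i j l else \<zero>)"
        unfolding co_linear_part[OF p] co_linear_part[OF q] using kp kq by simp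
      also have "\<dots> = co (linear_part (p \<otimes>\<^bsub>S0\<^esub> q)) i j l"
      proof -
        consider "i = 1 \<and> j = 0 \<and> l = 0" | "i = 0 \<and> j = 1 \<and> l = 0" | "i = 0 \<and> j = 0 \<and> l = 1" | "i + j + l \<noteq> 1"
          by linarith
        then show ?thesis
          unfolding co_linear_part[OF U0.P.m_closed[OF p q]] using co_mult_linear[OF p q] by cases simp_all
      qed
      finally show "co (linear_part (p \<otimes>\<^bsub>S0\<^esub> q)) i j l =
          co (const_part p \<otimes>\<^bsub>S0\<^esub> linear_part q \<oplus>\<^bsub>S0\<^esub> const_part q \<otimes>\<^bsub>S0\<^esub> linear_part p) i j l" by simp
    qed (use p q linear_part_closed in auto)
    show "poly3_grading K d \<subseteq> carrier S0" for d by (auto simp: poly3_grading_def)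
    show "const_part p = p" if "p \<in> poly3_grading K 0" for p
    proof -
      have p: "p \<in> carrier S0" "\<And>i j l. i + j + l \<noteq> 0 \<Longrightarrow> co p i j l = \<zero>" using that by (auto simp: poly3_grading_def)
      show ?thesis by (rule co_eqI) (use p co_E[OF p(1)] in auto)
    qed
    show "const_part p = \<zero>\<^bsub>S0\<^esub>" if "p \<in> poly3_grading K d" "1 \<le> d" for p d
      using that E_zero[of p] by (auto simp: poly3_grading_def)
    show "linear_part p = p" if "p \<in> poly3_grading K 1" for p
    proof -
      have p: "p \<in> carrier S0" "\<And>i j l. i + j + l \<noteq> 1 \<Longrightarrow> co p i j l = \<zero>" using that by (auto simp: poly3_grading_def)
      show ?thesis by (rule co_eqI) (use p co_linear_part[OF p(1)] linear_part_closed in auto)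
    qed
    show "linear_part p = \<zero>\<^bsub>S0\<^esub>" if "p \<in> poly3_grading K d" "d \<noteq> 1" for p d
    proof -
      have p: "p \<in> carrier S0" "\<And>i j l. i + j + l \<noteq> d \<Longrightarrow> co p i j l = \<zero>" using that(1) by (auto simp: poly3_grading_def)
      show ?thesis by (rule co_eqI) (use p that(2) co_linear_part[OF p(1)] linear_part_closed co_zero in auto)
    qed
    show "{x0, c0 x1, c0 (c1 x2)} \<subseteq> poly3_grading K 1"
      using vars_closed co_vars by (auto simp: poly3_grading_def)
    show "genideal S0 {x0, c0 x1, c0 (c1 x2)} = {p \<in> carrier S0. const_part p = \<zero>\<^bsub>S0\<^esub>}"
    proof
      have "ideal {p \<in> carrier S0. const_part p = \<zero>\<^bsub>S0\<^esub>} S0"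
        by (rule U0.P.ideal_memI) auto
      then show "genideal S0 {x0, c0 x1, c0 (c1 x2)} \<subseteq> {p \<in> carrier S0. const_part p = \<zero>\<^bsub>S0\<^esub>}"
        by (rule U0.P.genideal_minimal) (use vars_closed E_zero co_vars in auto)
      interpret I: ideal "genideal S0 {x0, c0 x1, c0 (c1 x2)}" S0 by (rule U0.P.genideal_ideal[OF vars])
      have v: "x0 \<in> genideal S0 {x0, c0 x1, c0 (c1 x2)}" "c0 x1 \<in> genideal S0 {x0, c0 x1, c0 (c1 x2)}"
        "c0 (c1 x2) \<in> genideal S0 {x0, c0 x1, c0 (c1 x2)}"
        using U0.P.genideal_self[OF vars] by auto
      show "{p \<in> carrier S0. const_part p = \<zero>\<^bsub>S0\<^esub>} \<subseteq> genideal S0 {x0, c0 x1, c0 (c1 x2)}"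
      proof
        fix p assume "p \<in> {p \<in> carrier S0. const_part p = \<zero>\<^bsub>S0\<^esub>}"
        then have p: "p \<in> carrier S0" "const_part p = \<zero>\<^bsub>S0\<^esub>" by auto
        obtain u s t where ust: "u \<in> carrier S0" "s \<in> carrier S0" "t \<in> carrier S0"
          "p = const_part p \<oplus>\<^bsub>S0\<^esub> (x0 \<otimes>\<^bsub>S0\<^esub> u \<oplus>\<^bsub>S0\<^esub> (c0 x1 \<otimes>\<^bsub>S0\<^esub> s \<oplus>\<^bsub>S0\<^esub> c0 (c1 x2) \<otimes>\<^bsub>S0\<^esub> t))"
          using minus_const_part_generated[OF p(1)] by blast
        have "x0 \<otimes>\<^bsub>S0\<^esub> u \<oplus>\<^bsub>S0\<^esub> (c0 x1 \<otimes>\<^bsub>S0\<^esub> s \<oplus>\<^bsub>S0\<^esub> c0 (c1 x2) \<otimes>\<^bsub>S0\<^esub> t) \<in> genideal S0 {x0, c0 x1, c0 (c1 x2)}"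
          by (intro I.a_closed I.I_r_closed v ust)
        moreover have "p = x0 \<otimes>\<^bsub>S0\<^esub> u \<oplus>\<^bsub>S0\<^esub> (c0 x1 \<otimes>\<^bsub>S0\<^esub> s \<oplus>\<^bsub>S0\<^esub> c0 (c1 x2) \<otimes>\<^bsub>S0\<^esub> t)"
          using ust(4) unfolding p(2) using ust(1-3) vars_closed by (simp only: U0.P.l_zero U0.P.a_closed U0.P.m_closed)
        ultimately show "p \<in> genideal S0 {x0, c0 x1, c0 (c1 x2)}" by simp
      qed
    qed
  qed
qed

end

theorem theorem3p7:
  fixes R :: "('a, 'm) ring_scheme" and K :: "('b, 'n) ring_scheme"
  shows
    "(\<forall>I. regular_local_ring R \<and> krull_dim R = 3 \<and> ideal I R \<and> I \<noteq> carrier R \<longrightarrow>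
        golod_local (R Quot (I \<cdot>\<^bsub>R\<^esub> maximal_ideal R))) \<and>
     (\<forall>I. field K \<and> homogeneous_ideal (poly3 K) (poly3_grading K) I \<and> I \<noteq> carrier (poly3 K) \<longrightarrow>
        (let J = I \<cdot>\<^bsub>poly3 K\<^esub> irrelevant_ideal (poly3 K) (poly3_grading K)
         in golod_graded (poly3 K Quot J) (quotient_grading (poly3 K) (poly3_grading K) J)))"
proof (intro conjI allI impI; elim conjE)
  fix I
  assume "regular_local_ring R" "krull_dim R = 3" "ideal I R" "I \<noteq> carrier R"
  then show "golod_local (R Quot (I \<cdot>\<^bsub>R\<^esub> maximal_ideal R))"
    by (rule regular_local_ring.golod_local_quotient)
next
  fix I
  assume K: "field K" and I: "homogeneous_ideal (poly3 K) (poly3_grading K) I" "I \<noteq> carrier (poly3 K)"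
  interpret poly3_field K by (rule poly3_field.intro[OF K])
  show "let J = I \<cdot>\<^bsub>poly3 K\<^esub> irrelevant_ideal (poly3 K) (poly3_grading K)
     in golod_graded (poly3 K Quot J) (quotient_grading (poly3 K) (poly3_grading K) J)"
    unfolding Let_def by (rule graded_linear_part.golod_graded_quotient[OF poly3_graded_linear_part I])
qed

end
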